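(* Let $\Sigma$ be a linear time-and-space-invariant (LTSI) system with operators $(\mathcal{A},\mathcal{B},\mathcal{C})$ (see context), and suppose that $\Sigma$ is exponentially stable. Then $\Sigma$ is of relaxation type if and only if the Hankel operator $\mathcal{H}\in\mathscr{B}(L_2(\mathbb{R}_+,\mathcal{U}))$ (so $\mathcal{U}=\mathcal{Y}$) satisfies $\mathcal{H}\ge0$, i.e. $\mathcal{H}$ is self-adjoint and nonnegative.
   Context: **Notation.** All Hilbert spaces are complex; $\mathscr{B}(\mathcal{X},\mathcal{Y})$ denotes the bounded linear operators from $\mathcal{X}$ to $\mathcal{Y}$, and $\mathscr{B}(\mathcal{X})=\mathscr{B}(\mathcal{X},\mathcal{X})$. $\mathbb{R}_+$ and $\mathbb{Z}_+$ are the nonnegative reals and integers; $L_2(\mathbb{R}_+,\mathcal{X})$ is the Hilbert space of square integrable $\mathcal{X}$-valued functions. For a (possibly unbounded) densely defined operator $T$, $T\ge 0$ means that $T$ is self-adjoint and $\langle Tx,x\rangle\ge 0$ for all $x$ in its domain. **LTSI systems.** Let $\mathcal{U}=L_2(\mathbb{R}^s,\mathbb{C}^m)$, $\mathcal{Z}=L_2(\mathbb{R}^s,\mathbb{C}^n)$, $\mathcal{Y}=L_2(\mathbb{R}^s,\mathbb{C}^p)$. An LTSI system $\Sigma$ is given by $\frac{d}{dt}z(t)=\mathcal{A}z(t)+\mathcal{B}u(t)$, $y(t)=\mathcal{C}z(t)$, where $\mathcal{A}:\mathscr{D}(\mathcal{A})\subset\mathcal{Z}\to\mathcal{Z}$ is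 densely defined and is the infinitesimal generator of a $C_0$-semigroup $t\mapsto\exp(\mathcal{A}t)\in\mathscr{B}(\mathcal{Z})$, $\mathcal{B}\in\mathscr{B}(\mathcal{U},\mathcal{Z})$, $\mathcal{C}\in\mathscr{B}(\mathcal{Z},\mathcal{Y})$, and $\mathcal{A},\mathcal{B},\mathcal{C}$ are translation-invariant. Here, with $(\mathcal{T}_{\bar x}f)(x)=f(x+\bar x)$, an operator is translation-invariant if $\mathcal{T}_{\bar x}$ maps its domain into its domain and it commutes with translations by every $\bar x\in\mathbb{R}^s$. With $\mathcal{F}$ the unitary Fourier transform on $L_2(\mathbb{R}^s,\cdot)$ (extending $\hat f(\omega)=(2\pi)^{-s/2}\int_{\mathbb{R}^s}e^{-j\langle\omega,x\rangle}f(x)\,dx$), the operators $\mathcal{F}\mathcal{A}\mathcal{F}^*$, $\mathcal{F}\mathcal{B}\mathcal{F}^*$, $\mathcal{F}\mathcal{C}\mathcal{F}^*$ are multiplication operators by matrix-valued functions (symbols) $\omega\mapsto\hat A_\omega\in\mathbb{C}^{n\times n}$, $\hat B_\omega\in\mathbb{C}^{n\times m}$, $\hat C_\omega\in\mathbb{C}^{p\times n}$, and it is a standing assumption that these symbols are continuous in $\omega\in\mathbb{R}^s$. **Relaxation.** The impulse response of $\Sigma$ is $\mathcal{G}(t)=\mathcal{C}\exp(\mathcal{A}t)\mathcal{B}\in\mathscr{B}(\mathcal{U},\mathcal{Y})$, $t\in\mathbb{R}_+$. $\Sigma$ is of relaxation type if $\mathcal{U}=\mathcal{Y}$ (i.e.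 $m=p$) and $\mathcal{G}$ is completely monotone: its $k$-th strong derivative satisfies $(-1)^k\frac{d^k}{dt^k}\mathcal{G}(t)\ge 0$ for all $t>0$ and $k\in\mathbb{Z}_+$, where the $k$-th strong derivative at $t$ is the (densely defined, a priori possibly unbounded) operator $u\mapsto\frac{d^k}{dt^k}(\mathcal{G}(t)u)$, defined for those $u\in\mathcal{U}$ for which this derivative exists in the norm of $\mathcal{Y}$. **Exponential stability.** $\Sigma$ is exponentially stable if there exist $M,\alpha>0$ such that $\|\exp(\mathcal{A}t)\|\le Me^{-\alpha t}$ for all $t\in\mathbb{R}_+$. **Hankel operator.** For exponentially stable $\Sigma$, the Hankel operator is the bounded linear operator $\mathcal{H}:L_2(\mathbb{R}_+,\mathcal{U})\to L_2(\mathbb{R}_+,\mathcal{Y})$ given by $(\mathcal{H}v)(t)=\int_{\mathbb{R}_+}\mathcal{G}(t+\tau)v(\tau)\,d\tau$. *)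

theory Defs
  imports "HOL-Analysis.Analysis"
begin

section \<open>Complex Hilbert spaces\<close>

class complex_hilbert_space = banach +
  fixes scaleC :: "complex \<Rightarrow> 'a \<Rightarrow> 'a" (infixr \<open>*\<^sub>C\<close> 75)
    and cinner :: "'a \<Rightarrow> 'a \<Rightarrow> complex"
  assumes scaleC_add_right: "a *\<^sub>C (x + y) = a *\<^sub>C x + a *\<^sub>C y"
    and scaleC_add_left: "(a + b) *\<^sub>C x = a *\<^sub>C x + b *\<^sub>C x"
    and scaleC_scaleC: "a *\<^sub>C (b *\<^sub>C x) = (a * b) *\<^sub>C x"
    and scaleR_scaleC: "r *\<^sub>R x = complex_of_real r *\<^sub>C x"
    and cinner_commute: "cinner x y = cnj (cinner y x)"
    and cinner_add_left: "cinner (x + y) z = cinner x z + cinner y z"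
    and cinner_scaleC_left: "cinner (a *\<^sub>C x) y = a * cinner x y"
    and norm_eq_sqrt_cinner: "norm x = sqrt (Re (cinner x x))"
begin

lemma cinner_add_right: "cinner x (y + z) = cinner x y + cinner x z"
  by (metis cinner_commute cinner_add_left complex_cnj_add)

lemma cinner_scaleC_right: "cinner x (a *\<^sub>C y) = cnj a * cinner x y"
  by (metis cinner_commute cinner_scaleC_left complex_cnj_mult)

lemma norm_sq_cinner: "(norm x)\<^sup>2 = Re (cinner x x)"
proof -
  have "0 \<le> sqrt (Re (cinner x x))" using norm_eq_sqrt_cinner[of x] norm_ge_zero[of x] by simp
  then have "0 \<le> Re (cinner x x)" by simp
  then show ?thesis by (simp add: norm_eq_sqrt_cinner)
qed

lemma Im_cinner_self: "Im (cinner x x) = 0"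
  by (metis cinner_commute complex_cnj_cancel_iff Reals_cnj_iff complex_is_Real_iff)

lemma norm_scaleC: "norm (a *\<^sub>C x) = cmod a * norm x"
proof -
  have "cinner (a *\<^sub>C x) (a *\<^sub>C x) = complex_of_real ((cmod a)\<^sup>2) * cinner x x"
    by (simp only: cinner_scaleC_left cinner_scaleC_right mult.assoc[symmetric]
        complex_norm_square mult.commute[of "cnj a"])
  then have "(norm (a *\<^sub>C x))\<^sup>2 = (cmod a * norm x)\<^sup>2"
    unfolding power_mult_distrib norm_sq_cinner by simp
  then show ?thesis by (simp add: power2_eq_iff_nonneg)
qed

lemma cinner_polarization:
  "cinner x y = complex_of_real (((norm (x + y))\<^sup>2 - (norm x)\<^sup>2 - (norm y)\<^sup>2) / 2)
     + \<i> * complex_of_real (((norm (x + \<i> *\<^sub>C y))\<^sup>2 - (norm x)\<^sup>2 - (norm (\<i> *\<^sub>C y))\<^sup>2) / 2)"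
proof (rule complex_eqI)
  have c: "Re (cinner y x) = Re (cinner x y)" "Im (cinner y x) = - Im (cinner x y)"
    by (subst cinner_commute; simp)+
  show "Re (cinner x y) = Re (complex_of_real (((norm (x + y))\<^sup>2 - (norm x)\<^sup>2 - (norm y)\<^sup>2) / 2)
     + \<i> * complex_of_real (((norm (x + \<i> *\<^sub>C y))\<^sup>2 - (norm x)\<^sup>2 - (norm (\<i> *\<^sub>C y))\<^sup>2) / 2))"
    using c by (simp add: norm_sq_cinner cinner_add_left cinner_add_right)
  show "Im (cinner x y) = Im (complex_of_real (((norm (x + y))\<^sup>2 - (norm x)\<^sup>2 - (norm y)\<^sup>2) / 2)
     + \<i> * complex_of_real (((norm (x + \<i> *\<^sub>C y))\<^sup>2 - (norm x)\<^sup>2 - (norm (\<i> *\<^sub>C y))\<^sup>2) / 2))"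
    using c by (simp add: norm_sq_cinner cinner_add_left cinner_add_right cinner_scaleC_left
        cinner_scaleC_right)
qed

end

lemma scaleC_minus1: "(-1) *\<^sub>C x = - x"
  using scaleR_scaleC[of "-1" x] by simp

instantiation complex :: complex_hilbert_space
begin

definition scaleC_complex :: "complex \<Rightarrow> complex \<Rightarrow> complex"
  where "scaleC_complex a x = a * x"

definition cinner_complex :: "complex \<Rightarrow> complex \<Rightarrow> complex"
  where "cinner_complex x y = x * cnj y"

instance
proof
  fix x y z a b :: complex and r :: real
  show "a *\<^sub>C (x + y) = a *\<^sub>C x + a *\<^sub>C y" "(a + b) *\<^sub>C x = a *\<^sub>C x + b *\<^sub>C x"
    "a *\<^sub>C (b *\<^sub>C x) = (a * b) *\<^sub>C x"
    by (simp_all add: scaleC_complex_def distrib_left distrib_right)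
  show "r *\<^sub>R x = complex_of_real r *\<^sub>C x"
    by (simp add: scaleC_complex_def scaleR_conv_of_real)
  show "cinner x y = cnj (cinner y x)" by (simp add: cinner_complex_def)
  show "cinner (x + y) z = cinner x z + cinner y z" "cinner (a *\<^sub>C x) y = a * cinner x y"
    by (simp_all add: scaleC_complex_def cinner_complex_def distrib_right)
  show "norm x = sqrt (Re (cinner x x))"
    by (simp add: cinner_complex_def cmod_def power2_eq_square)
qed

end

instantiation vec :: (complex_hilbert_space, finite) complex_hilbert_space
begin

definition scaleC_vec :: "complex \<Rightarrow> 'a ^ 'b \<Rightarrow> 'a ^ 'b"
  where "scaleC_vec a x = (\<chi> i. a *\<^sub>C (x $ i))"

definition cinner_vec :: "'a ^ 'b \<Rightarrow> 'a ^ 'b \<Rightarrow> complex"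
  where "cinner_vec x y = (\<Sum>i\<in>UNIV. cinner (x $ i) (y $ i))"

instance
proof
  fix x y z :: "'a ^ 'b" and a b :: complex and r :: real
  show "a *\<^sub>C (x + y) = a *\<^sub>C x + a *\<^sub>C y" "(a + b) *\<^sub>C x = a *\<^sub>C x + b *\<^sub>C x"
    "a *\<^sub>C (b *\<^sub>C x) = (a * b) *\<^sub>C x" "r *\<^sub>R x = complex_of_real r *\<^sub>C x"
    by (simp_all add: scaleC_vec_def vec_eq_iff scaleC_add_right scaleC_add_left scaleC_scaleC
        scaleR_scaleC)
  show "cinner x y = cnj (cinner y x)"
    unfolding cinner_vec_def cnj_sum by (intro sum.cong refl cinner_commute)
  show "cinner (x + y) z = cinner x z + cinner y z"
    by (simp add: cinner_vec_def cinner_add_left sum.distrib)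
  show "cinner (a *\<^sub>C x) y = a * cinner x y"
    by (simp add: cinner_vec_def scaleC_vec_def cinner_scaleC_left sum_distrib_left)
  show "norm x = sqrt (Re (cinner x x))"
    by (simp add: norm_vec_def L2_set_def cinner_vec_def norm_sq_cinner)
qed

end

section \<open>Square integrable functions\<close>

definition L2_fun :: "'a measure \<Rightarrow> ('a \<Rightarrow> 'b::{complex_hilbert_space, second_countable_topology}) set"
  where "L2_fun M = {f \<in> borel_measurable M. integrable M (\<lambda>x. (norm (f x))\<^sup>2)}"

definition L2_eq :: "'a measure \<Rightarrow> ('a \<Rightarrow> 'b::{complex_hilbert_space, second_countable_topology}) \<Rightarrow> ('a \<Rightarrow> 'b) \<Rightarrow> bool"
  where "L2_eq M f g \<longleftrightarrow> f \<in> L2_fun M \<and> g \<in> L2_fun M \<and> (AE x in M. f x = g x)"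

definition L2_cinner :: "'a measure \<Rightarrow> ('a \<Rightarrow> 'b::{complex_hilbert_space, second_countable_topology}) \<Rightarrow> ('a \<Rightarrow> 'b) \<Rightarrow> complex"
  where "L2_cinner M f g = (\<integral>x. cinner (f x) (g x) \<partial>M)"

definition L2_norm :: "'a measure \<Rightarrow> ('a \<Rightarrow> 'b::{complex_hilbert_space, second_countable_topology}) \<Rightarrow> real"
  where "L2_norm M f = sqrt (\<integral>x. (norm (f x))\<^sup>2 \<partial>M)"

lemma L2_funD [measurable_dest]: "f \<in> L2_fun M \<Longrightarrow> f \<in> borel_measurable M"
  and L2_fun_integrable: "f \<in> L2_fun M \<Longrightarrow> integrable M (\<lambda>x. (norm (f x))\<^sup>2)"
  by (auto simp: L2_fun_def)

lemma norm_add_sq_le: "(norm (x + y))\<^sup>2 \<le> 2 * (norm x)\<^sup>2 + 2 * (norm y)\<^sup>2"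
proof -
  have "(norm (x + y))\<^sup>2 \<le> (norm x + norm y)\<^sup>2"
    by (intro power_mono norm_triangle_ineq norm_ge_zero)
  also have "\<dots> \<le> 2 * (norm x)\<^sup>2 + 2 * (norm y)\<^sup>2"
    using sum_squares_ge_zero[of "norm x - norm y" 0]
    by (simp add: power2_eq_square algebra_simps)
  finally show ?thesis .
qed

lemma continuous_scaleC: "continuous_on UNIV (\<lambda>x::'b::complex_hilbert_space. a *\<^sub>C x)"
proof -
  have "bounded_linear (\<lambda>x::'b. a *\<^sub>C x)"
  proof (rule bounded_linear_intro[where K="cmod a"])
    show "a *\<^sub>C (r *\<^sub>R x) = r *\<^sub>R (a *\<^sub>C x)" for r and x :: 'b
      by (simp add: scaleR_scaleC scaleC_scaleC mult.commute)
  qed (simp_all add: scaleC_add_right norm_scaleC mult.commute)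
  then show ?thesis by (rule linear_continuous_on)
qed

lemma borel_measurable_scaleC [measurable (raw)]:
  fixes f :: "'a \<Rightarrow> 'b::{complex_hilbert_space, second_countable_topology}"
  assumes "f \<in> borel_measurable M" shows "(\<lambda>x. a *\<^sub>C f x) \<in> borel_measurable M"
  using measurable_compose[OF assms borel_measurable_continuous_onI[OF continuous_scaleC]] .

lemma L2_fun_zero: "(\<lambda>_. 0) \<in> L2_fun M"
  by (simp add: L2_fun_def)

lemma L2_fun_add:
  assumes "f \<in> L2_fun M" "g \<in> L2_fun M" shows "(\<lambda>x. f x + g x) \<in> L2_fun M"
proof -
  note [measurable] = assms[THEN L2_funD]
  have "integrable M (\<lambda>x. (norm (f x + g x))\<^sup>2)"
  proof (rule Bochner_Integration.integrable_bound)
    show "integrable M (\<lambda>x. 2 * (norm (f x))\<^sup>2 + 2 * (norm (g x))\<^sup>2)"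
      using assms[THEN L2_fun_integrable] by simp
  qed (auto simp: norm_add_sq_le)
  then show ?thesis by (simp add: L2_fun_def)
qed

lemma L2_fun_scaleC: "f \<in> L2_fun M \<Longrightarrow> (\<lambda>x. a *\<^sub>C f x) \<in> L2_fun M"
  by (auto simp: L2_fun_def norm_scaleC power_mult_distrib intro: borel_measurable_scaleC)

lemma L2_fun_minus: "f \<in> L2_fun M \<Longrightarrow> (\<lambda>x. - f x) \<in> L2_fun M"
  by (simp add: L2_fun_def)

lemma L2_fun_diff:
  assumes "f \<in> L2_fun M" "g \<in> L2_fun M" shows "(\<lambda>x. f x - g x) \<in> L2_fun M"
  using L2_fun_add[OF assms(1) L2_fun_minus[OF assms(2)]] by simp

lemma L2_eq_refl: "L2_eq M f f \<longleftrightarrow> f \<in> L2_fun M"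
  by (auto simp: L2_eq_def)

lemma part_equivp_L2_eq: "part_equivp (L2_eq M)"
proof (rule part_equivpI)
  show "\<exists>x. L2_eq M x x" using L2_fun_zero by (auto simp: L2_eq_def)
  show "symp (L2_eq M)" by (auto simp: L2_eq_def symp_def eq_commute)
  show "transp (L2_eq M)"
    unfolding transp_def L2_eq_def
  proof (intro allI impI conjI; (elim conjE)?)
    fix x y z assume "AE u in M. x u = y u" "AE u in M. y u = z u"
    then show "AE u in M. x u = z u" by eventually_elim simp
  qed auto
qed

lemma L2_cinner_integrable:
  assumes "f \<in> L2_fun M" "g \<in> L2_fun M"
  shows "integrable M (\<lambda>x. cinner (f x) (g x))"
  unfolding cinner_polarization
  using assms by (intro Bochner_Integration.integrable_add Bochner_Integration.integrable_diff
      integrable_mult_right integrable_of_real integrable_divide L2_fun_integrable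
      L2_fun_add L2_fun_scaleC)

lemma L2_norm_nonneg: "0 \<le> L2_norm M f"
  by (simp add: L2_norm_def)

lemma L2_norm_sq: "(L2_norm M f)\<^sup>2 = (\<integral>x. (norm (f x))\<^sup>2 \<partial>M)"
  by (simp add: L2_norm_def)

lemma L2_norm_cinner:
  assumes "f \<in> L2_fun M" shows "L2_norm M f = sqrt (Re (L2_cinner M f f))"
  unfolding L2_norm_def L2_cinner_def norm_sq_cinner
    integral_Re[OF L2_cinner_integrable[OF assms assms]] ..

lemma L2_norm_eq_0_iff:
  assumes "f \<in> L2_fun M" shows "L2_norm M f = 0 \<longleftrightarrow> (AE x in M. f x = 0)"
  using integral_nonneg_eq_0_iff_AE[OF L2_fun_integrable[OF assms]] by (simp add: L2_norm_def)

lemma add_sq_le_weighted: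
  fixes a b t :: real
  assumes "0 < t" shows "(a + b)\<^sup>2 \<le> (1 + t) * a\<^sup>2 + (1 + 1/t) * b\<^sup>2"
proof -
  have "0 \<le> (t * a - b)\<^sup>2 / t" using assms by simp
  also have "\<dots> = t * a\<^sup>2 - 2 * a * b + b\<^sup>2 / t"
    using assms by (simp add: power2_eq_square field_simps)
  finally show ?thesis by (simp add: power2_eq_square algebra_simps)
qed

lemma L2_norm_cong_AE:
  assumes "L2_eq M f g" shows "L2_norm M f = L2_norm M g"
proof -
  have [measurable]: "f \<in> borel_measurable M" "g \<in> borel_measurable M"
    and ae: "AE x in M. f x = g x"
    using assms by (auto simp: L2_eq_def L2_fun_def)
  have "(\<integral>x. (norm (f x))\<^sup>2 \<partial>M) = (\<integral>x. (norm (g x))\<^sup>2 \<partial>M)"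
  proof (rule integral_cong_AE)
    show "AE x in M. (norm (f x))\<^sup>2 = (norm (g x))\<^sup>2"
      using ae by eventually_elim simp
  qed measurable
  then show ?thesis by (simp add: L2_norm_def)
qed

lemma L2_norm_triangle:
  assumes f: "f \<in> L2_fun M" and g: "g \<in> L2_fun M"
  shows "L2_norm M (\<lambda>x. f x + g x) \<le> L2_norm M f + L2_norm M g"
proof -
  define A B where "A = L2_norm M f" and "B = L2_norm M g"
  consider "A = 0" | "B = 0" | "A > 0" "B > 0"
    using L2_norm_nonneg[of M f] L2_norm_nonneg[of M g] unfolding A_def B_def by linarith
  then show ?thesis
  proof cases
    case 1
    then have "AE x in M. f x = 0" using L2_norm_eq_0_iff[OF f] by (simp add: A_def)
    then have "L2_eq M (\<lambda>x. f x + g x) g"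
      using f g by (auto simp: L2_eq_def intro: L2_fun_add)
    then have "L2_norm M (\<lambda>x. f x + g x) = L2_norm M g" by (rule L2_norm_cong_AE)
    then show ?thesis using L2_norm_nonneg[of M f] by simp
  next
    case 2
    then have "AE x in M. g x = 0" using L2_norm_eq_0_iff[OF g] by (simp add: B_def)
    then have "L2_eq M (\<lambda>x. f x + g x) f"
      using f g by (auto simp: L2_eq_def intro: L2_fun_add)
    then have "L2_norm M (\<lambda>x. f x + g x) = L2_norm M f" by (rule L2_norm_cong_AE)
    then show ?thesis using L2_norm_nonneg[of M g] by simp
  next
    case 3
    define t where "t = B / A"
    have t: "t > 0" using 3 by (simp add: t_def)
    have "(L2_norm M (\<lambda>x. f x + g x))\<^sup>2
        \<le> (\<integral>x. (1 + t) * (norm (f x))\<^sup>2 + (1 + 1/t) * (norm (g x))\<^sup>2 \<partial>M)"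
      unfolding L2_norm_sq
    proof (rule integral_mono)
      show "integrable M (\<lambda>x. (norm (f x + g x))\<^sup>2)"
        using L2_fun_integrable[OF L2_fun_add[OF f g]] .
      show "integrable M (\<lambda>x. (1 + t) * (norm (f x))\<^sup>2 + (1 + 1/t) * (norm (g x))\<^sup>2)"
        using f g by (intro Bochner_Integration.integrable_add integrable_mult_right L2_fun_integrable)
      show "(norm (f x + g x))\<^sup>2 \<le> (1 + t) * (norm (f x))\<^sup>2 + (1 + 1/t) * (norm (g x))\<^sup>2" for x
        by (rule order_trans[OF power_mono[OF norm_triangle_ineq norm_ge_zero] add_sq_le_weighted[OF t]])
    qed
    also have "\<dots> = (1 + t) * A\<^sup>2 + (1 + 1/t) * B\<^sup>2"
      using f g by (simp add: A_def B_def L2_norm_sq L2_fun_integrable)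
    also have "\<dots> = (A + B)\<^sup>2"
    proof -
      have "t * A\<^sup>2 = A * B" "1/t * B\<^sup>2 = A * B" using 3 by (simp_all add: t_def power2_eq_square)
      then show ?thesis by (simp add: power2_sum distrib_right)
    qed
    finally show ?thesis
      unfolding A_def[symmetric] B_def[symmetric] by (rule power2_le_imp_le) (use 3 in simp)
  qed
qed

lemma L2_norm_scaleC: "L2_norm M (\<lambda>x. a *\<^sub>C f x) = cmod a * L2_norm M f"
  by (simp add: L2_norm_def norm_scaleC power_mult_distrib real_sqrt_mult)

lemma L2_cinner_cong_AE:
  assumes "L2_eq M f g" "L2_eq M f' g'" shows "L2_cinner M f f' = L2_cinner M g g'"
  unfolding L2_cinner_def
proof (rule integral_cong_AE)
  show "(\<lambda>x. cinner (f x) (f' x)) \<in> borel_measurable M" "(\<lambda>x. cinner (g x) (g' x)) \<in> borel_measurable M"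
    using assms by (auto simp: L2_eq_def intro!: borel_measurable_integrable L2_cinner_integrable)
  have "AE x in M. f x = g x" "AE x in M. f' x = g' x" using assms by (auto simp: L2_eq_def)
  then show "AE x in M. cinner (f x) (f' x) = cinner (g x) (g' x)" by eventually_elim simp
qed

lemma L2_Fatou:
  fixes F :: "nat \<Rightarrow> 'a \<Rightarrow> 'b::{complex_hilbert_space, second_countable_topology}"
  assumes F: "\<And>n. F n \<in> L2_fun M" and f: "f \<in> borel_measurable M"
    and lim: "AE x in M. (\<lambda>n. F n x) \<longlonglongrightarrow> f x"
    and bd: "\<forall>\<^sub>F n in sequentially. L2_norm M (F n) \<le> c" and c: "0 \<le> c"
  shows "f \<in> L2_fun M" "L2_norm M f \<le> c"
proof -
  note [measurable] = F[THEN L2_funD] f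
  have nn: "(\<integral>\<^sup>+x. ennreal ((norm (F n x))\<^sup>2) \<partial>M) = ennreal ((L2_norm M (F n))\<^sup>2)" for n
    unfolding L2_norm_sq by (intro nn_integral_eq_integral L2_fun_integrable F) auto
  have "(\<integral>\<^sup>+x. ennreal ((norm (f x))\<^sup>2) \<partial>M)
      = (\<integral>\<^sup>+x. liminf (\<lambda>n. ennreal ((norm (F n x))\<^sup>2)) \<partial>M)"
  proof (rule nn_integral_cong_AE)
    show "AE x in M. ennreal ((norm (f x))\<^sup>2) = liminf (\<lambda>n. ennreal ((norm (F n x))\<^sup>2))"
      using lim
    proof eventually_elim
      case (elim x)
      have "(\<lambda>n. ennreal ((norm (F n x))\<^sup>2)) \<longlonglongrightarrow> ennreal ((norm (f x))\<^sup>2)"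
        by (intro tendsto_intros elim)
      then show ?case by (intro lim_imp_Liminf[symmetric]) auto
    qed
  qed
  also have "\<dots> \<le> liminf (\<lambda>n. \<integral>\<^sup>+x. ennreal ((norm (F n x))\<^sup>2) \<partial>M)"
    by (intro nn_integral_liminf) measurable
  also have "\<dots> \<le> ennreal (c\<^sup>2)"
  proof (rule Liminf_le)
    show "\<forall>\<^sub>F n in sequentially. (\<integral>\<^sup>+x. ennreal ((norm (F n x))\<^sup>2) \<partial>M) \<le> ennreal (c\<^sup>2)"
      using bd by eventually_elim (simp add: nn ennreal_leI power_mono L2_norm_nonneg)
  qed simp
  finally have le: "(\<integral>\<^sup>+x. ennreal ((norm (f x))\<^sup>2) \<partial>M) \<le> ennreal (c\<^sup>2)" .
  have int: "integrable M (\<lambda>x. (norm (f x))\<^sup>2)"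
    using le by (intro integrableI_bounded) (auto simp: le_less_trans[OF _ ennreal_less_top])
  then show "f \<in> L2_fun M" by (simp add: L2_fun_def)
  have "ennreal (\<integral>x. (norm (f x))\<^sup>2 \<partial>M) \<le> ennreal (c\<^sup>2)"
    using le nn_integral_eq_integral[OF int] by simp
  then have "(L2_norm M f)\<^sup>2 \<le> c\<^sup>2" by (simp add: L2_norm_sq)
  then show "L2_norm M f \<le> c" using c by (rule power2_le_imp_le)
qed

lemma L2_complete_fast:
  fixes Y :: "nat \<Rightarrow> 'a \<Rightarrow> 'b::{complex_hilbert_space, second_countable_topology}"
  assumes Y: "\<And>n. Y n \<in> L2_fun M"
    and fast: "\<And>n. L2_norm M (\<lambda>x. Y (Suc n) x - Y n x) \<le> (1/2)^n"
  shows "\<exists>f. f \<in> borel_measurable M \<and> (AE x in M. (\<lambda>n. Y n x) \<longlonglongrightarrow> f x)"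
proof -
  note [measurable] = Y[THEN L2_funD]
  define D where "D n x = Y (Suc n) x - Y n x" for n x
  have D: "D n \<in> L2_fun M" for n unfolding D_def by (intro L2_fun_diff Y)
  note [measurable] = D[THEN L2_funD]
  have nn: "(\<integral>\<^sup>+x. ennreal (2^n * (norm (D n x))\<^sup>2) \<partial>M) \<le> ennreal ((1/2)^n)" for n
  proof -
    have "(\<integral>\<^sup>+x. ennreal (2^n * (norm (D n x))\<^sup>2) \<partial>M) = ennreal (\<integral>x. 2^n * (norm (D n x))\<^sup>2 \<partial>M)"
      by (intro nn_integral_eq_integral integrable_mult_right L2_fun_integrable D) auto
    also have "(\<integral>x. 2^n * (norm (D n x))\<^sup>2 \<partial>M) = 2^n * (L2_norm M (D n))\<^sup>2"
      by (simp add: L2_norm_sq)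
    also have "\<dots> \<le> 2^n * ((1/2)^n)\<^sup>2"
      using fast[of n] by (intro mult_left_mono power_mono L2_norm_nonneg) (auto simp: D_def[abs_def])
    also have "\<dots> = (1/2)^n"
      by (simp add: power2_eq_square power_divide)
    finally show ?thesis by (auto simp: ennreal_leI)
  qed
  have "(\<integral>\<^sup>+x. (\<Sum>n. ennreal (2^n * (norm (D n x))\<^sup>2)) \<partial>M)
      = (\<Sum>n. \<integral>\<^sup>+x. ennreal (2^n * (norm (D n x))\<^sup>2) \<partial>M)"
    by (intro nn_integral_suminf) measurable
  also have "\<dots> \<le> (\<Sum>n. ennreal ((1/2)^n))"
    by (intro suminf_le nn) auto
  also have "\<dots> = ennreal (\<Sum>n. (1/2)^n)"
    by (intro suminf_ennreal2) (auto simp: summable_geometric)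
  also have "\<dots> < \<infinity>" by simp
  finally have fin: "(\<integral>\<^sup>+x. (\<Sum>n. ennreal (2^n * (norm (D n x))\<^sup>2)) \<partial>M) < \<infinity>" .
  have "AE x in M. (\<Sum>n. ennreal (2^n * (norm (D n x))\<^sup>2)) \<noteq> \<infinity>"
    using fin by (intro nn_integral_PInf_AE) auto
  then have conv: "AE x in M. convergent (\<lambda>n. Y n x)"
  proof eventually_elim
    case (elim x)
    then have s: "summable (\<lambda>n. 2^n * (norm (D n x))\<^sup>2)"
      by (intro summable_suminf_not_top) auto
    have "summable (\<lambda>n. norm (D n x))"
    proof (rule summable_comparison_test')
      show "summable (\<lambda>n. 2^n * (norm (D n x))\<^sup>2 + (1/2)^n)"
        by (intro summable_add s) (auto simp: summable_geometric)
      show "norm (norm (D n x)) \<le> 2^n * (norm (D n x))\<^sup>2 + (1/2)^n" if "n \<ge> 0" for n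
      proof -
        define a q where "a = norm (D n x)" and "q = (2::real)^n"
        have q: "q > 0" and a: "a \<ge> 0" by (auto simp: q_def a_def)
        have "0 \<le> (q * a - 1)\<^sup>2 / q" using q by simp
        also have "\<dots> = q * a\<^sup>2 - 2 * a + 1 / q" using q by (simp add: power2_eq_square field_simps)
        finally have "a \<le> q * a\<^sup>2 + 1 / q" using a by simp
        then show ?thesis by (simp add: a_def q_def power_divide)
      qed
    qed
    then have "summable (\<lambda>n. D n x)" by (rule summable_norm_cancel)
    then have "convergent (\<lambda>n. \<Sum>i<n. D i x)" by (simp add: summable_iff_convergent)
    then have "convergent (\<lambda>n. Y 0 x + (\<Sum>i<n. D i x))" by (intro convergent_add convergent_const)
    moreover have "Y 0 x + (\<Sum>i<n. D i x) = Y n x" for n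
      by (simp add: D_def sum_lessThan_telescope[of "\<lambda>n. Y n x"])
    ultimately show ?case by simp
  qed
  show ?thesis
  proof (intro exI conjI)
    show "(\<lambda>x. lim (\<lambda>n. Y n x)) \<in> borel_measurable M" by measurable
    show "AE x in M. (\<lambda>n. Y n x) \<longlonglongrightarrow> lim (\<lambda>n. Y n x)"
      using conv by eventually_elim (simp add: convergent_LIMSEQ_iff)
  qed
qed

lemma L2_complete:
  fixes X :: "nat \<Rightarrow> 'a \<Rightarrow> 'b::{complex_hilbert_space, second_countable_topology}"
  assumes X: "\<And>n. X n \<in> L2_fun M"
    and cauchy: "\<And>e. e > 0 \<Longrightarrow> \<exists>N. \<forall>m\<ge>N. \<forall>n\<ge>N. L2_norm M (\<lambda>x. X m x - X n x) < e"
  shows "\<exists>f\<in>L2_fun M. (\<lambda>n. L2_norm M (\<lambda>x. X n x - f x)) \<longlonglongrightarrow> 0"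
proof -
  have "\<exists>N. \<forall>k. \<forall>m\<ge>N k. \<forall>n\<ge>N k. L2_norm M (\<lambda>x. X m x - X n x) < (1/2)^k"
    using cauchy by (intro choice) auto
  then obtain N where N: "\<And>k m n. m \<ge> N k \<Longrightarrow> n \<ge> N k \<Longrightarrow> L2_norm M (\<lambda>x. X m x - X n x) < (1/2)^k"
    by blast
  define r where "r k = (\<Sum>i\<le>k. N i) + k" for k
  have rN: "r k \<ge> N k" for k
    using member_le_sum[of k "{..k}" N] by (simp add: r_def)
  have rSuc: "r (Suc k) \<ge> r k" for k by (simp add: r_def)
  have rk: "r k \<ge> k" for k by (simp add: r_def)
  define Y where "Y k = X (r k)" for k
  have "\<exists>f. f \<in> borel_measurable M \<and> (AE x in M. (\<lambda>n. Y n x) \<longlonglongrightarrow> f x)"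
  proof (rule L2_complete_fast)
    show "Y n \<in> L2_fun M" for n by (simp add: Y_def X)
    show "L2_norm M (\<lambda>x. Y (Suc n) x - Y n x) \<le> (1/2)^n" for n
      using N[of n "r (Suc n)" "r n"] rN[of n] rSuc[of n] by (simp add: Y_def)
  qed
  then obtain f where f: "f \<in> borel_measurable M" and lim: "AE x in M. (\<lambda>n. Y n x) \<longlonglongrightarrow> f x"
    by blast
  have main: "\<exists>N0. \<forall>m\<ge>N0. (\<lambda>x. X m x - f x) \<in> L2_fun M \<and> L2_norm M (\<lambda>x. X m x - f x) \<le> e"
    if e: "e > 0" for e
  proof -
    obtain N0 where N0: "\<And>m n. m \<ge> N0 \<Longrightarrow> n \<ge> N0 \<Longrightarrow> L2_norm M (\<lambda>x. X m x - X n x) < e"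
      using cauchy[OF e] by blast
    show ?thesis
    proof (intro exI allI impI)
      fix m assume m: "m \<ge> N0"
      have 1: "(\<lambda>x. X m x - Y n x) \<in> L2_fun M" for n unfolding Y_def by (intro L2_fun_diff X)
      have 2: "(\<lambda>x. X m x - f x) \<in> borel_measurable M" using f X[THEN L2_funD] by simp
      have 3: "AE x in M. (\<lambda>n. X m x - Y n x) \<longlonglongrightarrow> X m x - f x"
        using lim by eventually_elim (intro tendsto_intros)
      have 4: "\<forall>\<^sub>F n in sequentially. L2_norm M (\<lambda>x. X m x - Y n x) \<le> e"
        using eventually_ge_at_top[of N0]
      proof eventually_elim
        case (elim n)
        then have "r n \<ge> N0" using rk[of n] by simp
        then show ?case unfolding Y_def using N0[OF m] by (simp add: less_imp_le)
      qed
      show "(\<lambda>x. X m x - f x) \<in> L2_fun M \<and> L2_norm M (\<lambda>x. X m x - f x) \<le> e"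
        using L2_Fatou[OF 1 2 3 4] e by auto
    qed
  qed
  obtain m where "(\<lambda>x. X m x - f x) \<in> L2_fun M" using main[of 1] by auto
  from L2_fun_diff[OF X[of m] this] have "f \<in> L2_fun M" by simp
  moreover have "(\<lambda>n. L2_norm M (\<lambda>x. X n x - f x)) \<longlonglongrightarrow> 0"
  proof (rule LIMSEQ_I)
    fix e :: real assume "e > 0"
    then obtain N0 where "\<And>m. m \<ge> N0 \<Longrightarrow> L2_norm M (\<lambda>x. X m x - f x) \<le> e/2"
      using main[of "e/2"] by auto
    then show "\<exists>no. \<forall>n\<ge>no. norm (L2_norm M (\<lambda>x. X n x - f x) - 0) < e"
      using \<open>e > 0\<close> by (intro exI[of _ N0]) (force simp: L2_norm_nonneg)
  qed
  ultimately show ?thesis by blast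
qed


lemma L2_eqI:
  assumes "f \<in> L2_fun M" "\<And>x. f x = g x" shows "L2_eq M f g"
proof -
  have "f = g" using assms(2) by auto
  then show ?thesis using assms(1) by (simp add: L2_eq_refl)
qed

lemma L2_eq_add:
  assumes "L2_eq M f f'" "L2_eq M g g'" shows "L2_eq M (\<lambda>x. f x + g x) (\<lambda>x. f' x + g' x)"
proof -
  have "AE x in M. f x = f' x" "AE x in M. g x = g' x" using assms by (auto simp: L2_eq_def)
  then have "AE x in M. f x + g x = f' x + g' x" by eventually_elim simp
  then show ?thesis using assms by (simp add: L2_eq_def L2_fun_add)
qed

lemma L2_eq_scaleC:
  assumes "L2_eq M f f'" shows "L2_eq M (\<lambda>x. a *\<^sub>C f x) (\<lambda>x. a *\<^sub>C f' x)"
proof -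
  have "AE x in M. f x = f' x" using assms by (auto simp: L2_eq_def)
  then have "AE x in M. a *\<^sub>C f x = a *\<^sub>C f' x" by eventually_elim simp
  then show ?thesis using assms by (simp add: L2_eq_def L2_fun_scaleC)
qed

lemma L2_eq_scaleR:
  assumes "L2_eq M f f'" shows "L2_eq M (\<lambda>x. r *\<^sub>R f x) (\<lambda>x. r *\<^sub>R f' x)"
  unfolding scaleR_scaleC using assms by (rule L2_eq_scaleC)

lemma L2_eq_minus:
  assumes "L2_eq M f f'" shows "L2_eq M (\<lambda>x. - f x) (\<lambda>x. - f' x)"
  using L2_eq_scaleC[OF assms, of "-1"] by (simp add: scaleC_minus1)

lemma L2_eq_diff:
  assumes "L2_eq M f f'" "L2_eq M g g'" shows "L2_eq M (\<lambda>x. f x - g x) (\<lambda>x. f' x - g' x)"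
  using L2_eq_add[OF assms(1) L2_eq_minus[OF assms(2)]] by simp

lemma L2_eq_zero: "L2_eq M (\<lambda>_. 0) (\<lambda>_. 0)"
  by (simp add: L2_eq_refl L2_fun_zero)

lemma L2_norm_eq_0_iff_eq:
  assumes "f \<in> L2_fun M" shows "L2_norm M f = 0 \<longleftrightarrow> L2_eq M f (\<lambda>_. 0)"
  using assms by (simp add: L2_norm_eq_0_iff L2_eq_def L2_fun_zero)

lemma L2_norm_scaleR: "L2_norm M (\<lambda>x. r *\<^sub>R f x) = \<bar>r\<bar> * L2_norm M f"
  unfolding scaleR_scaleC L2_norm_scaleC by simp

lemma L2_cinner_commute: "L2_cinner M f g = cnj (L2_cinner M g f)"
  unfolding L2_cinner_def Bochner_Integration.integral_cnj[symmetric]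
  by (intro Bochner_Integration.integral_cong refl cinner_commute)

lemma L2_cinner_add_left:
  assumes "f \<in> L2_fun M" "g \<in> L2_fun M" "h \<in> L2_fun M"
  shows "L2_cinner M (\<lambda>x. f x + g x) h = L2_cinner M f h + L2_cinner M g h"
  unfolding L2_cinner_def cinner_add_left
  by (intro Bochner_Integration.integral_add L2_cinner_integrable assms)

lemma L2_cinner_scaleC_left: "L2_cinner M (\<lambda>x. a *\<^sub>C f x) h = a * L2_cinner M f h"
  unfolding L2_cinner_def cinner_scaleC_left by simp

section \<open>The Hilbert spaces of square integrable functions on \<open>\<real>\<^sup>s\<close> and on \<open>\<real>\<^sub>+\<close>\<close>

quotient_type (overloaded) ('a, 'b) L2 =
  "'a::euclidean_space \<Rightarrow> 'b::{complex_hilbert_space, second_countable_topology}" / partial: "L2_eq lborel"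
  morphisms rep_L2 abs_L2
  by (rule part_equivp_L2_eq)

instantiation L2 :: (euclidean_space, "{complex_hilbert_space, second_countable_topology}") real_vector
begin

lift_definition zero_L2 :: "('a, 'b) L2" is "\<lambda>_. 0"
  by (rule L2_eq_zero)

lift_definition plus_L2 :: "('a, 'b) L2 \<Rightarrow> ('a, 'b) L2 \<Rightarrow> ('a, 'b) L2" is "\<lambda>f g x. f x + g x"
  by (rule L2_eq_add)

lift_definition minus_L2 :: "('a, 'b) L2 \<Rightarrow> ('a, 'b) L2 \<Rightarrow> ('a, 'b) L2" is "\<lambda>f g x. f x - g x"
  by (rule L2_eq_diff)

lift_definition uminus_L2 :: "('a, 'b) L2 \<Rightarrow> ('a, 'b) L2" is "\<lambda>f x. - f x"
  by (rule L2_eq_minus)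

lift_definition scaleR_L2 :: "real \<Rightarrow> ('a, 'b) L2 \<Rightarrow> ('a, 'b) L2" is "\<lambda>r f x. r *\<^sub>R f x"
  by (rule L2_eq_scaleR)

instance
proof
  fix f g h :: "('a, 'b) L2" and r s :: real
  show "f + g + h = f + (g + h)"
    by transfer (auto intro!: L2_eqI L2_fun_add simp: L2_eq_refl add.assoc)
  show "f + g = g + f"
    by transfer (auto intro!: L2_eqI L2_fun_add simp: L2_eq_refl add.commute)
  show "0 + f = f"
    by transfer simp
  show "- f + f = 0"
    by transfer (simp add: L2_eq_zero)
  show "f - g = f + - g"
    by transfer (auto intro!: L2_eqI L2_fun_diff simp: L2_eq_refl)
  show "r *\<^sub>R (f + g) = r *\<^sub>R f + r *\<^sub>R g"
    by transfer (auto intro!: L2_eqI L2_fun_scaleC L2_fun_add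
        simp: L2_eq_refl scaleR_scaleC scaleC_add_right)
  show "(r + s) *\<^sub>R f = r *\<^sub>R f + s *\<^sub>R f"
    by transfer (auto intro!: L2_eqI L2_fun_scaleC L2_fun_add
        simp: L2_eq_refl scaleR_scaleC scaleC_add_left)
  show "r *\<^sub>R s *\<^sub>R f = (r * s) *\<^sub>R f"
    by transfer (auto intro!: L2_eqI L2_fun_scaleC simp: L2_eq_refl scaleR_scaleC scaleC_scaleC)
  show "1 *\<^sub>R f = f"
    by transfer simp
qed

end

instantiation L2 :: (euclidean_space, "{complex_hilbert_space, second_countable_topology}") real_normed_vector
begin

lift_definition norm_L2 :: "('a, 'b) L2 \<Rightarrow> real" is "L2_norm lborel"
  by (rule L2_norm_cong_AE)

definition dist_L2 :: "('a, 'b) L2 \<Rightarrow> ('a, 'b) L2 \<Rightarrow> real"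
  where "dist_L2 f g = norm (f - g)"

definition sgn_L2 :: "('a, 'b) L2 \<Rightarrow> ('a, 'b) L2"
  where "sgn_L2 f = inverse (norm f) *\<^sub>R f"

definition uniformity_L2 :: "(('a, 'b) L2 \<times> ('a, 'b) L2) filter"
  where "uniformity_L2 = (INF e\<in>{0<..}. principal {(f, g). dist f g < e})"

definition open_L2 :: "('a, 'b) L2 set \<Rightarrow> bool"
  where "open_L2 U \<longleftrightarrow> (\<forall>f\<in>U. \<forall>\<^sub>F (f', g) in uniformity. f' = f \<longrightarrow> g \<in> U)"

lemma rep_L2_in: "rep_L2 f \<in> L2_fun lborel" for f :: "('a, 'b) L2"
  using Quotient_rep_reflp[OF Quotient_L2, of f] by (simp add: L2_eq_refl)

lemma abs_rep_L2: "abs_L2 (rep_L2 f) = f" for f :: "('a, 'b) L2"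
  by (rule Quotient_abs_rep[OF Quotient_L2])

lemma norm_diff_L2: "norm (f - g) = L2_norm lborel (\<lambda>x. rep_L2 f x - rep_L2 g x)"
  for f g :: "('a, 'b) L2"
proof -
  have "norm (abs_L2 (rep_L2 f) - abs_L2 (rep_L2 g))
      = L2_norm lborel (\<lambda>x. rep_L2 f x - rep_L2 g x)"
    by (simp add: minus_L2.abs_eq norm_L2.abs_eq L2_eq_refl rep_L2_in L2_fun_diff)
  then show ?thesis by (simp add: abs_rep_L2)
qed

instance
proof
  fix f g :: "('a, 'b) L2" and r :: real
  show "dist f g = norm (f - g)" by (rule dist_L2_def)
  show "sgn f = f /\<^sub>R norm f" by (rule sgn_L2_def)
  show "uniformity = (INF e\<in>{0<..}. principal {(f, g :: ('a, 'b) L2). dist f g < e})"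
    by (rule uniformity_L2_def)
  show "open U \<longleftrightarrow> (\<forall>f\<in>U. \<forall>\<^sub>F (f', g) in uniformity. f' = f \<longrightarrow> g \<in> U)"
    for U :: "('a, 'b) L2 set" by (rule open_L2_def)
  show "norm f = 0 \<longleftrightarrow> f = 0"
    by transfer (simp add: L2_norm_eq_0_iff_eq L2_eq_refl)
  show "norm (f + g) \<le> norm f + norm g"
    by transfer (simp add: L2_norm_triangle L2_eq_refl)
  show "norm (r *\<^sub>R f) = \<bar>r\<bar> * norm f"
    by transfer (simp add: L2_norm_scaleR)
qed

end

instance L2 :: (euclidean_space, "{complex_hilbert_space, second_countable_topology}") banach
proof
  fix X :: "nat \<Rightarrow> ('a, 'b) L2" assume "Cauchy X"
  define F where "F n = rep_L2 (X n)" for n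
  have F: "F n \<in> L2_fun lborel" for n by (simp add: F_def rep_L2_in)
  have dist: "dist (X m) (X n) = L2_norm lborel (\<lambda>x. F m x - F n x)" for m n
    by (simp add: F_def dist_L2_def norm_diff_L2)
  have "\<exists>f\<in>L2_fun lborel. (\<lambda>n. L2_norm lborel (\<lambda>x. F n x - f x)) \<longlonglongrightarrow> 0"
  proof (rule L2_complete[OF F])
    fix e :: real assume "e > 0"
    then have "\<exists>N. \<forall>m\<ge>N. \<forall>n\<ge>N. dist (X m) (X n) < e"
      using metric_CauchyD[OF \<open>Cauchy X\<close>] by blast
    then show "\<exists>N. \<forall>m\<ge>N. \<forall>n\<ge>N. L2_norm lborel (\<lambda>x. F m x - F n x) < e"
      by (simp add: dist)
  qed
  then obtain f where f: "f \<in> L2_fun lborel" "(\<lambda>n. L2_norm lborel (\<lambda>x. F n x - f x)) \<longlonglongrightarrow> 0"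
    by blast
  have "norm (abs_L2 (F n) - abs_L2 f) = L2_norm lborel (\<lambda>x. F n x - f x)" for n
    by (simp add: minus_L2.abs_eq norm_L2.abs_eq L2_eq_refl F f L2_fun_diff)
  then have "dist (X n) (abs_L2 f) = L2_norm lborel (\<lambda>x. F n x - f x)" for n
    by (simp add: dist_L2_def F_def abs_rep_L2)
  then have "X \<longlonglongrightarrow> abs_L2 f"
    using f(2) by (subst tendsto_dist_iff) simp
  then show "convergent X" by (rule convergentI)
qed

instantiation L2 :: (euclidean_space, "{complex_hilbert_space, second_countable_topology}") complex_hilbert_space
begin

lift_definition scaleC_L2 :: "complex \<Rightarrow> ('a, 'b) L2 \<Rightarrow> ('a, 'b) L2" is "\<lambda>a f x. a *\<^sub>C f x"
  by (rule L2_eq_scaleC)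

lift_definition cinner_L2 :: "('a, 'b) L2 \<Rightarrow> ('a, 'b) L2 \<Rightarrow> complex" is "L2_cinner lborel"
  by (rule L2_cinner_cong_AE)

instance
proof
  fix f g h :: "('a, 'b) L2" and r :: real and a b :: complex
  show "a *\<^sub>C (f + g) = a *\<^sub>C f + a *\<^sub>C g"
    by transfer (auto intro!: L2_eqI L2_fun_scaleC L2_fun_add simp: L2_eq_refl scaleC_add_right)
  show "(a + b) *\<^sub>C f = a *\<^sub>C f + b *\<^sub>C f"
    by transfer (auto intro!: L2_eqI L2_fun_scaleC L2_fun_add simp: L2_eq_refl scaleC_add_left)
  show "a *\<^sub>C (b *\<^sub>C f) = (a * b) *\<^sub>C f"
    by transfer (auto intro!: L2_eqI L2_fun_scaleC simp: L2_eq_refl scaleC_scaleC)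
  show "r *\<^sub>R f = complex_of_real r *\<^sub>C f"
    by transfer (auto intro!: L2_eqI L2_fun_scaleC simp: L2_eq_refl scaleR_scaleC)
  show "cinner f g = cnj (cinner g f)"
    by transfer (rule L2_cinner_commute)
  show "cinner (f + g) h = cinner f h + cinner g h"
    by transfer (simp add: L2_cinner_add_left L2_eq_refl)
  show "cinner (a *\<^sub>C f) g = a * cinner f g"
    by transfer (simp add: L2_cinner_scaleC_left)
  show "norm f = sqrt (Re (cinner f f))"
    by transfer (simp add: L2_norm_cinner L2_eq_refl)
qed

end

lemma countable_dense_span:
  fixes E :: "'a::real_normed_vector set"
  assumes "countable E" shows "\<exists>D. countable D \<and> span E \<subseteq> closure D"
proof -
  define D where "D = (\<lambda>l. \<Sum>p\<leftarrow>l. real_of_rat (fst p) *\<^sub>R snd p) ` lists (UNIV \<times> E)"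
  have D: "countable D" unfolding D_def using assms by (intro countable_image countable_lists) auto
  have D0: "0 \<in> D" unfolding D_def by (rule image_eqI[of _ _ "[]"]) auto
  have Dadd: "x + y \<in> D" if xy: "x \<in> D" "y \<in> D" for x y
  proof -
    obtain l m where "l \<in> lists (UNIV \<times> E)" "m \<in> lists (UNIV \<times> E)"
      "x = (\<Sum>p\<leftarrow>l. real_of_rat (fst p) *\<^sub>R snd p)" "y = (\<Sum>p\<leftarrow>m. real_of_rat (fst p) *\<^sub>R snd p)"
      using xy unfolding D_def by blast
    then show ?thesis unfolding D_def by (intro image_eqI[of _ _ "l @ m"]) auto
  qed
  have Dscale: "real_of_rat r *\<^sub>R x \<in> D" if x: "x \<in> D" for r x
  proof -
    obtain l where l: "l \<in> lists (UNIV \<times> E)" and x: "x = (\<Sum>p\<leftarrow>l. real_of_rat (fst p) *\<^sub>R snd p)"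
      using x unfolding D_def by blast
    have "real_of_rat r *\<^sub>R x = (\<Sum>p\<leftarrow>map (\<lambda>p. (r * fst p, snd p)) l. real_of_rat (fst p) *\<^sub>R snd p)"
      unfolding x by (induction l) (auto simp: scaleR_add_right of_rat_mult)
    moreover have "map (\<lambda>p. (r * fst p, snd p)) l \<in> lists (UNIV \<times> E)" using l by (fastforce simp: in_lists_conv_set)
    ultimately show ?thesis unfolding D_def by blast
  qed
  have "subspace (closure D)"
  proof (rule subspaceI)
    show "0 \<in> closure D" using D0 closure_subset by blast
  next
    fix x y assume "x \<in> closure D" "y \<in> closure D"
    then obtain f g where "\<And>n. f n \<in> D" "f \<longlonglongrightarrow> x" "\<And>n. g n \<in> D" "g \<longlonglongrightarrow> y"
      unfolding closure_sequential by blast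
    then show "x + y \<in> closure D"
      unfolding closure_sequential by (intro exI[of _ "\<lambda>n. f n + g n"]) (auto intro: Dadd tendsto_add)
  next
    fix c x assume "x \<in> closure D"
    then obtain f where f: "\<And>n. f n \<in> D" "f \<longlonglongrightarrow> x"
      unfolding closure_sequential by blast
    have "\<exists>q. \<bar>real_of_rat q - c\<bar> < inverse (real (Suc n))" for n
    proof -
      obtain q where "c < real_of_rat q" "real_of_rat q < c + inverse (real (Suc n))"
        using of_rat_dense[of c "c + inverse (real (Suc n))"] by auto
      then show ?thesis by (intro exI[of _ q]) (simp only: abs_less_iff, linarith)
    qed
    then obtain q where q: "\<And>n. \<bar>real_of_rat (q n) - c\<bar> < inverse (real (Suc n))" by metis
    have "(\<lambda>n. real_of_rat (q n) - c) \<longlonglongrightarrow> 0"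
      by (rule Lim_null_comparison[OF _ LIMSEQ_inverse_real_of_nat])
        (use q in \<open>auto intro!: always_eventually less_imp_le\<close>)
    then have "(\<lambda>n. real_of_rat (q n)) \<longlonglongrightarrow> c" by (simp add: LIM_zero_iff)
    then show "c *\<^sub>R x \<in> closure D"
      unfolding closure_sequential
      by (intro exI[of _ "\<lambda>n. real_of_rat (q n) *\<^sub>R f n"]) (auto intro: Dscale tendsto_scaleR f)
  qed
  moreover have "E \<subseteq> closure D"
  proof -
    have "E \<subseteq> D"
    proof
      fix x assume "x \<in> E"
      then show "x \<in> D" unfolding D_def by (intro image_eqI[of _ _ "[(1, x)]"]) auto
    qed
    then show ?thesis using closure_subset by blast
  qed
  ultimately have "span E \<subseteq> closure D" by (intro span_minimal)
  then show ?thesis using D by blast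
qed

lemma second_countable_if_dense:
  fixes D :: "'a::metric_space set"
  assumes "countable D" "closure D = UNIV"
  shows "\<exists>B::'a set set. countable B \<and> open = generate_topology B"
proof (intro exI conjI)
  define B where "B = (\<lambda>(d, n). ball d (inverse (real (Suc n)))) ` (D \<times> (UNIV :: nat set))"
  show "countable B" unfolding B_def using assms by (intro countable_image) auto
  have "generate_topology B S" if S: "open S" for S
  proof -
    have "\<exists>b\<in>B. x \<in> b \<and> b \<subseteq> S" if x: "x \<in> S" for x
    proof -
      obtain e where e: "e > 0" "ball x e \<subseteq> S" using S x by (auto simp: open_contains_ball)
      obtain n where n: "inverse (real (Suc n)) < e / 2" using reals_Archimedean[of "e/2"] e by auto
      have "x \<in> closure D" using assms by simp
      then obtain d where d: "d \<in> D" "dist d x < inverse (real (Suc n))"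
        unfolding closure_approachable by (meson inverse_positive_iff_positive of_nat_0_less_iff zero_less_Suc)
      have "ball d (inverse (real (Suc n))) \<subseteq> ball x e"
      proof
        fix y assume "y \<in> ball d (inverse (real (Suc n)))"
        then have "dist x y < e" using dist_triangle[of x y d] d n by (simp add: dist_commute)
        then show "y \<in> ball x e" by simp
      qed
      then show ?thesis using d e
        by (intro bexI[of _ "ball d (inverse (real (Suc n)))"]) (auto simp: B_def)
    qed
    then have "S = \<Union>{b \<in> B. b \<subseteq> S}" by blast
    moreover have "generate_topology B (\<Union>{b \<in> B. b \<subseteq> S})"
      by (rule generate_topology.UN) (auto intro: generate_topology.Basis)
    ultimately show ?thesis by simp
  qed
  moreover have "open S" if "generate_topology B S" for S
    using that by induction (auto simp: B_def)
  ultimately show "open = generate_topology B" by (intro ext) blast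
qed

lemma L2_dominated_convergence:
  fixes f :: "'a \<Rightarrow> 'b::{complex_hilbert_space, second_countable_topology}"
  assumes F: "\<And>n. F n \<in> L2_fun M" and f: "f \<in> L2_fun M" and w: "integrable M w"
    and lim: "\<And>x. x \<in> space M \<Longrightarrow> (\<lambda>n. F n x) \<longlonglongrightarrow> f x"
    and bd: "\<And>n x. x \<in> space M \<Longrightarrow> (norm (F n x))\<^sup>2 \<le> w x"
  shows "(\<lambda>n. L2_norm M (\<lambda>x. F n x - f x)) \<longlonglongrightarrow> 0"
proof -
  note [measurable] = F[THEN L2_funD] f[THEN L2_funD]
  have "(\<lambda>n. \<integral>x. (norm (F n x - f x))\<^sup>2 \<partial>M) \<longlonglongrightarrow> (\<integral>x. 0 \<partial>M)"
  proof (rule integral_dominated_convergence)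
    show "integrable M (\<lambda>x. 2 * w x + 2 * (norm (f x))\<^sup>2)"
      using w L2_fun_integrable[OF f] by simp
    show "AE x in M. (\<lambda>n. (norm (F n x - f x))\<^sup>2) \<longlonglongrightarrow> 0"
    proof (rule AE_I2)
      fix x assume "x \<in> space M"
      then have "(\<lambda>n. (norm (F n x - f x))\<^sup>2) \<longlonglongrightarrow> (norm (f x - f x))\<^sup>2"
        by (intro tendsto_intros lim)
      then show "(\<lambda>n. (norm (F n x - f x))\<^sup>2) \<longlonglongrightarrow> 0" by simp
    qed
    show "AE x in M. norm ((norm (F n x - f x))\<^sup>2) \<le> 2 * w x + 2 * (norm (f x))\<^sup>2" for n
    proof (rule AE_I2)
      fix x assume x: "x \<in> space M"
      show "norm ((norm (F n x - f x))\<^sup>2) \<le> 2 * w x + 2 * (norm (f x))\<^sup>2"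
        using norm_add_sq_le[of "F n x" "- f x"] bd[OF x, of n] by simp
    qed
  qed measurable
  then show ?thesis
    unfolding L2_norm_def using tendsto_real_sqrt by fastforce
qed

lemma abs_L2_tendsto:
  fixes f :: "'a::euclidean_space \<Rightarrow> 'b::{complex_hilbert_space, second_countable_topology}"
  assumes F: "\<And>n. F n \<in> L2_fun lborel" and f: "f \<in> L2_fun lborel" and w: "integrable lborel w"
    and lim: "\<And>x. (\<lambda>n. F n x) \<longlonglongrightarrow> f x"
    and bd: "\<And>n x. (norm (F n x))\<^sup>2 \<le> w x"
  shows "(\<lambda>n. abs_L2 (F n)) \<longlonglongrightarrow> abs_L2 f"
proof -
  have "dist (abs_L2 (F n)) (abs_L2 f) = L2_norm lborel (\<lambda>x. F n x - f x)" for n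
    by (simp add: dist_norm minus_L2.abs_eq norm_L2.abs_eq L2_eq_refl F f L2_fun_diff)
  then show ?thesis
    using L2_dominated_convergence[OF F f w lim bd] by (subst tendsto_dist_iff) simp
qed

lemma L2_fun_indicator:
  assumes "A \<in> sets M" "emeasure M A < \<infinity>"
  shows "(\<lambda>x. indicator A x *\<^sub>R q) \<in> L2_fun M"
proof -
  have "(\<lambda>x. (norm (indicator A x *\<^sub>R q))\<^sup>2) = (\<lambda>x. (norm q)\<^sup>2 * indicator A x)"
    by (auto simp: indicator_def)
  then show ?thesis using assms by (simp add: L2_fun_def integrable_real_indicator)
qed

lemma abs_L2_sum:
  fixes F :: "'i \<Rightarrow> 'a::euclidean_space \<Rightarrow> 'b::{complex_hilbert_space, second_countable_topology}"
  assumes "finite I" "\<And>i. i \<in> I \<Longrightarrow> F i \<in> L2_fun lborel"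
  shows "(\<lambda>x. \<Sum>i\<in>I. F i x) \<in> L2_fun lborel \<and> abs_L2 (\<lambda>x. \<Sum>i\<in>I. F i x) = (\<Sum>i\<in>I. abs_L2 (F i))"
  using assms
proof (induction I rule: finite_induct)
  case empty
  then show ?case by (simp add: L2_fun_zero zero_L2.abs_eq)
next
  case (insert i I)
  then have *: "(\<lambda>x. \<Sum>i\<in>I. F i x) \<in> L2_fun lborel" "F i \<in> L2_fun lborel"
    "abs_L2 (\<lambda>x. \<Sum>i\<in>I. F i x) = (\<Sum>i\<in>I. abs_L2 (F i))" by auto
  then have "abs_L2 (F i) + abs_L2 (\<lambda>x. \<Sum>i\<in>I. F i x) = abs_L2 (\<lambda>x. F i x + (\<Sum>i\<in>I. F i x))"
    using plus_L2.abs_eq[of "F i" "\<lambda>x. \<Sum>i\<in>I. F i x"] * by (simp only: L2_eq_refl)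
  then show ?case using insert * by (simp add: L2_fun_add)
qed

lemma L2_separable:
  "\<exists>D :: ('a::euclidean_space, 'b::{complex_hilbert_space, second_countable_topology}) L2 set.
     countable D \<and> closure D = UNIV"
proof -
  obtain S :: "'a set set" where S: "countable S" "topological_basis S"
    using ex_countable_basis by blast
  define G where "G = Inter ` {b. finite b \<and> b \<subseteq> S}"
  have countG: "countable G"
    unfolding G_def by (intro countable_image countable_Collect_finite_subset S)
  have GUNIV: "UNIV \<in> G" unfolding G_def by (rule image_eqI[of _ _ "{}"]) auto
  have stable: "Int_stable G"
  proof (rule Int_stableI)
    fix a b assume "a \<in> G" "b \<in> G"
    then obtain x y where "finite x" "x \<subseteq> S" "a = \<Inter>x" "finite y" "y \<subseteq> S" "b = \<Inter>y"
      unfolding G_def by blast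
    then show "a \<inter> b \<in> G" unfolding G_def by (intro image_eqI[of _ _ "x \<union> y"]) auto
  qed
  have openG: "open a" if "a \<in> G" for a
    using that topological_basis_open[OF S(2)] unfolding G_def by (auto intro!: open_Inter)
  have SG: "S \<subseteq> G"
  proof
    fix s assume "s \<in> S" then show "s \<in> G" unfolding G_def by (intro image_eqI[of _ _ "{s}"]) auto
  qed
  have borel: "sets (borel :: 'a measure) \<subseteq> sigma_sets UNIV G"
    unfolding borel_eq_countable_basis[OF S] by (simp add: sigma_sets_mono'[OF SG])
  have Gborel: "sigma_sets UNIV G \<subseteq> sets (borel :: 'a measure)"
    using sets.sigma_sets_subset[of G "borel :: 'a measure"] openG by (auto simp: subset_eq)
  obtain Q :: "'b set" where Q: "countable Q" "\<And>X. open X \<Longrightarrow> X \<noteq> {} \<Longrightarrow> \<exists>d\<in>Q. d \<in> X"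
    by (erule countable_dense_setE)
  define W where "W n = ball (0::'a) (real n)" for n
  define i where "i A n q = (\<lambda>x. indicator (A \<inter> W n) x *\<^sub>R q)" for A :: "'a set" and n and q :: 'b
  have i_in: "i A n q \<in> L2_fun lborel" if "A \<in> sets borel" for A n q
    unfolding i_def
  proof (rule L2_fun_indicator)
    show "A \<inter> W n \<in> sets lborel" using that by (simp add: W_def)
    have "emeasure lborel (A \<inter> W n) \<le> emeasure lborel (W n)"
      by (intro emeasure_mono) (auto simp: W_def)
    also have "\<dots> < \<infinity>" unfolding W_def by (rule emeasure_lborel_ball_finite)
    finally show "emeasure lborel (A \<inter> W n) < \<infinity>" .
  qed
  define E where "E = (\<lambda>(A, n, q). abs_L2 (i A n q)) ` (G \<times> (UNIV :: nat set) \<times> Q)"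
  have "countable E" unfolding E_def using countG Q by (intro countable_image countable_SIGMA) auto
  then obtain D where D: "countable D" "span E \<subseteq> closure D" using countable_dense_span by blast
  define K where "K = closure (span E)"
  have K: "subspace K"
  proof (rule subspaceI)
    show "0 \<in> K" unfolding K_def using span_zero closure_subset by blast
  next
    fix x y assume "x \<in> K" "y \<in> K"
    then obtain f g where "\<And>n. f n \<in> span E" "f \<longlonglongrightarrow> x" "\<And>n. g n \<in> span E" "g \<longlonglongrightarrow> y"
      unfolding K_def closure_sequential by blast
    then show "x + y \<in> K"
      unfolding K_def closure_sequential
      by (intro exI[of _ "\<lambda>n. f n + g n"]) (auto intro: span_add tendsto_add)
  next
    fix c x assume "x \<in> K"
    then obtain f where "\<And>n. f n \<in> span E" "f \<longlonglongrightarrow> x"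
      unfolding K_def closure_sequential by blast
    then show "c *\<^sub>R x \<in> K"
      unfolding K_def closure_sequential
      by (intro exI[of _ "\<lambda>n. c *\<^sub>R f n"]) (auto intro: span_scale tendsto_scaleR)
  qed
  have Klim: "x \<in> K" if "\<And>n. f n \<in> K" "f \<longlonglongrightarrow> x" for f :: "nat \<Rightarrow> _" and x
    using closed_sequentially[of K f x] that by (simp add: K_def)
  have intW: "integrable lborel (\<lambda>x. c * indicator (W n) x)" for c :: real and n
    by (intro integrable_mult_right integrable_real_indicator)
      (use emeasure_lborel_ball_finite[of "0::'a" "real n"] in \<open>auto simp: W_def\<close>)
  have KQ: "abs_L2 (i A n q) \<in> K" if A: "A \<in> sets borel" and q: "q \<in> Q" for A n q
  proof -
    have "A \<in> sigma_sets UNIV G" using A borel by blast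
    with stable subset_UNIV[of G, folded Pow_UNIV] show ?thesis
    proof (induction rule: sigma_sets_induct_disjoint)
      case (basic A)
      then have "abs_L2 (i A n q) \<in> E" unfolding E_def using q by force
      then show ?case unfolding K_def using span_base closure_subset by blast
    next
      case empty
      have "i {} n q = (\<lambda>_. 0)" by (simp add: i_def fun_eq_iff)
      then show ?case using subspace_0[OF K] by (simp add: zero_L2.abs_eq)
    next
      case (compl A)
      have A: "A \<in> sets borel" using subsetD[OF Gborel compl(1)] .
      have "abs_L2 (i UNIV n q) - abs_L2 (i A n q) = abs_L2 (\<lambda>x. i UNIV n q x - i A n q x)"
        by (simp add: minus_L2.abs_eq L2_eq_refl i_in A)
      also have "(\<lambda>x. i UNIV n q x - i A n q x) = i (UNIV - A) n q"
        by (auto simp: i_def fun_eq_iff indicator_def)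
      finally have eq: "abs_L2 (i (UNIV - A) n q) = abs_L2 (i UNIV n q) - abs_L2 (i A n q)" by simp
      have "abs_L2 (i UNIV n q) \<in> E" unfolding E_def using q GUNIV by force
      then have "abs_L2 (i UNIV n q) \<in> K" unfolding K_def using span_base closure_subset by blast
      then show ?case unfolding eq using compl by (intro subspace_diff[OF K])
    next
      case (union A)
      have A: "A k \<in> sets borel" for k
        using subsetD[OF Gborel range_subsetD[OF union(2)]] .
      have AU: "(\<Union>j<k. A j) \<in> sets borel" for k using A by auto
      have part: "abs_L2 (i (\<Union>j<k. A j) n q) \<in> K" for k
      proof (induction k)
        case 0
        have "i {} n q = (\<lambda>_. 0)" by (simp add: i_def fun_eq_iff)
        then show ?case using subspace_0[OF K] by (simp add: zero_L2.abs_eq)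
      next
        case (Suc k)
        have disj: "(\<Union>j<k. A j) \<inter> A k = {}"
        proof -
          have "A j \<inter> A k = {}" if "j < k" for j
            using disjoint_family_onD[OF union(1), of j k] that by simp
          then show ?thesis by blast
        qed
        have "abs_L2 (i (\<Union>j<k. A j) n q) + abs_L2 (i (A k) n q)
            = abs_L2 (\<lambda>x. i (\<Union>j<k. A j) n q x + i (A k) n q x)"
          by (simp add: plus_L2.abs_eq L2_eq_refl i_in A AU)
        also have "(\<lambda>x. i (\<Union>j<k. A j) n q x + i (A k) n q x) = i (\<Union>j<Suc k. A j) n q"
        proof
          fix x show "i (\<Union>j<k. A j) n q x + i (A k) n q x = i (\<Union>j<Suc k. A j) n q x"
            using disj unfolding i_def lessThan_Suc UN_insert
            by (cases "x \<in> A k"; cases "x \<in> (\<Union>j<k. A j)"; cases "x \<in> W n") auto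
        qed
        finally show ?case using subspace_add[OF K Suc union(3)[of k]] by simp
      qed
      have "(\<lambda>k. abs_L2 (i (\<Union>j<k. A j) n q)) \<longlonglongrightarrow> abs_L2 (i (\<Union>j. A j) n q)"
      proof (rule abs_L2_tendsto)
        show "integrable lborel (\<lambda>x. (norm q)\<^sup>2 * indicator (W n) x)" by (rule intW)
        show "(norm (i (\<Union>j<k. A j) n q x))\<^sup>2 \<le> (norm q)\<^sup>2 * indicator (W n) x" for k x
          by (auto simp: i_def indicator_def)
        show "(\<lambda>k. i (\<Union>j<k. A j) n q x) \<longlonglongrightarrow> i (\<Union>j. A j) n q x" for x
          unfolding i_def indicator_inter_arith
          by (intro tendsto_scaleR tendsto_mult tendsto_const LIMSEQ_indicator_UN)
        show "i (\<Union>j<k. A j) n q \<in> L2_fun lborel" for k by (rule i_in[OF AU])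
        show "i (\<Union>j. A j) n q \<in> L2_fun lborel" using A by (intro i_in) auto
      qed
      then show ?case by (rule Klim[OF part])
    qed
  qed
  have Kb: "abs_L2 (i A n b) \<in> K" if A: "A \<in> sets borel" for A n b
  proof -
    have "\<exists>q\<in>Q. dist q b < inverse (real (Suc k))" for k
      using Q(2)[of "ball b (inverse (real (Suc k)))"] by (auto simp: dist_commute)
    then obtain q where q: "\<And>k. q k \<in> Q" "\<And>k. dist (q k) b < inverse (real (Suc k))" by metis
    have "(\<lambda>k. dist (q k) b) \<longlonglongrightarrow> 0"
      by (rule Lim_null_comparison[OF _ LIMSEQ_inverse_real_of_nat])
        (use q in \<open>auto intro!: always_eventually less_imp_le\<close>)
    then have qb: "q \<longlonglongrightarrow> b" by (subst tendsto_dist_iff)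
    then obtain B where B: "\<And>k. norm (q k) \<le> B"
      using convergent_imp_Bseq[OF convergentI[OF qb]] by (auto simp: Bseq_def)
    have "(\<lambda>k. abs_L2 (i A n (q k))) \<longlonglongrightarrow> abs_L2 (i A n b)"
    proof (rule abs_L2_tendsto)
      show "integrable lborel (\<lambda>x. B\<^sup>2 * indicator (W n) x)" by (rule intW)
      show "(norm (i A n (q k) x))\<^sup>2 \<le> B\<^sup>2 * indicator (W n) x" for k x
        using B[of k] by (auto simp: i_def indicator_def power_mono)
      show "(\<lambda>k. i A n (q k) x) \<longlonglongrightarrow> i A n b x" for x
        unfolding i_def by (intro tendsto_scaleR tendsto_const qb)
    qed (rule i_in[OF A])+
    then show ?thesis by (rule Klim[OF KQ[OF A q(1)]])
  qed
  have "f \<in> K" for f :: "('a, 'b) L2"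
  proof -
    define g where "g = rep_L2 f"
    have g: "g \<in> L2_fun lborel" by (simp add: g_def rep_L2_in)
    obtain s where s: "\<And>k. simple_function lborel (s k)" "\<And>x. (\<lambda>k. s k x) \<longlonglongrightarrow> g x"
      "\<And>k x. norm (s k x) \<le> 2 * norm (g x)"
      using borel_measurable_implies_sequence_metric[OF L2_funD[OF g], of 0] by auto
    define F where "F k x = (\<Sum>y\<in>s k ` UNIV. i (s k -` {y}) k y x)" for k x
    have fin: "finite (s k ` UNIV)" for k using simple_functionD(1)[OF s(1)[of k]] by simp
    have meas: "s k -` {y} \<in> sets borel" for k y
      using simple_functionD(2)[OF s(1)[of k], of "{y}"] by simp
    have Feq: "F k x = indicator (W k) x *\<^sub>R s k x" for k x
    proof -
      have "F k x = (\<Sum>y\<in>{s k x}. i (s k -` {y}) k y x)"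
        unfolding F_def by (rule sum.mono_neutral_right[OF fin]) (auto simp: i_def)
      then show ?thesis by (simp add: i_def indicator_def)
    qed
    have F: "F k \<in> L2_fun lborel \<and> abs_L2 (F k) = (\<Sum>y\<in>s k ` UNIV. abs_L2 (i (s k -` {y}) k y))" for k
      unfolding F_def by (rule abs_L2_sum[OF fin i_in[OF meas]])
    have FK: "abs_L2 (F k) \<in> K" for k
      using F[of k] by (auto intro: subspace_sum[OF K] Kb[OF meas])
    have "(\<lambda>k. abs_L2 (F k)) \<longlonglongrightarrow> abs_L2 g"
    proof (rule abs_L2_tendsto[OF _ g])
      show "F k \<in> L2_fun lborel" for k using F by blast
      show "integrable lborel (\<lambda>x. 4 * (norm (g x))\<^sup>2)"
        by (intro integrable_mult_right L2_fun_integrable g)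
      show "(norm (F k x))\<^sup>2 \<le> 4 * (norm (g x))\<^sup>2" for k x
        using power_mono[OF s(3)[of k x], of 2] by (auto simp: Feq indicator_def power_mult_distrib)
      show "(\<lambda>k. F k x) \<longlonglongrightarrow> g x" for x
      proof -
        obtain N :: nat where N: "norm x < real N" using reals_Archimedean2 by blast
        have "\<forall>\<^sub>F k in sequentially. s k x = F k x"
          using eventually_ge_at_top[of N]
        proof eventually_elim
          case (elim k)
          then have "x \<in> W k" using N by (simp add: W_def)
          then show ?case by (simp add: Feq)
        qed
        then show ?thesis by (rule Lim_transform_eventually[OF s(2)])
      qed
    qed
    then have "abs_L2 g \<in> K" by (rule Klim[OF FK])
    then show ?thesis by (simp add: g_def abs_rep_L2)
  qed
  then have "closure (span E) = UNIV" unfolding K_def by auto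
  moreover have "closure (span E) \<subseteq> closure D" using D(2) by (intro closure_minimal) auto
  ultimately show ?thesis using D(1) by auto
qed

instance L2 :: (euclidean_space, "{complex_hilbert_space, second_countable_topology}") second_countable_topology
proof
  obtain D :: "('a, 'b) L2 set" where "countable D" "closure D = UNIV"
    using L2_separable by blast
  then show "\<exists>B :: ('a, 'b) L2 set set. countable B \<and> open = generate_topology B"
    by (rule second_countable_if_dense)
qed

abbreviation lborel_nonneg :: "real measure"
  where "lborel_nonneg \<equiv> restrict_space lborel {0..}"

quotient_type (overloaded) 'a L2_half =
  "real \<Rightarrow> 'a::{complex_hilbert_space, second_countable_topology}" / partial: "L2_eq lborel_nonneg"
  morphisms rep_L2_half abs_L2_half
  by (rule part_equivp_L2_eq)

instantiation L2_half :: ("{complex_hilbert_space, second_countable_topology}") real_vector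
begin

lift_definition zero_L2_half :: "'a L2_half" is "\<lambda>_. 0"
  by (rule L2_eq_zero)

lift_definition plus_L2_half :: "'a L2_half \<Rightarrow> 'a L2_half \<Rightarrow> 'a L2_half" is "\<lambda>f g x. f x + g x"
  by (rule L2_eq_add)

lift_definition minus_L2_half :: "'a L2_half \<Rightarrow> 'a L2_half \<Rightarrow> 'a L2_half" is "\<lambda>f g x. f x - g x"
  by (rule L2_eq_diff)

lift_definition uminus_L2_half :: "'a L2_half \<Rightarrow> 'a L2_half" is "\<lambda>f x. - f x"
  by (rule L2_eq_minus)

lift_definition scaleR_L2_half :: "real \<Rightarrow> 'a L2_half \<Rightarrow> 'a L2_half" is "\<lambda>r f x. r *\<^sub>R f x"
  by (rule L2_eq_scaleR)

instance
proof
  fix f g h :: "'a L2_half" and r s :: real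
  show "f + g + h = f + (g + h)"
    by transfer (auto intro!: L2_eqI L2_fun_add simp: L2_eq_refl add.assoc)
  show "f + g = g + f"
    by transfer (auto intro!: L2_eqI L2_fun_add simp: L2_eq_refl add.commute)
  show "0 + f = f"
    by transfer simp
  show "- f + f = 0"
    by transfer (simp add: L2_eq_zero)
  show "f - g = f + - g"
    by transfer (auto intro!: L2_eqI L2_fun_diff simp: L2_eq_refl)
  show "r *\<^sub>R (f + g) = r *\<^sub>R f + r *\<^sub>R g"
    by transfer (auto intro!: L2_eqI L2_fun_scaleC L2_fun_add
        simp: L2_eq_refl scaleR_scaleC scaleC_add_right)
  show "(r + s) *\<^sub>R f = r *\<^sub>R f + s *\<^sub>R f"
    by transfer (auto intro!: L2_eqI L2_fun_scaleC L2_fun_add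
        simp: L2_eq_refl scaleR_scaleC scaleC_add_left)
  show "r *\<^sub>R s *\<^sub>R f = (r * s) *\<^sub>R f"
    by transfer (auto intro!: L2_eqI L2_fun_scaleC simp: L2_eq_refl scaleR_scaleC scaleC_scaleC)
  show "1 *\<^sub>R f = f"
    by transfer simp
qed

end

instantiation L2_half :: ("{complex_hilbert_space, second_countable_topology}") real_normed_vector
begin

lift_definition norm_L2_half :: "'a L2_half \<Rightarrow> real" is "L2_norm lborel_nonneg"
  by (rule L2_norm_cong_AE)

definition dist_L2_half :: "'a L2_half \<Rightarrow> 'a L2_half \<Rightarrow> real"
  where "dist_L2_half f g = norm (f - g)"

definition sgn_L2_half :: "'a L2_half \<Rightarrow> 'a L2_half"
  where "sgn_L2_half f = inverse (norm f) *\<^sub>R f"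

definition uniformity_L2_half :: "('a L2_half \<times> 'a L2_half) filter"
  where "uniformity_L2_half = (INF e\<in>{0<..}. principal {(f, g). dist f g < e})"

definition open_L2_half :: "'a L2_half set \<Rightarrow> bool"
  where "open_L2_half U \<longleftrightarrow> (\<forall>f\<in>U. \<forall>\<^sub>F (f', g) in uniformity. f' = f \<longrightarrow> g \<in> U)"

lemma rep_L2_half_in: "rep_L2_half f \<in> L2_fun lborel_nonneg" for f :: "'a L2_half"
  using Quotient_rep_reflp[OF Quotient_L2_half, of f] by (simp add: L2_eq_refl)

lemma abs_rep_L2_half: "abs_L2_half (rep_L2_half f) = f" for f :: "'a L2_half"
  by (rule Quotient_abs_rep[OF Quotient_L2_half])

lemma norm_diff_L2_half: "norm (f - g) = L2_norm lborel_nonneg (\<lambda>x. rep_L2_half f x - rep_L2_half g x)"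
  for f g :: "'a L2_half"
proof -
  have "norm (abs_L2_half (rep_L2_half f) - abs_L2_half (rep_L2_half g))
      = L2_norm lborel_nonneg (\<lambda>x. rep_L2_half f x - rep_L2_half g x)"
    by (simp add: minus_L2_half.abs_eq norm_L2_half.abs_eq L2_eq_refl rep_L2_half_in L2_fun_diff)
  then show ?thesis by (simp add: abs_rep_L2_half)
qed

instance
proof
  fix f g :: "'a L2_half" and r :: real
  show "dist f g = norm (f - g)" by (rule dist_L2_half_def)
  show "sgn f = f /\<^sub>R norm f" by (rule sgn_L2_half_def)
  show "uniformity = (INF e\<in>{0<..}. principal {(f, g :: 'a L2_half). dist f g < e})"
    by (rule uniformity_L2_half_def)
  show "open U \<longleftrightarrow> (\<forall>f\<in>U. \<forall>\<^sub>F (f', g) in uniformity. f' = f \<longrightarrow> g \<in> U)"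
    for U :: "'a L2_half set" by (rule open_L2_half_def)
  show "norm f = 0 \<longleftrightarrow> f = 0"
    by transfer (simp add: L2_norm_eq_0_iff_eq L2_eq_refl)
  show "norm (f + g) \<le> norm f + norm g"
    by transfer (simp add: L2_norm_triangle L2_eq_refl)
  show "norm (r *\<^sub>R f) = \<bar>r\<bar> * norm f"
    by transfer (simp add: L2_norm_scaleR)
qed

end

instance L2_half :: ("{complex_hilbert_space, second_countable_topology}") banach
proof
  fix X :: "nat \<Rightarrow> 'a L2_half" assume "Cauchy X"
  define F where "F n = rep_L2_half (X n)" for n
  have F: "F n \<in> L2_fun lborel_nonneg" for n by (simp add: F_def rep_L2_half_in)
  have dist: "dist (X m) (X n) = L2_norm lborel_nonneg (\<lambda>x. F m x - F n x)" for m n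
    by (simp add: F_def dist_L2_half_def norm_diff_L2_half)
  have "\<exists>f\<in>L2_fun lborel_nonneg. (\<lambda>n. L2_norm lborel_nonneg (\<lambda>x. F n x - f x)) \<longlonglongrightarrow> 0"
  proof (rule L2_complete[OF F])
    fix e :: real assume "e > 0"
    then have "\<exists>N. \<forall>m\<ge>N. \<forall>n\<ge>N. dist (X m) (X n) < e"
      using metric_CauchyD[OF \<open>Cauchy X\<close>] by blast
    then show "\<exists>N. \<forall>m\<ge>N. \<forall>n\<ge>N. L2_norm lborel_nonneg (\<lambda>x. F m x - F n x) < e"
      by (simp add: dist)
  qed
  then obtain f where f: "f \<in> L2_fun lborel_nonneg" "(\<lambda>n. L2_norm lborel_nonneg (\<lambda>x. F n x - f x)) \<longlonglongrightarrow> 0"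
    by blast
  have "norm (abs_L2_half (F n) - abs_L2_half f) = L2_norm lborel_nonneg (\<lambda>x. F n x - f x)" for n
    by (simp add: minus_L2_half.abs_eq norm_L2_half.abs_eq L2_eq_refl F f L2_fun_diff)
  then have "dist (X n) (abs_L2_half f) = L2_norm lborel_nonneg (\<lambda>x. F n x - f x)" for n
    by (simp add: dist_L2_half_def F_def abs_rep_L2_half)
  then have "X \<longlonglongrightarrow> abs_L2_half f"
    using f(2) by (subst tendsto_dist_iff) simp
  then show "convergent X" by (rule convergentI)
qed

instantiation L2_half :: ("{complex_hilbert_space, second_countable_topology}") complex_hilbert_space
begin

lift_definition scaleC_L2_half :: "complex \<Rightarrow> 'a L2_half \<Rightarrow> 'a L2_half" is "\<lambda>a f x. a *\<^sub>C f x"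
  by (rule L2_eq_scaleC)

lift_definition cinner_L2_half :: "'a L2_half \<Rightarrow> 'a L2_half \<Rightarrow> complex" is "L2_cinner lborel_nonneg"
  by (rule L2_cinner_cong_AE)

instance
proof
  fix f g h :: "'a L2_half" and r :: real and a b :: complex
  show "a *\<^sub>C (f + g) = a *\<^sub>C f + a *\<^sub>C g"
    by transfer (auto intro!: L2_eqI L2_fun_scaleC L2_fun_add simp: L2_eq_refl scaleC_add_right)
  show "(a + b) *\<^sub>C f = a *\<^sub>C f + b *\<^sub>C f"
    by transfer (auto intro!: L2_eqI L2_fun_scaleC L2_fun_add simp: L2_eq_refl scaleC_add_left)
  show "a *\<^sub>C (b *\<^sub>C f) = (a * b) *\<^sub>C f"
    by transfer (auto intro!: L2_eqI L2_fun_scaleC simp: L2_eq_refl scaleC_scaleC)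
  show "r *\<^sub>R f = complex_of_real r *\<^sub>C f"
    by transfer (auto intro!: L2_eqI L2_fun_scaleC simp: L2_eq_refl scaleR_scaleC)
  show "cinner f g = cnj (cinner g f)"
    by transfer (rule L2_cinner_commute)
  show "cinner (f + g) h = cinner f h + cinner g h"
    by transfer (simp add: L2_cinner_add_left L2_eq_refl)
  show "cinner (a *\<^sub>C f) g = a * cinner f g"
    by transfer (simp add: L2_cinner_scaleC_left)
  show "norm f = sqrt (Re (cinner f f))"
    by transfer (simp add: L2_norm_cinner L2_eq_refl)
qed

end

section \<open>Operators on Hilbert spaces\<close>

text \<open>An unbounded operator is a pair \<open>D\<close>, \<open>T\<close>; the values of \<open>T\<close> outside its domain \<open>D\<close> are irrelevant.\<close>

definition bounded_clinear :: "('a::complex_hilbert_space \<Rightarrow> 'b::complex_hilbert_space) \<Rightarrow> bool"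
  where "bounded_clinear T \<longleftrightarrow> bounded_linear T \<and> (\<forall>c x. T (c *\<^sub>C x) = c *\<^sub>C T x)"

definition unitary :: "('a::complex_hilbert_space \<Rightarrow> 'b::complex_hilbert_space) \<Rightarrow> bool"
  where "unitary T \<longleftrightarrow> bounded_clinear T \<and> surj T \<and> (\<forall>x y. cinner (T x) (T y) = cinner x y)"

text \<open>The graph of the adjoint of \<open>T\<close> consists of the pairs \<open>(y, z)\<close> such that
  \<open>cinner (T x) y = cinner x z\<close> for all \<open>x\<close> in the domain of \<open>T\<close>.\<close>

definition adjoint_graph :: "'a set \<Rightarrow> ('a::complex_hilbert_space \<Rightarrow> 'b::complex_hilbert_space) \<Rightarrow> ('b \<times> 'a) set"
  where "adjoint_graph D T = {(y, z). \<forall>x\<in>D. cinner (T x) y = cinner x z}"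

definition self_adjoint :: "'a set \<Rightarrow> ('a::complex_hilbert_space \<Rightarrow> 'a) \<Rightarrow> bool"
  where "self_adjoint D T \<longleftrightarrow> closure D = UNIV \<and> adjoint_graph D T = {(x, T x) | x. x \<in> D}"

definition nonneg_operator :: "'a set \<Rightarrow> ('a::complex_hilbert_space \<Rightarrow> 'a) \<Rightarrow> bool"
  where "nonneg_operator D T \<longleftrightarrow> self_adjoint D T \<and> (\<forall>x\<in>D. cinner (T x) x \<in> \<real>\<^sub>\<ge>\<^sub>0)"

definition C0_semigroup :: "(real \<Rightarrow> 'a::complex_hilbert_space \<Rightarrow> 'a) \<Rightarrow> bool"
  where "C0_semigroup S \<longleftrightarrow>
    (\<forall>t\<ge>0. bounded_clinear (S t)) \<and> S 0 = id \<and> (\<forall>s\<ge>0. \<forall>t\<ge>0. S (s + t) = S s \<circ> S t) \<and>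
    (\<forall>x. ((\<lambda>t. S t x) \<longlongrightarrow> x) (at_right 0))"

definition generates :: "'a set \<Rightarrow> ('a::complex_hilbert_space \<Rightarrow> 'a) \<Rightarrow> (real \<Rightarrow> 'a \<Rightarrow> 'a) \<Rightarrow> bool"
  where "generates D A S \<longleftrightarrow> C0_semigroup S \<and>
    (\<forall>x y. ((\<lambda>h. (S h x - x) /\<^sub>R h) \<longlongrightarrow> y) (at_right 0) \<longleftrightarrow> x \<in> D \<and> A x = y)"

section \<open>Translations, Fourier transform and symbols\<close>

lemma L2_fun_translate:
  fixes f :: "'a::euclidean_space \<Rightarrow> 'b::{complex_hilbert_space, second_countable_topology}"
  assumes f: "f \<in> L2_fun lborel" shows "(\<lambda>x. f (x + a)) \<in> L2_fun lborel"
proof -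
  note [measurable] = L2_funD[OF f]
  have "integrable (distr lborel borel ((+) a)) (\<lambda>x. (norm (f x))\<^sup>2)"
    unfolding lborel_distr_plus by (rule L2_fun_integrable[OF f])
  then have "integrable lborel (\<lambda>x. (norm (f (a + x)))\<^sup>2)"
    by (subst (asm) integrable_distr_eq) auto
  moreover have "(\<lambda>x. f (x + a)) \<in> borel_measurable lborel" by measurable
  ultimately show ?thesis by (simp add: L2_fun_def add.commute)
qed

lift_definition translate :: "'a::euclidean_space \<Rightarrow> ('a, 'b::{complex_hilbert_space, second_countable_topology}) L2 \<Rightarrow> ('a, 'b) L2"
  is "\<lambda>a f x. f (x + a)"
proof -
  fix a and f g :: "'a \<Rightarrow> 'b" assume fg: "L2_eq lborel f g"
  then have f: "f \<in> L2_fun lborel" and g: "g \<in> L2_fun lborel" and "AE x in lborel. f x = g x"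
    by (auto simp: L2_eq_def)
  note [measurable] = f[THEN L2_funD] g[THEN L2_funD]
  have "AE x in distr lborel borel ((+) a). f x = g x"
    unfolding lborel_distr_plus by fact
  then have "AE x in lborel. f (a + x) = g (a + x)"
    by (subst (asm) AE_distr_iff) auto
  then show "L2_eq lborel (\<lambda>x. f (x + a)) (\<lambda>x. g (x + a))"
    using f g by (simp add: L2_eq_def L2_fun_translate add.commute)
qed

definition translation_invariant ::
  "('a::euclidean_space, 'b::{complex_hilbert_space, second_countable_topology}) L2 set \<Rightarrow>
   (('a, 'b) L2 \<Rightarrow> ('a, 'c::{complex_hilbert_space, second_countable_topology}) L2) \<Rightarrow> bool"
  where "translation_invariant D T \<longleftrightarrow>
    (\<forall>a. \<forall>f\<in>D. translate a f \<in> D \<and> T (translate a f) = translate a (T f))"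

definition fourier_integral ::
  "('a::euclidean_space \<Rightarrow> 'b::{complex_hilbert_space, second_countable_topology}) \<Rightarrow> 'a \<Rightarrow> 'b"
  where "fourier_integral f \<omega> =
    (2 * pi) powr (- real DIM('a) / 2) *\<^sub>R (\<integral>x. exp (- \<i> * complex_of_real (\<omega> \<bullet> x)) *\<^sub>C f x \<partial>lborel)"

text \<open>By Plancherel's theorem there is exactly one such operator.\<close>

definition fourier ::
  "('a::euclidean_space, 'b::{complex_hilbert_space, second_countable_topology}) L2 \<Rightarrow> ('a, 'b) L2"
  where "fourier = (THE F. unitary F \<and>
    (\<forall>f. integrable lborel (rep_L2 f) \<longrightarrow> (AE \<omega> in lborel. rep_L2 (F f) \<omega> = fourier_integral (rep_L2 f) \<omega>)))"

text \<open>The operator \<open>D\<close>, \<open>T\<close> is unitarily equivalent, via the Fourier transform, to multiplication by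
  \<open>M\<close> with its maximal domain.  For \<open>D = UNIV\<close> the first conjunct says that the product is
  always square integrable.\<close>

definition has_symbol ::
  "('a::euclidean_space, complex ^ 'n) L2 set \<Rightarrow>
   (('a, complex ^ 'n) L2 \<Rightarrow> ('a, complex ^ 'p) L2) \<Rightarrow> ('a \<Rightarrow> complex ^ 'n ^ 'p) \<Rightarrow> bool"
  where "has_symbol D T M \<longleftrightarrow>
    (\<forall>f. f \<in> D \<longleftrightarrow> (\<lambda>\<omega>. M \<omega> *v rep_L2 (fourier f) \<omega>) \<in> L2_fun lborel) \<and>
    (\<forall>f\<in>D. AE \<omega> in lborel. rep_L2 (fourier (T f)) \<omega> = M \<omega> *v rep_L2 (fourier f) \<omega>)"

section \<open>Linear time-and-space-invariant systems\<close>

text \<open>\<open>D\<close> is the domain of \<open>A\<close>, and \<open>S t\<close> plays the role of \<open>exp (A t)\<close>.\<close>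

definition LTSI_system ::
  "(real ^ 's, complex ^ 'n) L2 set \<Rightarrow>
   ((real ^ 's, complex ^ 'n) L2 \<Rightarrow> (real ^ 's, complex ^ 'n) L2) \<Rightarrow>
   (real \<Rightarrow> (real ^ 's, complex ^ 'n) L2 \<Rightarrow> (real ^ 's, complex ^ 'n) L2) \<Rightarrow>
   ((real ^ 's, complex ^ 'm) L2 \<Rightarrow> (real ^ 's, complex ^ 'n) L2) \<Rightarrow>
   ((real ^ 's, complex ^ 'n) L2 \<Rightarrow> (real ^ 's, complex ^ 'p) L2) \<Rightarrow> bool"
  where "LTSI_system D A S B C \<longleftrightarrow>
    closure D = UNIV \<and> generates D A S \<and> bounded_clinear B \<and> bounded_clinear C \<and>
    translation_invariant D A \<and> translation_invariant UNIV B \<and> translation_invariant UNIV C \<and>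
    (\<exists>M. continuous_on UNIV M \<and> has_symbol D A M) \<and>
    (\<exists>M. continuous_on UNIV M \<and> has_symbol UNIV B M) \<and>
    (\<exists>M. continuous_on UNIV M \<and> has_symbol UNIV C M)"

definition exponentially_stable :: "(real \<Rightarrow> 'a::complex_hilbert_space \<Rightarrow> 'a) \<Rightarrow> bool"
  where "exponentially_stable S \<longleftrightarrow>
    (\<exists>M>0. \<exists>\<alpha>>0. \<forall>t\<ge>0. onorm (S t) \<le> M * exp (- \<alpha> * t))"

definition impulse_response :: "(real \<Rightarrow> 'z \<Rightarrow> 'z) \<Rightarrow> ('u \<Rightarrow> 'z) \<Rightarrow> ('z \<Rightarrow> 'y) \<Rightarrow> real \<Rightarrow> 'u \<Rightarrow> 'y"
  where "impulse_response S B C t = C \<circ> S t \<circ> B"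

primrec has_nth_derivative :: "nat \<Rightarrow> (real \<Rightarrow> 'a::real_normed_vector) \<Rightarrow> 'a \<Rightarrow> real \<Rightarrow> bool"
  where
    "has_nth_derivative 0 f d t \<longleftrightarrow> f t = d"
  | "has_nth_derivative (Suc k) f d t \<longleftrightarrow>
      (\<exists>g. (\<forall>\<^sub>F s in nhds t. has_nth_derivative k f (g s) s) \<and> (g has_vector_derivative d) (at t))"

definition strong_deriv_domain :: "nat \<Rightarrow> (real \<Rightarrow> 'u \<Rightarrow> 'y::real_normed_vector) \<Rightarrow> real \<Rightarrow> 'u set"
  where "strong_deriv_domain k G t = {u. \<exists>d. has_nth_derivative k (\<lambda>s. G s u) d t}"

definition strong_deriv :: "nat \<Rightarrow> (real \<Rightarrow> 'u \<Rightarrow> 'y::real_normed_vector) \<Rightarrow> real \<Rightarrow> 'u \<Rightarrow> 'y"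
  where "strong_deriv k G t u = (THE d. has_nth_derivative k (\<lambda>s. G s u) d t)"

definition completely_monotone :: "(real \<Rightarrow> 'u::complex_hilbert_space \<Rightarrow> 'u) \<Rightarrow> bool"
  where "completely_monotone G \<longleftrightarrow>
    (\<forall>t>0. \<forall>k. nonneg_operator (strong_deriv_domain k G t) (\<lambda>u. (-1) ^ k *\<^sub>R strong_deriv k G t u))"

definition relaxation_type ::
  "(real \<Rightarrow> 'z \<Rightarrow> 'z) \<Rightarrow> ('u::complex_hilbert_space \<Rightarrow> 'z) \<Rightarrow> ('z \<Rightarrow> 'u) \<Rightarrow> bool"
  where "relaxation_type S B C \<longleftrightarrow> completely_monotone (impulse_response S B C)"

definition hankel_operator ::
  "(real \<Rightarrow> 'u::{complex_hilbert_space, second_countable_topology} \<Rightarrow> 'y::{complex_hilbert_space, second_countable_topology}) \<Rightarrow>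
   'u L2_half \<Rightarrow> 'y L2_half"
  where "hankel_operator G v =
    abs_L2_half (\<lambda>t. \<integral>\<tau>. G (t + \<tau>) (rep_L2_half v \<tau>) \<partial>lborel_nonneg)"

end

theory Submission
  imports Defs "HOL-Probability.Probability" "HOL-Real_Asymp.Real_Asymp"
begin

text \<open>Let \<open>G t = C \<circ> S t \<circ> B\<close> be the impulse response. Relaxation and positivity of the Hankel operator
  are both equivalent to a third condition, \<open>alternating_operators G\<close>: the form
  \<open>cinner (G t u) u\<close> is real for all \<open>t > 0\<close>, and all its iterated finite differences
  \<open>f t - f (t + h)\<close> in \<open>t\<close> are nonnegative. In contrast to derivatives, differences exist for every
  vector \<open>u\<close>, involve bounded operators only, and are preserved by limits.

  From differences to relaxation (\<open>completely_monotone_if_alternating\<close>): monotonicity of the differences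
  bounds those of first and second order by \<open>O(h)\<close> and \<open>O(h k)\<close>. Polarization carries these bounds over
  to the operator norm, which makes every \<open>G t u\<close> differentiable; the negative of the derivative is a
  limit of difference quotients, so it is alternating again. Hence all strong derivatives are bounded
  and everywhere defined, and the sign of their forms already makes them self-adjoint.

  From relaxation to differences (\<open>alternating_if_relaxation\<close>): if the Fourier transform of \<open>u\<close>
  vanishes outside a ball, where the continuous symbols are bounded, then \<open>B u\<close> is in the domain of
  every power of \<open>A\<close>, so \<open>G t u\<close> is smooth, and the signs of its derivatives determine those of its
  differences. Such vectors are dense because the Fourier transform is unitary.

  From differences to the Hankel operator (\<open>hankel_nonneg_if_alternating\<close>): sampled on a grid,
  an alternating family satisfies Hausdorff's condition for a moment sequence. Approximating the moments by
  sums over point masses, as in Hausdorff's proof, gives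
  \<open>(\<Sum>i j. cinner (G (s + (i + j) * h) (u j)) (u i)) \<ge> 0\<close>. The form of the Hankel operator is a limit
  of such sums.

  From the Hankel operator to differences (\<open>alternating_if_hankel_nonneg\<close>): step signals of small
  width show that \<open>cinner (G t u) u\<close> is positive definite as a kernel in \<open>t = s + s'\<close>. The
  difference \<open>f t - f (t + h)\<close> of a bounded function of this kind is of the same kind
  (\<open>positive_definite_bdiff\<close>), which can be iterated.

  The Fourier transform is defined as the unitary operator that extends the Fourier integral, so its
  existence, Plancherel's theorem (\<open>unitary_fourier\<close>), is a part of the proof. The squared modulus
  of a Fourier integral is the Fourier integral of an autocorrelation function; integration against
  wider and wider Gaussians recovers the value of the autocorrelation at \<open>0\<close>, which is the squared
  norm. Surjectivity follows because the adjoint, the transform followed by a reflection, is an isometry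
  as well.\<close>

section \<open>Forms on complex Hilbert spaces\<close>

lemma cinner_zero_left [simp]: "cinner 0 y = (0::complex)"
  for y :: "'a::complex_hilbert_space"
  using cinner_add_left[of 0 0 y] by simp

lemma cinner_zero_right [simp]: "cinner x 0 = (0::complex)"
  for x :: "'a::complex_hilbert_space"
  using cinner_add_right[of x 0 0] by simp

lemma cinner_minus_left [simp]: "cinner (- x) y = - cinner x y"
  for x :: "'a::complex_hilbert_space"
  using cinner_add_left[of x "- x" y] by (simp add: eq_neg_iff_add_eq_0 add.commute)

lemma cinner_minus_right [simp]: "cinner x (- y) = - cinner x y"
  for x :: "'a::complex_hilbert_space"
  using cinner_add_right[of x y "- y"] by (simp add: eq_neg_iff_add_eq_0 add.commute)

lemma cinner_diff_left: "cinner (x - y) z = cinner x z - cinner y z"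
  for x :: "'a::complex_hilbert_space"
  using cinner_add_left[of x "- y" z] by simp

lemma cinner_diff_right: "cinner x (y - z) = cinner x y - cinner x z"
  for x :: "'a::complex_hilbert_space"
  using cinner_add_right[of x y "- z"] by simp

lemma cinner_scaleR_left: "cinner (r *\<^sub>R x) y = of_real r * cinner x y"
  for x :: "'a::complex_hilbert_space"
  by (simp add: scaleR_scaleC cinner_scaleC_left)

lemma cinner_scaleR_right: "cinner x (r *\<^sub>R y) = of_real r * cinner x y"
  for x :: "'a::complex_hilbert_space"
  by (simp add: scaleR_scaleC cinner_scaleC_right)

lemma cinner_self: "cinner x x = of_real ((norm x)\<^sup>2)"
  for x :: "'a::complex_hilbert_space"
  by (rule complex_eqI) (simp_all add: norm_sq_cinner Im_cinner_self)

lemma norm_diff_sq: "(norm (x - y))\<^sup>2 = (norm x)\<^sup>2 + (norm y)\<^sup>2 - 2 * Re (cinner x y)"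
  for x :: "'a::complex_hilbert_space"
proof -
  have "Re (cinner y x) = Re (cinner x y)" by (subst cinner_commute) simp
  then show ?thesis by (simp add: norm_sq_cinner cinner_diff_left cinner_diff_right)
qed

lemma cinner_Cauchy_Schwarz: "norm (cinner x y) \<le> norm x * norm y"
  for x :: "'a::complex_hilbert_space"
proof (cases "y = 0")
  case False
  define c where "c = cinner x y / of_real ((norm y)\<^sup>2)"
  have y: "(norm y)\<^sup>2 > 0" using False by simp
  have "cinner x (c *\<^sub>C y) = of_real ((cmod (cinner x y))\<^sup>2 / (norm y)\<^sup>2)"
    unfolding cinner_scaleC_right c_def by (simp add: complex_norm_square[unfolded of_real_power] mult.commute)
  moreover have "(norm (c *\<^sub>C y))\<^sup>2 = (cmod (cinner x y))\<^sup>2 / (norm y)\<^sup>2"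
    using y by (simp add: norm_scaleC c_def norm_divide norm_power norm_mult power2_eq_square field_simps)
  ultimately have "0 \<le> (norm x)\<^sup>2 - (cmod (cinner x y))\<^sup>2 / (norm y)\<^sup>2"
    using norm_diff_sq[of x "c *\<^sub>C y"] zero_le_power2[of "norm (x - c *\<^sub>C y)"] by simp
  then have "(cmod (cinner x y))\<^sup>2 \<le> (norm x * norm y)\<^sup>2"
    using y by (simp add: power_mult_distrib field_simps)
  then show ?thesis by (rule power2_le_imp_le) simp
qed simp

lemma bounded_bilinear_cinner:
  "bounded_bilinear (cinner :: 'a::complex_hilbert_space \<Rightarrow> 'a \<Rightarrow> complex)"
proof
  show "\<exists>K. \<forall>a b::'a. norm (cinner a b) \<le> norm a * norm b * K"
    by (rule exI[of _ 1]) (simp add: cinner_Cauchy_Schwarz)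
qed (simp_all add: cinner_add_left cinner_add_right cinner_scaleR_left cinner_scaleR_right
      scaleR_conv_of_real)

lemmas tendsto_cinner = bounded_bilinear.tendsto[OF bounded_bilinear_cinner]
lemmas bounded_linear_cinner_left = bounded_bilinear.bounded_linear_left[OF bounded_bilinear_cinner]
lemmas bounded_linear_cinner_right = bounded_bilinear.bounded_linear_right[OF bounded_bilinear_cinner]

lemma scaleC_diff_right: "a *\<^sub>C (x - y) = a *\<^sub>C x - a *\<^sub>C y"
  for x :: "'a::complex_hilbert_space"
  using scaleC_add_right[of a "x - y" y] by simp

lemma bounded_linear_scaleC: "bounded_linear (\<lambda>x::'b::complex_hilbert_space. c *\<^sub>C x)"
  by (rule bounded_linear_intro[where K="cmod c"])
    (simp_all add: scaleC_add_right scaleR_scaleC scaleC_scaleC norm_scaleC mult.commute)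

lemma borel_measurable_cinner [measurable (raw)]:
  fixes f g :: "'x \<Rightarrow> 'b::{complex_hilbert_space, second_countable_topology}"
  assumes "f \<in> borel_measurable M" "g \<in> borel_measurable M"
  shows "(\<lambda>x. cinner (f x) (g x)) \<in> borel_measurable M"
  unfolding cinner_polarization using assms by measurable

text \<open>Over the complex numbers the quadratic form of an operator determines its sesquilinear form;
  so a bound for the quadratic form is, up to a factor, a bound for the operator.\<close>

lemma cinner_op_polarization:
  fixes T :: "'a::complex_hilbert_space \<Rightarrow> 'a"
  assumes add: "\<And>x y. T (x + y) = T x + T y" and sc: "\<And>c x. T (c *\<^sub>C x) = c *\<^sub>C T x"
  shows "4 * cinner (T x) y = cinner (T (x + y)) (x + y) - cinner (T (x + (-1) *\<^sub>C y)) (x + (-1) *\<^sub>C y)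
    + \<i> * cinner (T (x + \<i> *\<^sub>C y)) (x + \<i> *\<^sub>C y) - \<i> * cinner (T (x + (-\<i>) *\<^sub>C y)) (x + (-\<i>) *\<^sub>C y)"
  unfolding add sc cinner_add_left cinner_add_right cinner_scaleC_left cinner_scaleC_right
  by (simp add: algebra_simps)

lemma norm_le_quadratic_form:
  fixes T :: "'a::complex_hilbert_space \<Rightarrow> 'a"
  assumes add: "\<And>x y. T (x + y) = T x + T y" and sc: "\<And>c x. T (c *\<^sub>C x) = c *\<^sub>C T x"
    and bd: "\<And>x. cmod (cinner (T x) x) \<le> c * (norm x)\<^sup>2"
  shows "norm (T x) \<le> 4 * c * norm x"
proof -
  have c: "0 \<le> c * (norm y)\<^sup>2" for y :: 'a using bd[of y] norm_ge_zero order_trans by blast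
  have le: "cmod (cinner (T x) y) \<le> 4 * c" if "norm x = 1" "norm y = 1" for x y
  proof -
    have c0: "0 \<le> c" using c[of x] that by simp
    have *: "cmod (cinner (T z) z) \<le> 4 * c" if "norm z \<le> 2" for z
    proof -
      have "c * (norm z)\<^sup>2 \<le> c * 4"
        using power_mono[OF that, of 2] c0 by (intro mult_left_mono) auto
      then show ?thesis using bd[of z] by linarith
    qed
    have n: "norm (x + a *\<^sub>C y) \<le> 2" if "cmod a = 1" for a
      using norm_triangle_ineq[of x "a *\<^sub>C y"] that \<open>norm x = 1\<close> \<open>norm y = 1\<close> by (simp add: norm_scaleC)
    have n1: "norm (x + y) \<le> 2" using norm_triangle_ineq[of x y] that by simp
    have "cmod (4 * cinner (T x) y) \<le> 4 * c + 4 * c + 4 * c + 4 * c"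
      unfolding cinner_op_polarization[of T, OF add sc]
      by (intro order_trans[OF norm_triangle_ineq4] order_trans[OF norm_triangle_ineq] add_mono)
        (auto simp: norm_mult intro!: * n n1)
    then show ?thesis by (simp add: norm_mult)
  qed
  have T0: "T 0 = 0" using add[of 0 0] by simp
  show ?thesis
  proof (cases "x = 0 \<or> T x = 0")
    case True
    then show ?thesis
    proof (cases "x = 0")
      case False
      then have "T x = 0" using True by simp
      moreover have "0 \<le> c" using c[of x] False by (simp add: zero_le_mult_iff)
      ultimately show ?thesis by simp
    qed (simp add: T0)
  next
    case False
    \<comment> \<open>the unit vectors at which the form takes the value \<open>norm (T x) / norm x\<close>\<close>
    define x' y' where "x' = x /\<^sub>R norm x" and "y' = T x /\<^sub>R norm (T x)"
    have "cinner (T x') y' = of_real (norm (T x) / norm x)"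
      using False unfolding x'_def y'_def scaleR_scaleC sc cinner_scaleC_left cinner_scaleC_right cinner_self
      by (simp add: power2_eq_square divide_simps)
    moreover have "norm x' = 1" "norm y' = 1" using False by (auto simp: x'_def y'_def)
    ultimately have "norm (T x) / norm x \<le> 4 * c" using le[of x' y'] by (simp add: norm_divide)
    then show ?thesis using False by (simp add: divide_simps)
  qed
qed

text \<open>Exchanging the two vectors only permutes the four terms of the polarization identity and conjugates
  their coefficients, and the terms themselves are real.\<close>

lemma symmetric_if_form_nonneg:
  fixes T :: "'a::complex_hilbert_space \<Rightarrow> 'a"
  assumes add: "\<And>x y. T (x + y) = T x + T y" and sc: "\<And>c x. T (c *\<^sub>C x) = c *\<^sub>C T x"
    and nn: "\<And>x. cinner (T x) x \<in> \<real>\<^sub>\<ge>\<^sub>0"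
  shows "cinner (T x) y = cinner x (T y)"
proof -
  have real: "cnj (cinner (T x) x) = cinner (T x) x" for x
    using nn[of x] by (metis Reals_cnj_iff nonneg_Reals_subset_Reals subsetD)
  have e1: "cinner (T (y + \<i> *\<^sub>C x)) (y + \<i> *\<^sub>C x) = cinner (T (x + (-\<i>) *\<^sub>C y)) (x + (-\<i>) *\<^sub>C y)"
    and e2: "cinner (T (y + (-\<i>) *\<^sub>C x)) (y + (-\<i>) *\<^sub>C x) = cinner (T (x + \<i> *\<^sub>C y)) (x + \<i> *\<^sub>C y)"
    and e3: "cinner (T (y + (-1) *\<^sub>C x)) (y + (-1) *\<^sub>C x) = cinner (T (x + (-1) *\<^sub>C y)) (x + (-1) *\<^sub>C y)"
    unfolding add sc cinner_add_left cinner_add_right cinner_scaleC_left cinner_scaleC_right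
    by (simp_all add: algebra_simps)
  have "4 * cinner (T x) y = cnj (4 * cinner (T y) x)"
    unfolding cinner_op_polarization[of T, OF add sc] complex_cnj_add complex_cnj_diff complex_cnj_mult real e1 e2 e3
    by (simp add: add.commute[of x y])
  then show ?thesis using cinner_commute[of x "T y"] by simp
qed

text \<open>Rotating \<open>y\<close> by a phase makes the off-diagonal term real; expand the form at the difference.\<close>

lemma nonneg_form_le:
  fixes T :: "'a::complex_hilbert_space \<Rightarrow> 'a"
  assumes add: "\<And>x y. T (x + y) = T x + T y" and sc: "\<And>c x. T (c *\<^sub>C x) = c *\<^sub>C T x"
    and nn: "\<And>x. cinner (T x) x \<in> \<real>\<^sub>\<ge>\<^sub>0"
  shows "cmod (cinner (T x) y) \<le> (Re (cinner (T x) x) + Re (cinner (T y) y)) / 2"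
proof -
  define z where "z = cinner (T x) y"
  define c where "c = (if z = 0 then 1 else z / of_real (cmod z))"
  have c: "c * cnj c = 1 \<and> cnj c * z = of_real (cmod z)"
  proof (cases "z = 0")
    case False
    define r where "r = complex_of_real (cmod z)"
    have r: "r \<noteq> 0" "cnj r = r" "z * cnj z = r * r" "c = z / r"
      using False complex_norm_square[of z] by (auto simp: r_def c_def power2_eq_square)
    have "c * cnj c = (z * cnj z) / (r * r)" using r(2) by (simp add: r(4))
    moreover have "cnj c * z = (z * cnj z) / r" using r(2) by (simp add: r(4) mult.commute)
    ultimately show ?thesis using r(1) by (simp add: r(3)) (simp add: r_def)
  qed (simp add: c_def)
  have n: "0 \<le> Re (cinner (T (x + (- c) *\<^sub>C y)) (x + (- c) *\<^sub>C y))"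
    using nn by (simp add: complex_nonneg_Reals_iff)
  have yx: "cinner (T y) x = cnj z"
    using symmetric_if_form_nonneg[of T, OF add sc nn, of y x] cinner_commute[of y "T x"] by (simp add: z_def)
  have "cinner (T (x + (- c) *\<^sub>C y)) (x + (- c) *\<^sub>C y)
      = cinner (T x) x + (c * cnj c) * cinner (T y) y - cnj c * z - cnj (cnj c * z)"
    unfolding add sc cinner_add_left cinner_add_right cinner_scaleC_left cinner_scaleC_right z_def[symmetric] yx
    by (simp add: algebra_simps)
  then show ?thesis using n by (simp add: c[THEN conjunct1] c[THEN conjunct2]) (simp add: z_def)
qed

text \<open>On a complex Hilbert space a nonnegative quadratic form makes an everywhere defined operator
  symmetric, and a symmetric operator with full domain is self-adjoint.\<close>

lemma nonneg_operator_UNIV: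
  fixes T :: "'a::complex_hilbert_space \<Rightarrow> 'a"
  assumes add: "\<And>x y. T (x + y) = T x + T y" and sc: "\<And>c x. T (c *\<^sub>C x) = c *\<^sub>C T x"
    and nn: "\<And>x. cinner (T x) x \<in> \<real>\<^sub>\<ge>\<^sub>0"
  shows "nonneg_operator UNIV T"
proof -
  note sym = symmetric_if_form_nonneg[of T, OF add sc nn]
  have "z = T y" if "\<forall>x. cinner (T x) y = cinner x z" for y z
  proof -
    have "cinner (T y - z) (T y - z) = 0"
      using that sym[of "T y - z" y] by (simp add: cinner_diff_right)
    then show ?thesis by (simp add: cinner_self)
  qed
  then show ?thesis
    unfolding nonneg_operator_def self_adjoint_def adjoint_graph_def using nn sym by auto
qed

lemma bounded_clinearD:
  assumes "bounded_clinear T"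
  shows "bounded_linear T" "T (x + y) = T x + T y" "T (c *\<^sub>C x) = c *\<^sub>C T x"
    "T (x - y) = T x - T y" "T (r *\<^sub>R x) = r *\<^sub>R T x" "T 0 = 0"
  using assms by (auto simp: bounded_clinear_def linear_simps)

section \<open>Alternating finite differences\<close>

definition bdiff :: "real \<Rightarrow> (real \<Rightarrow> 'a::ab_group_add) \<Rightarrow> real \<Rightarrow> 'a"
  where "bdiff h f t = f t - f (t + h)"

text \<open>The discrete counterpart of complete monotonicity. The factor \<open>(-1)^k\<close> of the derivatives is absorbed by
  \<open>bdiff\<close>, which subtracts the later value from the earlier one.\<close>

definition alternating :: "(real \<Rightarrow> real) \<Rightarrow> bool"
  where "alternating f \<longleftrightarrow> (\<forall>hs. (\<forall>h\<in>set hs. 0 < h) \<longrightarrow> (\<forall>t>0. 0 \<le> foldr bdiff hs f t))"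

lemma alternating_nonneg: "alternating f \<Longrightarrow> 0 < t \<Longrightarrow> 0 \<le> f t"
  unfolding alternating_def by (metis empty_iff empty_set foldr.simps(1) id_apply)

lemma alternating_bdiff: 
  assumes "alternating f" "0 < h" shows "alternating (bdiff h f)"
  unfolding alternating_def
proof (intro allI impI)
  fix hs :: "real list" and t :: real assume "\<forall>h\<in>set hs. 0 < h" "0 < t"
  then show "0 \<le> foldr bdiff hs (bdiff h f) t"
    using assms(1)[unfolded alternating_def, rule_format, of "hs @ [h]" t] assms(2) by auto
qed

lemma alternating_antimono:
  assumes "alternating f" "0 < s" "s \<le> t" shows "f t \<le> f s"
proof (cases "s = t")
  case False
  then show ?thesis
    using alternating_nonneg[OF alternating_bdiff[OF assms(1), of "t - s"], of s] assms
    by (simp add: bdiff_def)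
qed simp

lemma foldr_bdiff_tendsto:
  fixes f :: "'i \<Rightarrow> real \<Rightarrow> 'a::real_normed_vector"
  assumes "\<And>t. 0 < t \<Longrightarrow> ((\<lambda>i. f i t) \<longlongrightarrow> g t) F" and "\<forall>h\<in>set hs. 0 < h" and "0 < t"
  shows "((\<lambda>i. foldr bdiff hs (f i) t) \<longlongrightarrow> foldr bdiff hs g t) F"
  using assms(2,3)
proof (induction hs arbitrary: t)
  case Nil
  then show ?case using assms(1) by simp
next
  case (Cons h hs)
  then show ?case
    unfolding foldr_Cons o_apply by (subst (1 2) bdiff_def) (auto intro!: tendsto_intros)
qed

lemma alternating_limit:
  assumes F: "F \<noteq> bot" and alt: "\<forall>\<^sub>F i in F. alternating (f i)"
    and lim: "\<And>t. 0 < t \<Longrightarrow> ((\<lambda>i. f i t) \<longlongrightarrow> g t) F"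
  shows "alternating g"
  unfolding alternating_def
proof (intro allI impI)
  fix hs :: "real list" and t :: real assume t: "\<forall>h\<in>set hs. 0 < h" "0 < t"
  have lim': "((\<lambda>i. foldr bdiff hs (f i) t) \<longlongrightarrow> foldr bdiff hs g t) F"
    by (rule foldr_bdiff_tendsto[OF _ t]) (rule lim)
  have "\<forall>\<^sub>F i in F. 0 \<le> foldr bdiff hs (f i) t"
    using alt by eventually_elim (use t in \<open>auto simp: alternating_def\<close>)
  then show "0 \<le> foldr bdiff hs g t"
    using tendsto_lowerbound[OF lim' _ F] by blast
qed

lemma foldr_bdiff_scale: "foldr bdiff hs (\<lambda>s. c * f s) t = c * foldr bdiff hs f t"
  for c :: "'a::comm_ring"
  by (induction hs arbitrary: t) (auto simp: bdiff_def right_diff_distrib)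

lemma alternating_scale: "alternating f \<Longrightarrow> 0 \<le> c \<Longrightarrow> alternating (\<lambda>t. c * f t)"
  by (auto simp: alternating_def foldr_bdiff_scale)

text \<open>The \<open>n = \<lfloor>a/h\<rfloor>\<close> consecutive differences of step \<open>h\<close> between \<open>t - n h\<close> and \<open>t\<close> decrease
  and sum up to at most \<open>f (t - a)\<close>, and the difference at \<open>t\<close> is below all of them. The factor
  \<open>2\<close> pays for the rounding: \<open>n h \<ge> a/2\<close>.\<close>

lemma alternating_bdiff_le:
  assumes f: "alternating f" and h: "0 < h" "h \<le> a" and t: "a < t"
  shows "bdiff h f t \<le> (2 * h / a) * f (t - a)"
proof -
  define n where "n = nat \<lfloor>a / h\<rfloor>"
  have a: "0 < a" using h by simp
  have "1 \<le> a / h" using h by simp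
  then have "1 \<le> \<lfloor>a / h\<rfloor>" by simp
  then have n: "real n \<le> a / h" "a / h < real n + 1" "1 \<le> real n"
    unfolding n_def using of_nat_nat[of "\<lfloor>a / h\<rfloor>"] by linarith+
  have nh: "real n * h \<le> a" using n(1) h by (simp add: field_simps)
  have pos: "0 < t - real j * h" if "j \<le> n" for j
  proof -
    have "real j * h \<le> real n * h" using that h by (intro mult_right_mono) auto
    then show ?thesis using nh t by linarith
  qed
  have tel: "real j * bdiff h f t \<le> f (t - real j * h) - f t" if "j \<le> n" for j
    using that
  proof (induction j)
    case (Suc j)
    have "bdiff h f t \<le> bdiff h f (t - real (Suc j) * h)"
      using alternating_antimono[OF alternating_bdiff[OF f h(1)] pos[OF Suc.prems], of t] h by simp
    also have "\<dots> = f (t - real (Suc j) * h) - f (t - real j * h)"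
      by (simp add: bdiff_def algebra_simps)
    finally show ?case using Suc by (simp add: algebra_simps)
  qed simp
  have "real n * bdiff h f t \<le> f (t - real n * h)"
    using tel[of n] alternating_nonneg[OF f, of t] a t by simp
  also have "\<dots> \<le> f (t - a)" using nh t by (intro alternating_antimono[OF f]) auto
  finally have le: "real n * bdiff h f t \<le> f (t - a)" .
  have "a \<le> real n * (2 * h)"
  proof -
    have "a < (real n + 1) * h" using n(2) h by (simp add: field_simps)
    also have "\<dots> \<le> (2 * real n) * h" using n(3) h by (intro mult_right_mono) auto
    finally show ?thesis by simp
  qed
  moreover have "0 \<le> bdiff h f t" using alternating_nonneg[OF alternating_bdiff[OF f h(1)]] a t by simp
  ultimately have "a * bdiff h f t \<le> real n * (2 * h) * bdiff h f t" by (intro mult_right_mono)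
  also have "\<dots> \<le> 2 * h * f (t - a)" using le h by (simp add: mult.assoc mult.left_commute)
  finally show ?thesis using a by (simp add: field_simps)
qed

lemma alternating_bdiff2_le:
  assumes f: "alternating f" and h: "0 < h" "h \<le> a" and k: "0 < k" "k \<le> a" and t: "2 * a < t"
  shows "bdiff h (bdiff k f) t \<le> (4 / a\<^sup>2) * h * k * f (t - 2 * a)"
proof -
  have a: "0 < a" using h by simp
  have "bdiff h (bdiff k f) t \<le> (2 * h / a) * bdiff k f (t - a)"
    using alternating_bdiff_le[OF alternating_bdiff[OF f k(1)] h] t a by simp
  also have "\<dots> \<le> (2 * h / a) * ((2 * k / a) * f (t - a - a))"
    using alternating_bdiff_le[OF f k, of "t - a"] t a h by (intro mult_left_mono) auto
  finally show ?thesis by (simp add: power2_eq_square field_simps)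
qed

section \<open>Differentiability from bounds on second differences\<close>

text \<open>Halving the step changes a difference quotient by a second difference, so the quotients with the
  steps \<open>1/2^n\<close> form a Cauchy sequence. Its limit is the derivative because an increment over any length
  is, up to second differences, a multiple of the increment over a short step.\<close>

lemma has_vector_derivative_of_second_differences:
  fixes f :: "real \<Rightarrow> 'a::banach"
  assumes sec: "\<And>t h k. l < t \<Longrightarrow> 0 < h \<Longrightarrow> 0 < k \<Longrightarrow> t + h + k < r \<Longrightarrow>
      norm (bdiff h (bdiff k f) t) \<le> C * h * k"
    and lip: "\<And>t h. l < t \<Longrightarrow> 0 < h \<Longrightarrow> t + h < r \<Longrightarrow> norm (bdiff h f t) \<le> L * h"
    and x: "l < x" "x < r"
  shows "\<exists>d. (f has_vector_derivative d) (at x)"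
proof -
  define k :: "nat \<Rightarrow> real" where "k n = (1/2)^n" for n
  define q where "q n s = (f (s + k n) - f s) /\<^sub>R k n" for n s
  define g where "g s = lim (\<lambda>n. q n s)" for s
  have kpos: "0 < k n" for n by (simp add: k_def)
  have k0: "k \<longlonglongrightarrow> 0" unfolding k_def by (rule LIMSEQ_power_zero) simp
  have C: "0 \<le> C"
  proof -
    have "0 \<le> C * ((r - x) / 3) * ((r - x) / 3)"
      using order_trans[OF norm_ge_zero sec[of x "(r-x)/3" "(r-x)/3"]] x by (simp add: field_simps)
    then show ?thesis using x by (simp add: zero_le_mult_iff)
  qed
  have lim: "(\<lambda>n. q n s) \<longlonglongrightarrow> g s" if s: "l < s" "s < r" for s
  proof -
    have "\<forall>\<^sub>F n in sequentially. k n < r - s"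
      using order_tendstoD(2)[OF k0, of "r - s"] s by simp
    then obtain N where N: "\<And>n. n \<ge> N \<Longrightarrow> k n < r - s" by (auto simp: eventually_sequentially)
    have step: "norm (q (Suc n) s - q n s) \<le> C * (1/2)^n" if n: "n \<ge> N" for n
    proof -
      define h where "h = k (Suc n)"
      have h: "h > 0" "k n = 2 * h" by (auto simp: h_def k_def)
      have q: "q (Suc n) s = (1 / (2 * h)) *\<^sub>R (2 *\<^sub>R (f (s + h) - f s))"
        "q n s = (1 / (2 * h)) *\<^sub>R (f (s + h + h) - f s)"
        unfolding q_def h_def[symmetric] h(2) mult_2[symmetric] add.assoc using h(1)
        by (simp_all add: inverse_eq_divide)
      have "q (Suc n) s - q n s = (1 / (2 * h)) *\<^sub>R - bdiff h (bdiff h f) s"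
        unfolding q scaleR_diff_right[symmetric] by (simp add: bdiff_def scaleR_2)
      then have "norm (q (Suc n) s - q n s) = (1 / (2 * h)) * norm (bdiff h (bdiff h f) s)"
        using h by simp
      also have "\<dots> \<le> (1 / (2 * h)) * (C * h * h)"
        using sec[of s h h] h N[OF n] s by (intro mult_left_mono) auto
      also have "\<dots> = C * k n / 4" using h by (simp add: field_simps)
      also have "\<dots> \<le> C * k n" using C kpos[of n] by (simp add: mult_nonneg_nonneg less_imp_le)
      finally show ?thesis by (simp add: k_def)
    qed
    have "summable (\<lambda>n. q (Suc n) s - q n s)"
      by (rule summable_comparison_test'[where N=N and g="\<lambda>n. C * (1/2)^n"])
        (use step in \<open>auto intro!: summable_mult summable_geometric\<close>)
    then have "convergent (\<lambda>n. q 0 s + (\<Sum>i<n. q (Suc i) s - q i s))"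
      by (intro convergent_add convergent_const) (simp add: summable_iff_convergent)
    then have "convergent (\<lambda>n. q n s)"
      by (simp add: sum_lessThan_telescope[of "\<lambda>i. q i s"])
    then show ?thesis unfolding g_def convergent_LIMSEQ_iff .
  qed
  have cont: "(\<lambda>n. f (s + a n)) \<longlonglongrightarrow> f (s + b)"
    if a: "a \<longlonglongrightarrow> b" "\<And>n. 0 \<le> a n" "\<And>n. a n \<le> b" and s: "l < s" "s + b < r"
    for s b :: real and a :: "nat \<Rightarrow> real"
  proof -
    have le: "norm (f (s + a n) - f (s + b)) \<le> L * (b - a n)" for n
    proof (cases "a n = b")
      case False
      then have "norm (bdiff (b - a n) f (s + a n)) \<le> L * (b - a n)"
        using a(2)[of n] a(3)[of n] s by (intro lip) auto
      then show ?thesis by (simp add: bdiff_def)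
    qed simp
    have "(\<lambda>n. L * (b - a n)) \<longlonglongrightarrow> L * (b - b)" by (intro tendsto_intros a(1))
    then have "(\<lambda>n. L * (b - a n)) \<longlonglongrightarrow> 0" by simp
    then have "(\<lambda>n. f (s + a n) - f (s + b)) \<longlonglongrightarrow> 0"
      by (rule Lim_null_comparison[OF always_eventually[OF allI[OF le]]])
    then show ?thesis by (simp only: LIM_zero_iff)
  qed
  \<comment> \<open>\<open>f (s + h) - f s\<close> consists of \<open>m n\<close> increments of step \<open>k n\<close> and a rest that vanishes in the limit;
    replacing one of these increments by the one at \<open>s\<close> costs one second difference\<close>
  have taylor: "norm (f (s + h) - f s - h *\<^sub>R g s) \<le> C * h\<^sup>2"
    if s: "l < s" and h: "0 < h" and sh: "s + h < r" for s h
  proof -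
    define m where "m n = nat \<lfloor>h / k n\<rfloor>" for n
    have m: "real (m n) * k n \<le> h" "h - k n \<le> real (m n) * k n" for n
    proof -
      have "0 \<le> h / k n" using h kpos[of n] by simp
      then have "real (m n) \<le> h / k n" "h / k n \<le> real (m n) + 1"
        unfolding m_def by linarith+
      then show "real (m n) * k n \<le> h" "h - k n \<le> real (m n) * k n"
        using kpos[of n] by (auto simp: field_simps)
    qed
    have mk: "(\<lambda>n. real (m n) * k n) \<longlonglongrightarrow> h"
    proof (rule tendsto_sandwich[OF _ _ _ tendsto_const])
      show "(\<lambda>n. h - k n) \<longlonglongrightarrow> h" using tendsto_diff[OF tendsto_const k0, of h] by simp
    qed (use m in auto)
    have tel: "norm (f (s + real j * k n) - f s - (real j * k n) *\<^sub>R q n s) \<le> C * (real j * k n)\<^sup>2"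
      if "j \<le> m n" for j n
      using that
    proof (induction j)
      case (Suc j)
      have jle: "(real j + 1) * k n \<le> h"
      proof -
        have "real (Suc j) * k n \<le> real (m n) * k n"
          using Suc.prems kpos[of n] by (intro mult_right_mono) auto
        then show ?thesis using m(1)[of n] by (simp add: algebra_simps)
      qed
      have inc: "norm (f (s + real (Suc j) * k n) - f (s + real j * k n) - (f (s + k n) - f s))
          \<le> C * (real j * k n) * k n"
      proof (cases "j = 0")
        case False
        have "norm (bdiff (real j * k n) (bdiff (k n) f) s) \<le> C * (real j * k n) * k n"
          using False kpos[of n] jle sh s by (intro sec) (auto simp: algebra_simps)
        then show ?thesis by (simp add: bdiff_def algebra_simps)
      qed simp
      have split: "f (s + real (Suc j) * k n) - f s - (real (Suc j) * k n) *\<^sub>R q n s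
          = (f (s + real j * k n) - f s - (real j * k n) *\<^sub>R q n s)
            + (f (s + real (Suc j) * k n) - f (s + real j * k n) - (f (s + k n) - f s))"
      proof -
        have "(real (Suc j) * k n) *\<^sub>R q n s = (real j * k n) *\<^sub>R q n s + k n *\<^sub>R q n s"
          by (simp add: distrib_right scaleR_add_left)
        also have "k n *\<^sub>R q n s = f (s + k n) - f s" using kpos[of n] by (simp add: q_def)
        finally show ?thesis by simp
      qed
      have "norm (f (s + real (Suc j) * k n) - f s - (real (Suc j) * k n) *\<^sub>R q n s)
          \<le> C * (real j * k n)\<^sup>2 + C * (real j * k n) * k n"
        unfolding split by (rule norm_triangle_mono[OF Suc.IH[OF Suc_leD[OF Suc.prems]] inc])
      also have "\<dots> \<le> C * (real (Suc j) * k n)\<^sup>2"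
      proof -
        have "(real j * k n)\<^sup>2 + real j * k n * k n \<le> (real (Suc j) * k n)\<^sup>2"
          using kpos[of n] by (simp add: power2_eq_square algebra_simps)
        from mult_left_mono[OF this C] show ?thesis by (simp only: distrib_left mult.assoc)
      qed
      finally show ?case .
    qed (use C in simp)
    have "(\<lambda>n. f (s + real (m n) * k n)) \<longlonglongrightarrow> f (s + h)"
      using cont[OF mk _ m(1) s sh] h kpos by (simp add: less_imp_le)
    then have "(\<lambda>n. norm (f (s + real (m n) * k n) - f s - (real (m n) * k n) *\<^sub>R q n s))
        \<longlonglongrightarrow> norm (f (s + h) - f s - h *\<^sub>R g s)"
      using lim[of s] s sh h by (intro tendsto_intros mk) auto
    moreover have "(\<lambda>n. C * (real (m n) * k n)\<^sup>2) \<longlonglongrightarrow> C * h\<^sup>2" by (intro tendsto_intros mk)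
    ultimately show ?thesis
      by (rule LIMSEQ_le) (use tel in blast)
  qed
  have glip: "norm (g s - g (s + h)) \<le> C * h" if s: "l < s" and h: "0 < h" and sh: "s + h < r" for s h
  proof (rule LIMSEQ_le_const2)
    show "(\<lambda>n. norm (q n s - q n (s + h))) \<longlonglongrightarrow> norm (g s - g (s + h))"
      using s h sh by (intro tendsto_intros lim) auto
    have "\<forall>\<^sub>F n in sequentially. k n < r - (s + h)"
      using order_tendstoD(2)[OF k0, of "r - (s + h)"] sh by simp
    then obtain N where N: "\<And>n. n \<ge> N \<Longrightarrow> k n < r - (s + h)" by (auto simp: eventually_sequentially)
    have "norm (q n s - q n (s + h)) \<le> C * h" if "n \<ge> N" for n
    proof -
      have "q n s - q n (s + h) = - (bdiff h (bdiff (k n) f) s) /\<^sub>R k n"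
        by (simp add: q_def bdiff_def algebra_simps)
      then have "norm (q n s - q n (s + h)) = norm (bdiff h (bdiff (k n) f) s) / k n"
        using kpos[of n] by (simp add: divide_inverse)
      also have "\<dots> \<le> (C * h * k n) / k n"
        using sec[of s h "k n"] N[OF that] kpos[of n] s h by (intro divide_right_mono) auto
      finally show ?thesis using kpos[of n] by simp
    qed
    then show "\<exists>N. \<forall>n\<ge>N. norm (q n s - q n (s + h)) \<le> C * h" by blast
  qed
  \<comment> \<open>\<open>taylor\<close> only looks to the right; for \<open>y < x\<close> it is used at \<open>y\<close>, and \<open>glip\<close> exchanges \<open>g y\<close> for \<open>g x\<close>\<close>
  have "(f has_vector_derivative g x) (at x)"
    unfolding has_vector_derivative_def has_derivative_at2
  proof (intro conjI)
    show "bounded_linear (\<lambda>y. y *\<^sub>R g x)" by (rule bounded_linear_scaleR_left)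
    define E where "E y = f y - (f x + (y - x) *\<^sub>R g x)" for y
    define R where "R y = (1 / norm (y - x)) *\<^sub>R E y" for y
    have E: "norm (E y) \<le> 2 * C * \<bar>y - x\<bar>\<^sup>2" if y: "l < y" "y < r" "y \<noteq> x" for y
    proof (cases "x < y")
      case True
      have "norm (E y) \<le> C * (y - x)\<^sup>2"
        using taylor[of x "y - x"] True x y by (simp add: E_def diff_diff_eq)
      also have "\<dots> \<le> 2 * C * \<bar>y - x\<bar>\<^sup>2" using C by (simp add: mult_right_mono)
      finally show ?thesis .
    next
      case False
      then have yx: "y < x" using y by simp
      have 1: "norm (f x - f y - (x - y) *\<^sub>R g y) \<le> C * (x - y)\<^sup>2"
        using taylor[of y "x - y"] yx x y by simp
      have "norm (g y - g x) \<le> C * (x - y)" using glip[of y "x - y"] yx x y by simp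
      then have 2: "norm ((x - y) *\<^sub>R (g y - g x)) \<le> C * (x - y)\<^sup>2"
        using mult_left_mono[of _ _ "x - y"] yx by (simp add: power2_eq_square mult.left_commute)
      have "E y = - ((f x - f y - (x - y) *\<^sub>R g y) + (x - y) *\<^sub>R (g y - g x))"
        by (simp add: E_def scaleR_diff_right scaleR_diff_left)
      then have "norm (E y) \<le> C * (x - y)\<^sup>2 + C * (x - y)\<^sup>2"
        using norm_triangle_mono[OF 1 2] by (simp only: norm_minus_cancel)
      then show ?thesis by (simp add: power2_commute)
    qed
    have "norm (R y) \<le> 2 * C * \<bar>y - x\<bar>" if y: "l < y" "y < r" "y \<noteq> x" for y
    proof -
      have "norm (R y) = norm (E y) / \<bar>y - x\<bar>" by (simp add: R_def)
      also have "\<dots> \<le> (2 * C * \<bar>y - x\<bar>\<^sup>2) / \<bar>y - x\<bar>" by (intro divide_right_mono E y) simp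
      also have "(2 * C * \<bar>y - x\<bar>\<^sup>2) / \<bar>y - x\<bar> = 2 * C * \<bar>y - x\<bar>"
      proof -
        have *: "(2 * C * d\<^sup>2) / d = 2 * C * d" if "d \<noteq> 0" for d
          using that by (simp add: power2_eq_square)
        show ?thesis by (rule *) (use y in simp)
      qed
      finally show ?thesis .
    qed note R = this
    have "\<forall>\<^sub>F y in at x. y \<in> {l<..<r} - {x}" using x by (intro eventually_at_in_open) auto
    then have "\<forall>\<^sub>F y in at x. norm (R y) \<le> 2 * C * \<bar>y - x\<bar>"
      by eventually_elim (rule R, auto)
    moreover have "((\<lambda>y. 2 * C * \<bar>y - x\<bar>) \<longlongrightarrow> 2 * C * \<bar>x - x\<bar>) (at x)"
      by (intro tendsto_intros)
    ultimately have "(R \<longlongrightarrow> 0) (at x)" using Lim_null_comparison[of R] by simp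
    then show "((\<lambda>y. (1 / norm (y - x)) *\<^sub>R (f y - (f x + (y - x) *\<^sub>R g x))) \<longlongrightarrow> 0) (at x)"
      unfolding R_def E_def .
  qed
  then show ?thesis ..
qed

lemma has_vector_derivative_iff_quotient:
  fixes f :: "real \<Rightarrow> 'a::real_normed_vector"
  shows "(f has_vector_derivative d) (at t) \<longleftrightarrow> ((\<lambda>h. (f (t + h) - f t) /\<^sub>R h) \<longlongrightarrow> d) (at 0)"
proof -
  have "norm (f (t + h) - f t - h *\<^sub>R d) / norm h = norm ((f (t + h) - f t) /\<^sub>R h - d)" if "h \<noteq> 0" for h
  proof -
    have "(f (t + h) - f t) /\<^sub>R h - d = (f (t + h) - f t - h *\<^sub>R d) /\<^sub>R h"
      using that by (simp add: scaleR_diff_right)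
    then show ?thesis by (simp add: divide_inverse mult.commute)
  qed
  then have "((\<lambda>h. norm (f (t + h) - f t - h *\<^sub>R d) / norm h) \<longlongrightarrow> 0) (at 0) \<longleftrightarrow>
      ((\<lambda>h. norm ((f (t + h) - f t) /\<^sub>R h - d)) \<longlongrightarrow> 0) (at 0)"
    by (intro Lim_cong_within) auto
  then show ?thesis
    by (simp add: has_vector_derivative_def has_derivative_at bounded_linear_scaleR_left
        tendsto_norm_zero_iff LIM_zero_iff)
qed

section \<open>Completely monotone operator functions\<close>

text \<open>The condition that mediates between relaxation and the Hankel operator. It does not mention derivatives, which
  might be unbounded operators, and it survives pointwise limits.\<close>

definition alternating_operators :: "(real \<Rightarrow> 'a::complex_hilbert_space \<Rightarrow> 'a) \<Rightarrow> bool"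
  where "alternating_operators F \<longleftrightarrow>
    (\<forall>t>0. bounded_clinear (F t)) \<and>
    (\<forall>u. (\<forall>t>0. Im (cinner (F t u) u) = 0) \<and> alternating (\<lambda>t. Re (cinner (F t u) u)))"

lemma bdiff_op_form:
  fixes F :: "real \<Rightarrow> 'a::complex_hilbert_space \<Rightarrow> 'a"
  assumes "alternating_operators F" "0 < t" "\<forall>h\<in>set hs. 0 < h"
  shows "cinner (foldr bdiff hs (\<lambda>t. F t u) t) u = of_real (foldr bdiff hs (\<lambda>t. Re (cinner (F t u) u)) t)"
  using assms(2,3)
proof (induction hs arbitrary: t)
  case Nil
  then show ?case using assms(1) by (auto simp: alternating_operators_def complex_eq_iff)
next
  case (Cons h hs)
  then show ?case
    unfolding foldr_Cons o_apply by (subst (1 2) bdiff_def) (simp add: cinner_diff_left)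
qed

lemma bdiff_op_linear:
  fixes F :: "real \<Rightarrow> 'a::complex_hilbert_space \<Rightarrow> 'a"
  assumes "\<And>t. 0 < t \<Longrightarrow> bounded_clinear (F t)" "0 < t" "\<forall>h\<in>set hs. 0 < h"
  shows "foldr bdiff hs (\<lambda>t. F t (x + y)) t = foldr bdiff hs (\<lambda>t. F t x) t + foldr bdiff hs (\<lambda>t. F t y) t"
    and "foldr bdiff hs (\<lambda>t. F t (c *\<^sub>C x)) t = c *\<^sub>C foldr bdiff hs (\<lambda>t. F t x) t"
  using assms(2,3)
proof (induction hs arbitrary: t)
  case Nil
  { case 1 then show ?case using bounded_clinearD[OF assms(1)[of t]] by simp }
  { case 2 then show ?case using bounded_clinearD[OF assms(1)[of t]] by simp }
next
  case (Cons h hs)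
  { case 1 then show ?case using Cons.IH(1)[of t] Cons.IH(1)[of "t + h"] by (simp add: bdiff_def) }
  { case 2 then show ?case using Cons.IH(2)[of t] Cons.IH(2)[of "t + h"] by (simp add: bdiff_def scaleC_diff_right) }
qed

text \<open>A difference of an alternating family has a nonnegative form, so an upper bound for the form suffices to
  bound the difference in norm. The form at a single time \<open>s\<close> provides it for all vectors.\<close>

lemma norm_bdiff_op_le:
  fixes F :: "real \<Rightarrow> 'a::complex_hilbert_space \<Rightarrow> 'a"
  assumes F: "alternating_operators F" and hs: "\<forall>h\<in>set hs. 0 < h" and t: "0 < t"
    and bd: "\<And>u. foldr bdiff hs (\<lambda>t. Re (cinner (F t u) u)) t \<le> c * Re (cinner (F s u) u)"
    and s: "0 < s" and c: "0 \<le> c"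
  shows "norm (foldr bdiff hs (\<lambda>t. F t u) t) \<le> 4 * (c * onorm (F s)) * norm u"
proof (rule norm_le_quadratic_form[where T="\<lambda>u. foldr bdiff hs (\<lambda>t. F t u) t"])
  have bl: "\<And>t. 0 < t \<Longrightarrow> bounded_clinear (F t)" using F by (simp add: alternating_operators_def)
  show "foldr bdiff hs (\<lambda>t. F t (x + y)) t = foldr bdiff hs (\<lambda>t. F t x) t + foldr bdiff hs (\<lambda>t. F t y) t" for x y
    by (rule bdiff_op_linear(1)[OF bl t hs])
  show "foldr bdiff hs (\<lambda>t. F t (a *\<^sub>C x)) t = a *\<^sub>C foldr bdiff hs (\<lambda>t. F t x) t" for a x
    by (rule bdiff_op_linear(2)[OF bl t hs])
  show "cmod (cinner (foldr bdiff hs (\<lambda>t. F t x) t) x) \<le> c * onorm (F s) * (norm x)\<^sup>2" for x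
  proof -
    have "0 \<le> foldr bdiff hs (\<lambda>t. Re (cinner (F t x) x)) t"
      using F hs t by (auto simp: alternating_operators_def alternating_def)
    then have "cmod (cinner (foldr bdiff hs (\<lambda>t. F t x) t) x) \<le> c * Re (cinner (F s x) x)"
      unfolding bdiff_op_form[OF F t hs] using bd[of x] by simp
    also have "\<dots> \<le> c * (onorm (F s) * (norm x)\<^sup>2)"
    proof (intro mult_left_mono c)
      have "Re (cinner (F s x) x) \<le> norm (F s x) * norm x"
        using complex_Re_le_cmod cinner_Cauchy_Schwarz order_trans by blast
      also have "\<dots> \<le> (onorm (F s) * norm x) * norm x"
        using onorm[OF bounded_clinearD(1)[OF bl[OF s]]] by (intro mult_right_mono) auto
      finally show "Re (cinner (F s x) x) \<le> onorm (F s) * (norm x)\<^sup>2" by (simp add: power2_eq_square)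
    qed
    finally show ?thesis by (simp add: mult.assoc)
  qed
qed

text \<open>The scalar estimates lead from \<open>t\<close> back to the times \<open>t - a\<close> and \<open>t - 2 a\<close>, which are above \<open>a\<close>; as the
  forms decrease in time, the norm of \<open>F a\<close> controls the differences at all \<open>t > 3 a\<close>.\<close>

lemma alternating_operators_bounds:
  fixes F :: "real \<Rightarrow> 'a::complex_hilbert_space \<Rightarrow> 'a"
  assumes F: "alternating_operators F" and a: "0 < a"
  shows "\<exists>K\<ge>0. \<forall>u t h. 3 * a < t \<longrightarrow> 0 < h \<longrightarrow> h \<le> a \<longrightarrow>
      norm (bdiff h (\<lambda>t. F t u) t) \<le> K * norm u * h \<and>
      (\<forall>k. 0 < k \<longrightarrow> k \<le> a \<longrightarrow> norm (bdiff h (bdiff k (\<lambda>t. F t u)) t) \<le> K * norm u * h * k)"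
proof -
  define N where "N = onorm (F a)"
  have N: "0 \<le> N" unfolding N_def using F a
    by (auto simp: alternating_operators_def intro: onorm_pos_le bounded_clinearD(1))
  define K where "K = 8 * N / a + 16 * N / a\<^sup>2"
  have K: "K \<ge> 0" "8 * N / a \<le> K" "16 * N / a\<^sup>2 \<le> K" using N a by (auto simp: K_def)
  have alt: "alternating (\<lambda>t. Re (cinner (F t u) u))" for u
    using F by (simp add: alternating_operators_def)
  have mono: "Re (cinner (F s u) u) \<le> Re (cinner (F a u) u)" if "a \<le> s" for s u
    using alternating_antimono[OF alt a that] .
  have "norm (bdiff h (\<lambda>t. F t u) t) \<le> K * norm u * h \<and>
      (\<forall>k. 0 < k \<longrightarrow> k \<le> a \<longrightarrow> norm (bdiff h (bdiff k (\<lambda>t. F t u)) t) \<le> K * norm u * h * k)"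
    if t: "3 * a < t" and h: "0 < h" "h \<le> a" for u t h
  proof (intro conjI allI impI)
    have "norm (foldr bdiff [h] (\<lambda>t. F t u) t) \<le> 4 * ((2 * h / a) * onorm (F a)) * norm u"
    proof (rule norm_bdiff_op_le[OF F])
      fix u
      have "bdiff h (\<lambda>t. Re (cinner (F t u) u)) t \<le> (2 * h / a) * Re (cinner (F (t - a) u) u)"
        using alternating_bdiff_le[OF alt h] t a by simp
      also have "\<dots> \<le> (2 * h / a) * Re (cinner (F a u) u)"
        using mono[of "t - a"] t a h by (intro mult_left_mono) auto
      finally show "foldr bdiff [h] (\<lambda>t. Re (cinner (F t u) u)) t \<le> (2 * h / a) * Re (cinner (F a u) u)"
        by simp
    qed (use a h t in auto)
    also have "\<dots> = (8 * N / a) * norm u * h" by (simp add: N_def)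
    also have "\<dots> \<le> K * norm u * h" using K h by (intro mult_right_mono) auto
    finally show "norm (bdiff h (\<lambda>t. F t u) t) \<le> K * norm u * h" by simp
  next
    fix k :: real assume k: "0 < k" "k \<le> a"
    have "norm (foldr bdiff [h, k] (\<lambda>t. F t u) t) \<le> 4 * (((4 / a\<^sup>2) * h * k) * onorm (F a)) * norm u"
    proof (rule norm_bdiff_op_le[OF F])
      fix u
      have "bdiff h (bdiff k (\<lambda>t. Re (cinner (F t u) u))) t
          \<le> ((4 / a\<^sup>2) * h * k) * Re (cinner (F (t - 2 * a) u) u)"
        using alternating_bdiff2_le[OF alt h k] t a by simp
      also have "\<dots> \<le> ((4 / a\<^sup>2) * h * k) * Re (cinner (F a u) u)"
        using mono[of "t - 2 * a"] t a h k by (intro mult_left_mono) auto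
      finally show "foldr bdiff [h, k] (\<lambda>t. Re (cinner (F t u) u)) t
          \<le> ((4 / a\<^sup>2) * h * k) * Re (cinner (F a u) u)"
        by simp
    qed (use a h k t in auto)
    also have "\<dots> = (16 * N / a\<^sup>2) * norm u * h * k" by (simp add: N_def)
    also have "\<dots> \<le> K * norm u * h * k" using K h k by (intro mult_right_mono) auto
    finally show "norm (bdiff h (bdiff k (\<lambda>t. F t u)) t) \<le> K * norm u * h * k" by simp
  qed
  then show ?thesis using K(1) by blast
qed

text \<open>The negative of the derivative is a limit of the functions \<open>(F t - F (t + h)) / h\<close>, all of which are again
  alternating; so differentiation can be repeated.\<close>

lemma alternating_operators_derivative:
  fixes F :: "real \<Rightarrow> 'a::complex_hilbert_space \<Rightarrow> 'a"
  assumes F: "alternating_operators F"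
  shows "\<exists>F'. alternating_operators F' \<and>
    (\<forall>t>0. \<forall>u. ((\<lambda>s. F s u) has_vector_derivative - F' t u) (at t))"
proof -
  have bl: "\<And>t. 0 < t \<Longrightarrow> bounded_clinear (F t)" using F by (simp add: alternating_operators_def)
  have ex: "\<exists>d. ((\<lambda>s. F s u) has_vector_derivative d) (at t)" if t: "0 < t" for t u
  proof -
    define a where "a = t / 8"
    have a: "0 < a" using t by (simp add: a_def)
    obtain K where K: "K \<ge> 0" "\<And>u t h. 3 * a < t \<Longrightarrow> 0 < h \<Longrightarrow> h \<le> a \<Longrightarrow>
      norm (bdiff h (\<lambda>t. F t u) t) \<le> K * norm u * h"
      "\<And>u t h k. 3 * a < t \<Longrightarrow> 0 < h \<Longrightarrow> h \<le> a \<Longrightarrow> 0 < k \<Longrightarrow> k \<le> a \<Longrightarrow>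
        norm (bdiff h (bdiff k (\<lambda>t. F t u)) t) \<le> K * norm u * h * k"
      using alternating_operators_bounds[OF F a] by metis
    show ?thesis
      by (rule has_vector_derivative_of_second_differences[where l="t - a/2" and r="t + a/2"
            and C="K * norm u" and L="K * norm u"]) (use t in \<open>auto intro!: K simp: a_def\<close>)
  qed
  define F' where "F' t u = - vector_derivative (\<lambda>s. F s u) (at t)" for t u
  have der: "((\<lambda>s. F s u) has_vector_derivative - F' t u) (at t)" if "0 < t" for t u
    using ex[OF that, of u] vector_derivative_works differentiableI_vector unfolding F'_def by (metis minus_minus)
  have quot: "((\<lambda>h. inverse h *\<^sub>R bdiff h (\<lambda>s. F s u) t) \<longlongrightarrow> F' t u) (at_right 0)" if "0 < t" for t u
  proof -
    have "((\<lambda>h. - ((F (t + h) u - F t u) /\<^sub>R h)) \<longlongrightarrow> - (- F' t u)) (at_right 0)"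
      using der[OF that, of u] unfolding has_vector_derivative_iff_quotient filterlim_at_split
      by (intro tendsto_minus) blast
    then show ?thesis by (simp add: bdiff_def scaleR_diff_right)
  qed
  have ne: "at_right (0::real) \<noteq> bot" by simp
  have bdiffbl: "bdiff h (\<lambda>s. F s (x + y)) t = bdiff h (\<lambda>s. F s x) t + bdiff h (\<lambda>s. F s y) t"
    "bdiff h (\<lambda>s. F s (c *\<^sub>C x)) t = c *\<^sub>C bdiff h (\<lambda>s. F s x) t" if "0 < t" "0 < h" for t h x y c
    using bdiff_op_linear[OF bl that(1), where hs="[h]"] that(2) by simp_all
  have pos: "\<forall>\<^sub>F h::real in at_right 0. 0 < h" by (simp add: eventually_at_right_less)
  have lin: "bounded_clinear (F' t)" if t: "0 < t" for t
  proof -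
    have add: "F' t (x + y) = F' t x + F' t y" for x y
    proof (rule tendsto_unique[OF ne quot[OF t]])
      have "\<forall>\<^sub>F h in at_right 0. inverse h *\<^sub>R bdiff h (\<lambda>s. F s x) t + inverse h *\<^sub>R bdiff h (\<lambda>s. F s y) t
          = inverse h *\<^sub>R bdiff h (\<lambda>s. F s (x + y)) t"
        using pos by eventually_elim (simp add: bdiffbl t scaleR_add_right)
      then show "((\<lambda>h. inverse h *\<^sub>R bdiff h (\<lambda>s. F s (x + y)) t) \<longlongrightarrow> F' t x + F' t y) (at_right 0)"
        by (rule Lim_transform_eventually[OF tendsto_add[OF quot[OF t] quot[OF t]]])
    qed
    have scl: "F' t (c *\<^sub>C x) = c *\<^sub>C F' t x" for c x
    proof (rule tendsto_unique[OF ne quot[OF t]])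
      have "((\<lambda>h. c *\<^sub>C (inverse h *\<^sub>R bdiff h (\<lambda>s. F s x) t)) \<longlongrightarrow> c *\<^sub>C F' t x) (at_right 0)"
        by (rule continuous_on_tendsto_compose[OF continuous_scaleC quot[OF t]]) auto
      moreover have "\<forall>\<^sub>F h in at_right 0. c *\<^sub>C (inverse h *\<^sub>R bdiff h (\<lambda>s. F s x) t)
          = inverse h *\<^sub>R bdiff h (\<lambda>s. F s (c *\<^sub>C x)) t"
        using pos by eventually_elim (simp add: bdiffbl t scaleR_scaleC scaleC_scaleC mult.commute)
      ultimately show "((\<lambda>h. inverse h *\<^sub>R bdiff h (\<lambda>s. F s (c *\<^sub>C x)) t) \<longlongrightarrow> c *\<^sub>C F' t x) (at_right 0)"
        by (rule Lim_transform_eventually)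
    qed
    define a where "a = t / 4"
    have a: "0 < a" "3 * a < t" using t by (auto simp: a_def)
    obtain K where K: "\<And>u h. 0 < h \<Longrightarrow> h \<le> a \<Longrightarrow> norm (bdiff h (\<lambda>t. F t u) t) \<le> K * norm u * h"
      using alternating_operators_bounds[OF F a(1)] a(2) by metis
    have bd: "norm (F' t u) \<le> norm u * K" for u
    proof (rule tendsto_upperbound[OF tendsto_norm[OF quot[OF t]] _ ne])
      have "\<forall>\<^sub>F h in at_right 0. h < a" by (rule eventually_at_rightI[of 0 a]) (use a in auto)
      with pos show "\<forall>\<^sub>F h in at_right 0. norm (inverse h *\<^sub>R bdiff h (\<lambda>s. F s u) t) \<le> norm u * K"
      proof eventually_elim
        case (elim h)
        then have "inverse h * norm (bdiff h (\<lambda>s. F s u) t) \<le> inverse h * (K * norm u * h)"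
          using K[of h u] by (intro mult_left_mono) auto
        then show ?case using elim by (simp add: divide_inverse[symmetric] field_simps)
      qed
    qed
    have "F' t (r *\<^sub>R x) = r *\<^sub>R F' t x" for r x by (simp only: scaleR_scaleC scl)
    then have "bounded_linear (F' t)" by (rule bounded_linear_intro[where K=K, OF add _ bd])
    then show ?thesis by (simp add: bounded_clinear_def scl)
  qed
  have form: "((\<lambda>h. cinner (inverse h *\<^sub>R bdiff h (\<lambda>s. F s u) t) u) \<longlongrightarrow> cinner (F' t u) u) (at_right 0)"
    if "0 < t" for t u
    by (intro tendsto_cinner quot that tendsto_const)
  have formeq: "cinner (inverse h *\<^sub>R bdiff h (\<lambda>s. F s u) t) u
      = of_real (inverse h * bdiff h (\<lambda>s. Re (cinner (F s u) u)) t)" if "0 < t" "0 < h" for t h u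
    using bdiff_op_form[OF F that(1), where hs="[h]" and u=u] that(2) by (simp add: cinner_scaleR_left)
  have "Im (cinner (F' t u) u) = 0" if t: "0 < t" for t u
  proof (rule tendsto_unique[OF ne tendsto_Im[OF form[OF t]]])
    have "\<forall>\<^sub>F h in at_right 0. 0 = Im (cinner (inverse h *\<^sub>R bdiff h (\<lambda>s. F s u) t) u)"
      using pos by eventually_elim (simp add: formeq t)
    then show "((\<lambda>h. Im (cinner (inverse h *\<^sub>R bdiff h (\<lambda>s. F s u) t) u)) \<longlongrightarrow> 0) (at_right 0)"
      by (rule Lim_transform_eventually[OF tendsto_const])
  qed
  moreover have "alternating (\<lambda>t. Re (cinner (F' t u) u))" for u
  proof (rule alternating_limit[OF ne])
    show "\<forall>\<^sub>F h in at_right 0. alternating (\<lambda>t. inverse h * bdiff h (\<lambda>s. Re (cinner (F s u) u)) t)"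
      using pos
    proof eventually_elim
      case (elim h)
      then show ?case using F
        by (intro alternating_scale alternating_bdiff) (auto simp: alternating_operators_def)
    qed
    show "((\<lambda>h. inverse h * bdiff h (\<lambda>s. Re (cinner (F s u) u)) t) \<longlongrightarrow> Re (cinner (F' t u) u)) (at_right 0)"
      if t: "0 < t" for t
    proof (rule Lim_transform_eventually[OF tendsto_Re[OF form[OF t]]])
      show "\<forall>\<^sub>F h in at_right 0. Re (cinner (inverse h *\<^sub>R bdiff h (\<lambda>s. F s u) t) u)
          = inverse h * bdiff h (\<lambda>s. Re (cinner (F s u) u)) t"
        using pos by eventually_elim (simp add: formeq t del: of_real_mult)
    qed
  qed
  ultimately have "alternating_operators F'" using lin by (simp add: alternating_operators_def)
  then show ?thesis using der by blast
qed

lemma has_nth_derivative_unique: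
  "has_nth_derivative k f d t \<Longrightarrow> has_nth_derivative k f d' t \<Longrightarrow> d = d'"
proof (induction k arbitrary: d d' t)
  case (Suc k)
  obtain g g' where g: "\<forall>\<^sub>F s in nhds t. has_nth_derivative k f (g s) s" "(g has_vector_derivative d) (at t)"
    and g': "\<forall>\<^sub>F s in nhds t. has_nth_derivative k f (g' s) s" "(g' has_vector_derivative d') (at t)"
    using Suc.prems by auto
  have "\<forall>\<^sub>F s in nhds t. g s = g' s" using g(1) g'(1) by eventually_elim (rule Suc.IH)
  then have "(g has_vector_derivative d') (at t)"
    using g'(2) has_vector_derivative_cong_ev[where f=g and g=g' and x=t and S=UNIV]
    by (auto dest: eventually_nhds_x_imp_x elim: eventually_mono)
  then show ?case using g(2) vector_derivative_unique_at by blast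
qed simp

lemma strong_deriv_eqI:
  assumes "has_nth_derivative k (\<lambda>s. G s u) d t"
  shows "u \<in> strong_deriv_domain k G t" "strong_deriv k G t u = d"
proof -
  show "u \<in> strong_deriv_domain k G t" using assms unfolding strong_deriv_domain_def by blast
  show "strong_deriv k G t u = d"
    unfolding strong_deriv_def
  proof (rule the_equality)
    show "has_nth_derivative k (\<lambda>s. G s u) d t" by (rule assms)
    show "e = d" if "has_nth_derivative k (\<lambda>s. G s u) e t" for e
      by (rule has_nth_derivative_unique[OF that assms])
  qed
qed

text \<open>Differentiation leads from alternating families to alternating families, so the strong derivatives of all
  orders are bounded operators with full domain, for which self-adjointness is a consequence of the
  sign of the form.\<close>

theorem completely_monotone_if_alternating:
  fixes G :: "real \<Rightarrow> 'a::complex_hilbert_space \<Rightarrow> 'a"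
  assumes G: "alternating_operators G"
  shows "completely_monotone G"
proof -
  define step where "step F = (SOME F'. alternating_operators F' \<and>
    (\<forall>t>0. \<forall>u. ((\<lambda>s. F s u) has_vector_derivative - F' t u) (at t)))" for F :: "real \<Rightarrow> 'a \<Rightarrow> 'a"
  have step: "alternating_operators (step F)"
    "\<And>t u. 0 < t \<Longrightarrow> ((\<lambda>s. F s u) has_vector_derivative - step F t u) (at t)"
    if "alternating_operators F" for F
    using someI_ex[OF alternating_operators_derivative[OF that]] by (auto simp: step_def)
  define H where "H k = (step ^^ k) G" for k
  have alt: "alternating_operators (H k)" for k
    by (induction k) (auto simp: H_def G step)
  have der: "has_nth_derivative k (\<lambda>s. G s u) ((-1)^k *\<^sub>R H k t u) t" if "0 < t" for k t u
    using that
  proof (induction k arbitrary: t)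
    case (Suc k)
    have "\<forall>\<^sub>F s in nhds t. s \<in> {0<..}" using Suc.prems by (intro eventually_nhds_in_open) auto
    then have "\<forall>\<^sub>F s in nhds t. has_nth_derivative k (\<lambda>s. G s u) ((-1)^k *\<^sub>R H k s u) s"
      by eventually_elim (simp add: Suc.IH)
    moreover have "((\<lambda>s. (-1)^k *\<^sub>R H k s u) has_vector_derivative (-1)^k *\<^sub>R - H (Suc k) t u) (at t)"
      using step(2)[OF alt Suc.prems, of k u]
      by (intro bounded_linear.has_vector_derivative[OF bounded_linear_scaleR_right]) (simp add: H_def)
    ultimately show ?case by auto
  qed (simp add: H_def)
  have "nonneg_operator (strong_deriv_domain k G t) (\<lambda>u. (-1) ^ k *\<^sub>R strong_deriv k G t u)" if t: "0 < t" for k t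
  proof -
    have "strong_deriv_domain k G t = UNIV" using strong_deriv_eqI(1)[of k G, OF der[OF t]] by blast
    moreover have "(\<lambda>u. (-1) ^ k *\<^sub>R strong_deriv k G t u) = H k t"
      by (simp add: strong_deriv_eqI(2)[of k G, OF der[OF t]] power_mult_distrib[symmetric])
    moreover have "nonneg_operator UNIV (H k t)"
    proof (rule nonneg_operator_UNIV)
      have bl: "bounded_clinear (H k t)" using alt[of k] t by (simp add: alternating_operators_def)
      show "H k t (x + y) = H k t x + H k t y" "H k t (c *\<^sub>C x) = c *\<^sub>C H k t x" for x y c
        using bounded_clinearD[OF bl] by auto
      show "cinner (H k t x) x \<in> \<real>\<^sub>\<ge>\<^sub>0" for x
        using alt[of k] alternating_nonneg[of "\<lambda>t. Re (cinner (H k t x) x)" t] t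
        by (simp add: alternating_operators_def complex_nonneg_Reals_iff)
    qed
    ultimately show ?thesis by simp
  qed
  then show ?thesis by (simp add: completely_monotone_def)
qed

section \<open>Bounded positive definite functions on the half-line\<close>

text \<open>The value of the kernel \<open>\<phi> (s + t)\<close> on two finite combinations of point masses, each
  given as a list of (weight, point) pairs.\<close>

definition hankel_form :: "(real \<Rightarrow> real) \<Rightarrow> (real \<times> real) list \<Rightarrow> (real \<times> real) list \<Rightarrow> real"
  where "hankel_form \<phi> xs ys = (\<Sum>(c, s)\<leftarrow>xs. \<Sum>(d, t)\<leftarrow>ys. c * d * \<phi> (s + t))"

definition positive_definite :: "(real \<Rightarrow> real) \<Rightarrow> bool"
  where "positive_definite \<phi> \<longleftrightarrow> (\<forall>xs. (\<forall>(c, s)\<in>set xs. 0 \<le> s) \<longrightarrow> 0 \<le> hankel_form \<phi> xs xs)"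

text \<open>Shift all points by \<open>x\<close> and scale all weights by \<open>a\<close>. The shift can be moved from the point masses to the
  kernel, which is how differences of the kernel enter.\<close>

definition moved :: "real \<Rightarrow> real \<Rightarrow> (real \<times> real) list \<Rightarrow> (real \<times> real) list"
  where "moved a x xs = map (\<lambda>(c, s). (a * c, s + x)) xs"

lemma hankel_form_append:
  "hankel_form \<phi> (xs @ xs') ys = hankel_form \<phi> xs ys + hankel_form \<phi> xs' ys"
  "hankel_form \<phi> xs (ys @ ys') = hankel_form \<phi> xs ys + hankel_form \<phi> xs ys'"
  by (simp_all add: hankel_form_def sum_list_addf[symmetric] case_prod_unfold)

lemma hankel_form_moved:
  "hankel_form \<phi> (moved a x xs) ys = a * hankel_form (\<lambda>t. \<phi> (t + x)) xs ys"
  "hankel_form \<phi> xs (moved a x ys) = a * hankel_form (\<lambda>t. \<phi> (t + x)) xs ys"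
  by (simp_all add: hankel_form_def moved_def case_prod_unfold o_def sum_list_const_mult[symmetric]
      mult.assoc mult.left_commute add_ac)

lemma hankel_form_minus:
  "hankel_form (\<lambda>t. f t - g t) xs ys = hankel_form f xs ys - hankel_form g xs ys"
  by (simp add: hankel_form_def case_prod_unfold right_diff_distrib sum_list_subtractf)

lemma hankel_form_bounded:
  assumes "\<And>t. 0 \<le> t \<Longrightarrow> \<bar>\<phi> t\<bar> \<le> B" "\<forall>(c, s)\<in>set xs. 0 \<le> s" "\<forall>(c, s)\<in>set ys. 0 \<le> s"
  shows "\<bar>hankel_form \<phi> xs ys\<bar> \<le> (\<Sum>(c, s)\<leftarrow>xs. \<Sum>(d, t)\<leftarrow>ys. \<bar>c\<bar> * \<bar>d\<bar> * B)"
proof -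
  have "\<bar>hankel_form \<phi> xs ys\<bar> \<le> (\<Sum>p\<leftarrow>xs. \<bar>\<Sum>(d, t)\<leftarrow>ys. fst p * d * \<phi> (snd p + t)\<bar>)"
    unfolding hankel_form_def case_prod_unfold using sum_list_abs[of "map _ xs"] by (simp add: o_def)
  also have "\<dots> \<le> (\<Sum>p\<leftarrow>xs. \<Sum>q\<leftarrow>ys. \<bar>fst p\<bar> * \<bar>fst q\<bar> * B)"
  proof (rule sum_list_mono)
    fix p assume p: "p \<in> set xs"
    have "\<bar>\<Sum>(d, t)\<leftarrow>ys. fst p * d * \<phi> (snd p + t)\<bar> \<le> (\<Sum>q\<leftarrow>ys. \<bar>fst p * fst q * \<phi> (snd p + snd q)\<bar>)"
      unfolding case_prod_unfold using sum_list_abs[of "map _ ys"] by (simp add: o_def)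
    also have "\<dots> \<le> (\<Sum>q\<leftarrow>ys. \<bar>fst p\<bar> * \<bar>fst q\<bar> * B)"
      using assms p by (intro sum_list_mono) (fastforce simp: abs_mult intro!: mult_left_mono)
    finally show "\<bar>\<Sum>(d, t)\<leftarrow>ys. fst p * d * \<phi> (snd p + t)\<bar> \<le> (\<Sum>q\<leftarrow>ys. \<bar>fst p\<bar> * \<bar>fst q\<bar> * B)" .
  qed
  finally show ?thesis by (simp add: case_prod_unfold)
qed

text \<open>Let \<open>Q x\<close> be the form of the kernel moved by \<open>x\<close>. Cauchy-Schwarz gives
  \<open>(Q x)\<^sup>2 \<le> Q 0 * Q (2 x)\<close>; if \<open>Q\<close> increased from \<open>0\<close> to \<open>h\<close>, iterating this at the points \<open>2^n h\<close> would
  make \<open>Q\<close> unbounded.\<close>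

lemma positive_definite_bdiff:
  assumes pd: "positive_definite \<phi>" and bd: "\<And>t. 0 \<le> t \<Longrightarrow> \<bar>\<phi> t\<bar> \<le> B" and h: "0 < h"
  shows "positive_definite (bdiff h \<phi>)"
  unfolding positive_definite_def
proof (intro allI impI)
  fix xs :: "(real \<times> real) list" assume xs: "\<forall>(c, s)\<in>set xs. 0 \<le> s"
  define Q where "Q x = hankel_form (\<lambda>t. \<phi> (t + x)) xs xs" for x
  have mv: "\<forall>(c, s)\<in>set (moved a x xs). 0 \<le> s" if "0 \<le> x" for a x
    using xs that by (auto simp: moved_def)
  have Qpos: "0 \<le> Q x" if "0 \<le> x" for x
  proof -
    have "0 \<le> hankel_form \<phi> (moved 1 (x/2) xs) (moved 1 (x/2) xs)"
      using pd mv[of "x/2" 1] that unfolding positive_definite_def by auto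
    then show ?thesis by (simp add: hankel_form_moved Q_def add.assoc)
  qed
  have quad: "0 \<le> a\<^sup>2 * Q 0 + 2 * a * b * Q x + b\<^sup>2 * Q (2 * x)" if "0 \<le> x" for a b x
  proof -
    have "\<forall>(c, s)\<in>set (moved a 0 xs @ moved b x xs). 0 \<le> s"
      using mv[of 0 a] mv[of x b] that by (simp add: ball_Un)
    then have "0 \<le> hankel_form \<phi> (moved a 0 xs @ moved b x xs) (moved a 0 xs @ moved b x xs)"
      using pd unfolding positive_definite_def by blast
    then show ?thesis
      by (simp add: hankel_form_append hankel_form_moved Q_def power2_eq_square add.assoc algebra_simps)
  qed
  have CS: "(Q x)\<^sup>2 \<le> Q 0 * Q (2 * x)" if x: "0 \<le> x" for x
  proof (cases "Q (2 * x) = 0")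
    case True
    have "Q x = 0"
    proof (rule ccontr)
      assume ne: "Q x \<noteq> 0"
      have "0 \<le> 1\<^sup>2 * Q 0 + 2 * 1 * (- (Q 0 + 1) / Q x) * Q x + (- (Q 0 + 1) / Q x)\<^sup>2 * Q (2 * x)"
        by (rule quad[OF x])
      then show False using True ne Qpos[of 0] by simp
    qed
    then show ?thesis using True by simp
  next
    case False
    then have p: "0 < Q (2 * x)" using Qpos[of "2 * x"] x by simp
    have "0 \<le> (Q (2 * x))\<^sup>2 * Q 0 + 2 * Q (2 * x) * (- Q x) * Q x + (- Q x)\<^sup>2 * Q (2 * x)"
      by (rule quad[OF x])
    also have "\<dots> = Q (2 * x) * (Q 0 * Q (2 * x) - (Q x)\<^sup>2)" by (simp add: power2_eq_square algebra_simps)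
    finally show ?thesis using p by (simp add: zero_le_mult_iff)
  qed
  have "Q h \<le> Q 0"
  proof (rule ccontr)
    assume "\<not> Q h \<le> Q 0"
    then have gt: "Q 0 < Q h" by simp
    have Q0: "0 < Q 0"
    proof (rule ccontr)
      assume "\<not> 0 < Q 0"
      then have "Q 0 = 0" using Qpos[of 0] by simp
      then show False using CS[of h] h gt by simp
    qed
    define r where "r = Q h / Q 0"
    have r: "1 < r" using gt Q0 by (simp add: r_def)
    have grow: "Q 0 * r ^ (2 ^ n) \<le> Q (2 ^ n * h)" for n
    proof (induction n)
      case 0 then show ?case using Q0 by (simp add: r_def)
    next
      case (Suc n)
      have "(Q 0 * r ^ (2 ^ n))\<^sup>2 \<le> (Q (2 ^ n * h))\<^sup>2"
        using Suc Q0 r by (intro power_mono) auto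
      also have "\<dots> \<le> Q 0 * Q (2 ^ Suc n * h)" using CS[of "2 ^ n * h"] h by (simp add: mult.assoc)
      finally have "Q 0 * (Q 0 * (r ^ (2 ^ n))\<^sup>2) \<le> Q 0 * Q (2 ^ Suc n * h)"
        by (simp add: power_mult_distrib power2_eq_square mult_ac)
      then have "Q 0 * (r ^ (2 ^ n))\<^sup>2 \<le> Q (2 ^ Suc n * h)" using Q0 by simp
      then show ?case by (simp add: power_mult[symmetric] mult.commute)
    qed
    define S where "S = (\<Sum>(c, s)\<leftarrow>xs. \<Sum>(d, t)\<leftarrow>xs. \<bar>c\<bar> * \<bar>d\<bar> * B)"
    have S: "Q x \<le> S" if "0 \<le> x" for x
    proof -
      have "\<bar>Q x\<bar> \<le> S"
        unfolding Q_def S_def by (intro hankel_form_bounded xs bd) (use that in auto)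
      then show ?thesis by simp
    qed
    obtain n where n: "S / Q 0 < r ^ n" using real_arch_pow[OF r] by blast
    have "r ^ n \<le> r ^ (2 ^ n)" using r by (intro power_increasing) (auto intro: less_imp_le less_exp)
    then have "S / Q 0 < r ^ (2 ^ n)" using n by simp
    then have "S < Q 0 * r ^ (2 ^ n)" using Q0 by (simp add: field_simps)
    also have "\<dots> \<le> S" using grow[of n] S[of "2 ^ n * h"] h by simp
    finally show False by simp
  qed
  then show "0 \<le> hankel_form (bdiff h \<phi>) xs xs"
    by (simp add: Q_def bdiff_def[abs_def] hankel_form_minus)
qed

text \<open>Differences of \<open>\<phi>\<close> remain positive definite and bounded, and the form of a single point mass at \<open>t/2\<close> is the
  value of the kernel at \<open>t\<close>.\<close>

lemma alternating_if_positive_definite: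
  assumes "positive_definite \<phi>" and "\<And>t. 0 \<le> t \<Longrightarrow> \<bar>\<phi> t\<bar> \<le> B"
  shows "alternating \<phi>"
proof -
  have main: "positive_definite (foldr bdiff hs \<phi>) \<and> (\<exists>B. \<forall>t\<ge>0. \<bar>foldr bdiff hs \<phi> t\<bar> \<le> B)"
    if "\<forall>h\<in>set hs. 0 < h" for hs
    using that
  proof (induction hs)
    case Nil
    then show ?case using assms by auto
  next
    case (Cons h hs)
    then obtain C where C: "\<And>t. t \<ge> 0 \<Longrightarrow> \<bar>foldr bdiff hs \<phi> t\<bar> \<le> C" by auto
    have "\<bar>bdiff h (foldr bdiff hs \<phi>) t\<bar> \<le> C + C" if "0 \<le> t" for t
      unfolding bdiff_def[of h "foldr bdiff hs \<phi>"] using Cons.prems that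
      by (intro order_trans[OF abs_triangle_ineq4] add_mono C) auto
    moreover have "positive_definite (bdiff h (foldr bdiff hs \<phi>))"
      using Cons C by (intro positive_definite_bdiff[of _ C]) auto
    ultimately show ?case by auto
  qed
  have "0 \<le> foldr bdiff hs \<phi> t" if "\<forall>h\<in>set hs. 0 < h" "0 < t" for hs t
    using main[OF that(1)] that(2) unfolding positive_definite_def
    by (auto dest!: spec[of _ "[(1, t / 2)]"] simp: hankel_form_def)
  then show ?thesis by (simp add: alternating_def)
qed

section \<open>The Hausdorff moment problem for operators\<close>

text \<open>For moments \<open>a n = \<integral>x^n\<close> of a measure on the unit interval, \<open>seq_diff a m n\<close> is \<open>\<integral>x^n (1 - x)^m\<close>.\<close>

primrec seq_diff :: "(nat \<Rightarrow> 'a::ab_group_add) \<Rightarrow> nat \<Rightarrow> nat \<Rightarrow> 'a" where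
  "seq_diff a 0 n = a n"
| "seq_diff a (Suc m) n = seq_diff a m n - seq_diff a m (Suc n)"

lemma foldr_bdiff_replicate:
  "foldr bdiff (replicate m h) f (s + real n * h) = seq_diff (\<lambda>n. f (s + real n * h)) m n"
proof (induction m arbitrary: n)
  case (Suc m)
  have "s + real n * h + h = s + real (Suc n) * h" by (simp add: algebra_simps)
  then show ?case
    unfolding replicate_Suc foldr_Cons o_apply seq_diff.simps Suc.IH[symmetric]
    by (subst bdiff_def) (simp only:)
qed simp

text \<open>This is the expansion of \<open>x^n = x^n (x + (1 - x))^M\<close>.\<close>

lemma sum_binomial_seq_diff:
  fixes a :: "nat \<Rightarrow> 'a::real_vector"
  shows "(\<Sum>i\<le>M. real (M choose i) *\<^sub>R seq_diff a (M - i) (n + i)) = a n"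
proof (induction M arbitrary: n)
  case (Suc M)
  have "(\<Sum>i\<le>Suc M. real (Suc M choose i) *\<^sub>R seq_diff a (Suc M - i) (n + i))
      = seq_diff a (Suc M) n
        + (\<Sum>i\<le>M. real (Suc M choose Suc i) *\<^sub>R seq_diff a (M - i) (n + Suc i))"
    by (subst sum.atMost_Suc_shift) simp
  also have "\<dots> = (seq_diff a (Suc M) n + (\<Sum>i\<le>M. real (M choose Suc i) *\<^sub>R seq_diff a (M - i) (n + Suc i)))
      + (\<Sum>i\<le>M. real (M choose i) *\<^sub>R seq_diff a (M - i) (n + Suc i))"
    by (simp add: scaleR_add_left sum.distrib add_ac)
  also have "seq_diff a (Suc M) n + (\<Sum>i\<le>M. real (M choose Suc i) *\<^sub>R seq_diff a (M - i) (n + Suc i))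
      = (\<Sum>i\<le>Suc M. real (M choose i) *\<^sub>R seq_diff a (Suc M - i) (n + i))"
    unfolding sum.atMost_Suc_shift[of "\<lambda>i. real (M choose i) *\<^sub>R seq_diff a (Suc M - i) (n + i)"] by simp
  also have "\<dots> = (\<Sum>i\<le>M. real (M choose i) *\<^sub>R seq_diff a (Suc M - i) (n + i))" by simp
  also have "\<dots> + (\<Sum>i\<le>M. real (M choose i) *\<^sub>R seq_diff a (M - i) (n + Suc i))
      = (\<Sum>i\<le>M. real (M choose i) *\<^sub>R seq_diff a (M - i) (n + i))"
    unfolding sum.distrib[symmetric] scaleR_add_right[symmetric]
    by (intro sum.cong refl) (simp add: Suc_diff_le)
  finally show ?case using Suc by simp
qed simp

text \<open>The same expansion with all terms of total degree \<open>N\<close>. Its weights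
  \<open>(k choose n) / (N choose n)\<close> are close to \<open>(k/N)^n\<close>, as if \<open>seq_diff a (N - k) k\<close> were a mass at the
  point \<open>k/N\<close>.\<close>

lemma moment_eq_sum_seq_diff:
  fixes a :: "nat \<Rightarrow> 'a::real_vector"
  assumes n: "n \<le> N"
  shows "(\<Sum>k\<le>N. (real (N choose k) * (real (k choose n) / real (N choose n))) *\<^sub>R seq_diff a (N - k) k) = a n"
proof -
  have "(\<Sum>k\<le>N. (real (N choose k) * (real (k choose n) / real (N choose n))) *\<^sub>R seq_diff a (N - k) k)
      = (\<Sum>k\<in>{n..N}. (real (N choose k) * (real (k choose n) / real (N choose n))) *\<^sub>R seq_diff a (N - k) k)"
    by (intro sum.mono_neutral_right) auto
  also have "\<dots> = (\<Sum>k\<in>{n..N}. real (N - n choose (k - n)) *\<^sub>R seq_diff a (N - k) k)"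
  proof (intro sum.cong refl)
    fix k assume k: "k \<in> {n..N}"
    have "real (N choose k) * real (k choose n) = real (N choose n) * real (N - n choose (k - n))"
      using choose_mult[of n k N] k by (simp add: of_nat_mult[symmetric] del: of_nat_mult)
    moreover have "0 < real (N choose n)" using n by (simp add: zero_less_binomial)
    ultimately show "(real (N choose k) * (real (k choose n) / real (N choose n))) *\<^sub>R seq_diff a (N - k) k
        = real (N - n choose (k - n)) *\<^sub>R seq_diff a (N - k) k"
      by (simp add: field_simps)
  qed
  also have "\<dots> = (\<Sum>i\<le>N - n. real (N - n choose i) *\<^sub>R seq_diff a (N - n - i) (n + i))"
    by (rule sum.reindex_bij_witness[of _ "\<lambda>i. n + i" "\<lambda>k. k - n"]) (use n in auto)
  finally show ?thesis using sum_binomial_seq_diff[of "N - n" a n] by simp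
qed

text \<open>Both quantities are products of \<open>n\<close> factors of modulus at most \<open>1\<close>, and \<open>(k - l)/(N - l)\<close> is close to
  \<open>k/N\<close>.\<close>

lemma binomial_ratio_approx:
  assumes "k \<le> N" "2 * n < N"
  shows "\<bar>real (k choose n) / real (N choose n) - (real k / real N) ^ n\<bar> \<le> real n * (real n / (real N - real n))"
proof -
  define z where "z l = (real k - real l) / (real N - real l)" for l
  have "real (m choose n) = (\<Prod>l<n. real m - real l) / fact n" for m
    by (simp add: binomial_gbinomial gbinomial_prod_rev atLeast0LessThan)
  then have "real (k choose n) / real (N choose n) = (\<Prod>l<n. z l)"
    by (simp add: z_def prod_dividef)
  then have "\<bar>real (k choose n) / real (N choose n) - (real k / real N) ^ n\<bar>
      = norm ((\<Prod>l<n. z l) - (\<Prod>l<n. real k / real N))" by simp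
  also have "\<dots> \<le> (\<Sum>l<n. norm (z l - real k / real N))"
  proof (rule norm_prod_diff)
    show "norm (z l) \<le> 1" if "l \<in> {..<n}" for l
      using that assms by (auto simp: z_def abs_le_iff divide_simps)
    show "norm (real k / real N) \<le> 1" using assms by (auto simp: divide_simps)
  qed
  also have "\<dots> \<le> (\<Sum>l<n. real n / (real N - real n))"
  proof (intro sum_mono)
    fix l assume l: "l \<in> {..<n}"
    have N: "0 < real N" "0 < real N - real l" using l assms by auto
    have "z l - real k / real N = - ((real N - real k) / real N * (real l / (real N - real l)))"
      using N by (simp add: z_def divide_simps) (simp add: algebra_simps)
    then have "norm (z l - real k / real N) = (real N - real k) / real N * (real l / (real N - real l))"
      using N assms by (simp add: abs_mult)
    also have "\<dots> \<le> 1 * (real n / (real N - real n))"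
      using N l assms by (intro mult_mono frac_le) (auto simp: divide_simps)
    finally show "norm (z l - real k / real N) \<le> real n / (real N - real n)" by simp
  qed
  finally show ?thesis by simp
qed

lemma nonneg_Reals_sum:
  "(\<And>i. i \<in> I \<Longrightarrow> f i \<in> \<real>\<^sub>\<ge>\<^sub>0) \<Longrightarrow> (\<Sum>i\<in>I. f i) \<in> (\<real>\<^sub>\<ge>\<^sub>0 :: complex set)"
  by (induction I rule: infinite_finite_induct) (auto intro: nonneg_Reals_add_I)

lemma seq_diff_linear:
  fixes a :: "nat \<Rightarrow> 'a::complex_hilbert_space \<Rightarrow> 'a"
  assumes "\<And>n x y. a n (x + y) = a n x + a n y" "\<And>n c x. a n (c *\<^sub>C x) = c *\<^sub>C a n x"
  shows "seq_diff (\<lambda>n. a n (x + y)) m n = seq_diff (\<lambda>n. a n x) m n + seq_diff (\<lambda>n. a n y) m n"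
    and "seq_diff (\<lambda>n. a n (c *\<^sub>C x)) m n = c *\<^sub>C seq_diff (\<lambda>n. a n x) m n"
proof -
  show "seq_diff (\<lambda>n. a n (x + y)) m n = seq_diff (\<lambda>n. a n x) m n + seq_diff (\<lambda>n. a n y) m n"
    by (induction m arbitrary: n) (simp_all add: assms)
  show "seq_diff (\<lambda>n. a n (c *\<^sub>C x)) m n = c *\<^sub>C seq_diff (\<lambda>n. a n x) m n"
    by (induction m arbitrary: n) (simp_all add: assms scaleC_diff_right)
qed

text \<open>Replacing \<open>(k choose n) / (N choose n)\<close> by \<open>(k/N)^n\<close> in the expansion of the moments turns the
  sum into a combination, with positive weights, of nonnegative forms evaluated at single vectors. The
  error is small because the total mass of the forms is the zeroth moment, independently of \<open>N\<close>.\<close>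

lemma hausdorff_moments_positive:
  fixes a :: "nat \<Rightarrow> 'a::complex_hilbert_space \<Rightarrow> 'a"
  assumes add: "\<And>n x y. a n (x + y) = a n x + a n y" and sc: "\<And>n c x. a n (c *\<^sub>C x) = c *\<^sub>C a n x"
    and nn: "\<And>x m n. cinner (seq_diff (\<lambda>n. a n x) m n) x \<in> \<real>\<^sub>\<ge>\<^sub>0"
  shows "(\<Sum>i<m. \<Sum>j<m. cinner (a (i + j) (u j)) (u i)) \<in> \<real>\<^sub>\<ge>\<^sub>0"
proof -
  define D where "D N k x = seq_diff (\<lambda>n. a n x) (N - k) k" for N k x
  have Dadd: "D N k (x + y) = D N k x + D N k y" and Dsc: "D N k (c *\<^sub>C x) = c *\<^sub>C D N k x" for N k x y c
    unfolding D_def by (rule seq_diff_linear[OF add sc])+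
  have DscR: "D N k (r *\<^sub>R x) = r *\<^sub>R D N k x" for N k r x by (simp only: scaleR_scaleC Dsc)
  have Dnn: "cinner (D N k x) x \<in> \<real>\<^sub>\<ge>\<^sub>0" for N k x unfolding D_def by (rule nn)
  have D0: "D N k 0 = 0" for N k using Dadd[of N k 0 0] by simp
  have Dsum: "D N k (\<Sum>j\<in>J. f j) = (\<Sum>j\<in>J. D N k (f j))" for N k J and f :: "nat \<Rightarrow> 'a"
    by (induction J rule: infinite_finite_induct) (simp_all add: D0 Dadd)
  define \<rho> where "\<rho> N n k = real (k choose n) / real (N choose n)" for N n k :: nat
  have moment: "(\<Sum>k\<le>N. of_real (real (N choose k) * \<rho> N n k) * cinner (D N k x) y) = cinner (a n x) y"
    if "n \<le> N" for N n x y
    unfolding moment_eq_sum_seq_diff[OF that, of "\<lambda>n. a n x", symmetric]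
      bounded_bilinear.sum_left[OF bounded_bilinear_cinner] cinner_scaleR_left D_def \<rho>_def ..
  define Sm where "Sm = (\<Sum>i<m. \<Sum>j<m. cinner (a (i + j) (u j)) (u i))"
  define y where "y N k = (\<Sum>j<m. (real k / real N)^j *\<^sub>R u j)" for N k
  define P where "P N = (\<Sum>k\<le>N. of_real (real (N choose k)) * cinner (D N k (y N k)) (y N k))" for N
  define A where "A i j = (Re (cinner (a 0 (u j)) (u j)) + Re (cinner (a 0 (u i)) (u i))) / 2" for i j
  \<comment> \<open>all exponents \<open>i + j\<close> are below \<open>2 m\<close>\<close>
  define \<epsilon> where "\<epsilon> N = (2 * real m) * ((2 * real m) / (real N - 2 * real m))" for N
  \<comment> \<open>the powers of \<open>k/N\<close> factor, so the double sum collapses to the form at the single vector \<open>y N k\<close>\<close>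
  have Pnn: "P N \<in> \<real>\<^sub>\<ge>\<^sub>0" for N
    unfolding P_def by (intro nonneg_Reals_sum nonneg_Reals_mult_I Dnn) auto
  have Pexp: "P N = (\<Sum>i<m. \<Sum>j<m. \<Sum>k\<le>N. of_real (real (N choose k) * (real k / real N)^(i + j)) * cinner (D N k (u j)) (u i))" for N
  proof -
    have "cinner (D N k (y N k)) (y N k)
        = (\<Sum>i<m. \<Sum>j<m. of_real ((real k / real N)^(i + j)) * cinner (D N k (u j)) (u i))" for k
      unfolding y_def Dsum DscR bounded_bilinear.sum_left[OF bounded_bilinear_cinner]
        bounded_bilinear.sum_right[OF bounded_bilinear_cinner] cinner_scaleR_left cinner_scaleR_right
      by (simp add: power_add mult_ac sum_distrib_left)
    then have "P N = (\<Sum>k\<le>N. \<Sum>i<m. \<Sum>j<m. of_real (real (N choose k) * (real k / real N)^(i + j)) * cinner (D N k (u j)) (u i))"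
      unfolding P_def by (simp add: sum_distrib_left mult.assoc)
    also have "\<dots> = (\<Sum>i<m. \<Sum>k\<le>N. \<Sum>j<m. of_real (real (N choose k) * (real k / real N)^(i + j)) * cinner (D N k (u j)) (u i))" by (rule sum.swap)
    also have "\<dots> = (\<Sum>i<m. \<Sum>j<m. \<Sum>k\<le>N. of_real (real (N choose k) * (real k / real N)^(i + j)) * cinner (D N k (u j)) (u i))" by (intro sum.cong refl sum.swap)
    finally show ?thesis .
  qed
  have est: "norm (Sm - P N) \<le> \<epsilon> N * (\<Sum>i<m. \<Sum>j<m. A i j)" if N: "4 * m < N" for N
  proof -
    have "norm (cinner (a (i + j) (u j)) (u i)
        - (\<Sum>k\<le>N. of_real (real (N choose k) * (real k / real N)^(i + j)) * cinner (D N k (u j)) (u i))) \<le> \<epsilon> N * A i j"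
      if ij: "i < m" "j < m" for i j
    proof -
      have "cinner (a (i + j) (u j)) (u i) = (\<Sum>k\<le>N. of_real (real (N choose k) * \<rho> N (i + j) k) * cinner (D N k (u j)) (u i))"
        using N ij by (intro moment[symmetric]) auto
      then have "norm (cinner (a (i + j) (u j)) (u i)
        - (\<Sum>k\<le>N. of_real (real (N choose k) * (real k / real N)^(i + j)) * cinner (D N k (u j)) (u i)))
        = norm (\<Sum>k\<le>N. of_real (real (N choose k) * (\<rho> N (i + j) k - (real k / real N)^(i + j))) * cinner (D N k (u j)) (u i))"
        by (simp add: sum_subtractf[symmetric] algebra_simps)
      also have "\<dots> \<le> (\<Sum>k\<le>N. real (N choose k) * \<epsilon> N * ((Re (cinner (D N k (u j)) (u j)) + Re (cinner (D N k (u i)) (u i))) / 2))"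
      proof (rule sum_norm_le)
        fix k assume k: "k \<in> {..N}"
        have "\<bar>\<rho> N (i + j) k - (real k / real N)^(i + j)\<bar> \<le> real (i + j) * (real (i + j) / (real N - real (i + j)))"
          unfolding \<rho>_def using k N ij by (intro binomial_ratio_approx) auto
        also have "\<dots> \<le> \<epsilon> N"
          unfolding \<epsilon>_def using N ij by (intro mult_mono frac_le) auto
        finally have "\<bar>\<rho> N (i + j) k - (real k / real N)^(i + j)\<bar> \<le> \<epsilon> N" .
        moreover have "cmod (cinner (D N k (u j)) (u i)) \<le> (Re (cinner (D N k (u j)) (u j)) + Re (cinner (D N k (u i)) (u i))) / 2"
          by (rule nonneg_form_le[of "D N k", OF Dadd Dsc Dnn])
        ultimately show "norm (of_real (real (N choose k) * (\<rho> N (i + j) k - (real k / real N)^(i + j))) * cinner (D N k (u j)) (u i))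
          \<le> real (N choose k) * \<epsilon> N * ((Re (cinner (D N k (u j)) (u j)) + Re (cinner (D N k (u i)) (u i))) / 2)"
          unfolding norm_mult norm_of_real abs_mult by (intro mult_mono) auto
      qed
      also have "\<dots> = \<epsilon> N * A i j"
      proof -
        have "(\<Sum>k\<le>N. real (N choose k) * Re (cinner (D N k x) x)) = Re (cinner (a 0 x) x)" for x
          using arg_cong[OF moment[of 0 N x x], of Re] by (simp add: \<rho>_def)
        note mass = this
        have "(\<Sum>k\<le>N. real (N choose k) * \<epsilon> N * ((Re (cinner (D N k (u j)) (u j)) + Re (cinner (D N k (u i)) (u i))) / 2))
            = (\<epsilon> N / 2) * ((\<Sum>k\<le>N. real (N choose k) * Re (cinner (D N k (u j)) (u j)))
              + (\<Sum>k\<le>N. real (N choose k) * Re (cinner (D N k (u i)) (u i))))"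
          unfolding sum.distrib[symmetric] sum_distrib_left
          by (intro sum.cong refl) (simp add: algebra_simps)
        then show ?thesis unfolding A_def mass by simp
      qed
      finally show ?thesis .
    qed
    then have "norm (\<Sum>i<m. \<Sum>j<m. (cinner (a (i + j) (u j)) (u i)
        - (\<Sum>k\<le>N. of_real (real (N choose k) * (real k / real N)^(i + j)) * cinner (D N k (u j)) (u i))))
        \<le> (\<Sum>i<m. \<Sum>j<m. \<epsilon> N * A i j)"
      by (intro sum_norm_le) auto
    then show ?thesis unfolding Sm_def Pexp by (simp only: sum_subtractf sum_distrib_left)
  qed
  have "\<epsilon> \<longlonglongrightarrow> 0" unfolding \<epsilon>_def by real_asymp
  then have lim: "(\<lambda>N. \<epsilon> N * (\<Sum>i<m. \<Sum>j<m. A i j)) \<longlonglongrightarrow> 0" by (rule tendsto_mult_left_zero)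
  have ev: "\<forall>\<^sub>F N in sequentially. norm (Sm - P N) \<le> \<epsilon> N * (\<Sum>i<m. \<Sum>j<m. A i j)"
    using eventually_gt_at_top[of "4 * m"] by eventually_elim (rule est)
  have "(\<lambda>N. Sm - P N) \<longlonglongrightarrow> 0" by (rule Lim_null_comparison[OF ev lim])
  from tendsto_diff[OF tendsto_const this, of Sm] have "P \<longlonglongrightarrow> Sm" by simp
  then show ?thesis
    unfolding Sm_def[symmetric] using Lim_in_closed_set[of "\<real>\<^sub>\<ge>\<^sub>0" P sequentially Sm] Pnn by simp
qed

lemma alternating_operators_grid_positive:
  fixes G :: "real \<Rightarrow> 'a::complex_hilbert_space \<Rightarrow> 'a"
  assumes G: "alternating_operators G" and h: "0 < h" and s: "0 < s"
  shows "(\<Sum>i<m. \<Sum>j<m. cinner (G (s + real (i + j) * h) (u j)) (u i)) \<in> \<real>\<^sub>\<ge>\<^sub>0"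
proof (rule hausdorff_moments_positive)
  have pos: "0 < s + real n * h" for n using s h by (simp add: add_pos_nonneg)
  have bl: "bounded_clinear (G (s + real n * h))" for n
    using G pos by (simp add: alternating_operators_def)
  show "G (s + real n * h) (x + y) = G (s + real n * h) x + G (s + real n * h) y"
    "G (s + real n * h) (c *\<^sub>C x) = c *\<^sub>C G (s + real n * h) x" for n x y c
    using bounded_clinearD[OF bl] by auto
  show "cinner (seq_diff (\<lambda>n. G (s + real n * h) x) m n) x \<in> \<real>\<^sub>\<ge>\<^sub>0" for x m n
  proof -
    have "\<forall>h\<in>set (replicate m h). 0 < h" using h by simp
    moreover from this have "0 \<le> foldr bdiff (replicate m h) (\<lambda>t. Re (cinner (G t x) x)) (s + real n * h)"
      using G pos[of n] unfolding alternating_operators_def alternating_def by blast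
    ultimately show ?thesis
      unfolding foldr_bdiff_replicate[of m h "\<lambda>t. G t x", symmetric]
      by (simp only: bdiff_op_form[OF G pos] nonneg_Reals_of_real_iff)
  qed
qed

section \<open>The form of the Hankel operator\<close>

lemma integrable_exp_decay:
  assumes "0 < a" shows "integrable lborel (\<lambda>t::real. indicator {0..} t * exp (- a * t))"
proof -
  interpret prob_space "density lborel (exponential_density a)"
    by (rule prob_space_exponential_density[OF assms])
  have "(\<integral>\<^sup>+t. ennreal (exponential_density a t) \<partial>lborel) = 1"
    using emeasure_space_1 by (simp add: emeasure_density)
  then have "integrable lborel (exponential_density a)"
    using exponential_density_nonneg[OF assms] by (intro integrableI_nonneg) auto
  then have "integrable lborel (\<lambda>t. exponential_density a t / a)" by simp
  also have "(\<lambda>t. exponential_density a t / a) = (\<lambda>t. indicator {0..} t * exp (- a * t))"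
    using assms by (auto simp: exponential_density_def fun_eq_iff mult.commute)
  finally show ?thesis .
qed

text \<open>A stable semigroup satisfies these conditions, and so do the impulse responses built from it.\<close>

locale decaying_response =
  fixes G :: "real \<Rightarrow> 'u::{complex_hilbert_space, second_countable_topology} \<Rightarrow> 'u"
    and M \<alpha> :: real
  assumes bl: "\<And>t. 0 \<le> t \<Longrightarrow> bounded_clinear (G t)"
    and decay: "\<And>t x. 0 \<le> t \<Longrightarrow> norm (G t x) \<le> M * exp (- \<alpha> * t) * norm x"
    and M: "0 < M" and \<alpha>: "0 < \<alpha>"
    and cont: "\<And>x. continuous_on {0..} (\<lambda>t. G t x)"
begin

text \<open>An extension to the whole line, so that all integrals can be taken over the real line.\<close>

definition G' :: "real \<Rightarrow> 'u \<Rightarrow> 'u"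
  where "G' t = G (max 0 t)"

lemma G'_eq: "0 \<le> t \<Longrightarrow> G' t = G t"
  by (simp add: G'_def max_def)

lemma G'_linear:
  "G' t (x + y) = G' t x + G' t y" "G' t (x - y) = G' t x - G' t y" "G' t (c *\<^sub>C x) = c *\<^sub>C G' t x"
  "G' t (r *\<^sub>R x) = r *\<^sub>R G' t x" "G' t 0 = 0" "bounded_linear (G' t)"
  using bounded_clinearD[OF bl[of "max 0 t"]] by (auto simp: G'_def)

lemma norm_G'_le: "norm (G' t x) \<le> M * norm x"
proof -
  have "M * exp (- \<alpha> * max 0 t) * norm x \<le> M * 1 * norm x"
    using M \<alpha> by (intro mult_right_mono mult_left_mono) auto
  then show ?thesis using decay[of "max 0 t" x] by (simp add: G'_def)
qed

lemma norm_G'_decay: "norm (G' t x) \<le> M * exp (- \<alpha> * t) * norm x"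
proof -
  have "M * exp (- \<alpha> * max 0 t) * norm x \<le> M * exp (- \<alpha> * t) * norm x"
    using M \<alpha> by (intro mult_right_mono mult_left_mono) auto
  then show ?thesis using decay[of "max 0 t" x] by (simp add: G'_def)
qed

lemma norm_G'_add_le: "norm (G' (t + \<tau>) x) \<le> M * exp (- \<alpha> * t) * (exp (- \<alpha> * \<tau>) * norm x)"
proof -
  have "exp (- \<alpha> * (t + \<tau>)) = exp (- \<alpha> * t) * exp (- \<alpha> * \<tau>)"
    by (simp add: exp_add[symmetric] distrib_left)
  then show ?thesis using norm_G'_decay[of "t + \<tau>" x] by (simp only: mult.assoc)
qed

lemma G'_tendsto:
  assumes "(f \<longlongrightarrow> s) F" "(g \<longlongrightarrow> x) F"
  shows "((\<lambda>i. G' (f i) (g i)) \<longlongrightarrow> G' s x) F"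
proof -
  have "continuous_on UNIV (\<lambda>t. G' t x)"
    unfolding G'_def by (intro continuous_on_compose2[OF cont] continuous_intros) auto
  then have 1: "((\<lambda>i. G' (f i) x) \<longlongrightarrow> G' s x) F"
    using continuous_on_tendsto_compose[OF _ assms(1), of UNIV "\<lambda>t. G' t x"] by simp
  have "((\<lambda>i. G' (f i) (g i - x)) \<longlongrightarrow> 0) F"
  proof (rule Lim_null_comparison)
    show "\<forall>\<^sub>F i in F. norm (G' (f i) (g i - x)) \<le> M * norm (g i - x)"
      by (intro always_eventually allI norm_G'_le)
    have "((\<lambda>i. M * norm (g i - x)) \<longlongrightarrow> M * norm (x - x)) F" by (intro tendsto_intros assms)
    then show "((\<lambda>i. M * norm (g i - x)) \<longlongrightarrow> 0) F" by simp
  qed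
  from tendsto_add[OF this 1] show ?thesis by (simp add: G'_linear(2))
qed

lemma G'_measurable [measurable (raw)]:
  assumes [measurable]: "f \<in> borel_measurable N" "g \<in> borel_measurable N"
  shows "(\<lambda>w. G' (f w) (g w)) \<in> borel_measurable N"
proof -
  have "continuous_on UNIV (\<lambda>p. G' (fst p) (snd p))"
    unfolding continuous_on_def
    by (intro ballI G'_tendsto tendsto_fst[OF tendsto_ident_at] tendsto_snd[OF tendsto_ident_at])
  then have "(\<lambda>p. G' (fst p) (snd p)) \<in> borel_measurable borel" by (rule borel_measurable_continuous_onI)
  then have [measurable]: "(\<lambda>p. G' (fst p) (snd p)) \<in> borel_measurable (borel \<Otimes>\<^sub>M borel)"
    by (simp add: borel_prod)
  have "(\<lambda>w. (f w, g w)) \<in> N \<rightarrow>\<^sub>M borel \<Otimes>\<^sub>M borel" by measurable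
  from measurable_compose[OF this, of "\<lambda>p. G' (fst p) (snd p)" borel] show ?thesis by simp
qed

text \<open>Square integrable functions on the half-line, extended by zero.\<close>

definition signals :: "(real \<Rightarrow> 'u) set"
  where "signals = {w \<in> L2_fun lborel. \<forall>t<0. w t = 0}"

lemma signals_measurable [measurable_dest]: "w \<in> signals \<Longrightarrow> w \<in> borel_measurable borel"
  using L2_funD[of w lborel] by (simp add: signals_def)

lemma signal_exp_integrable:
  assumes w: "w \<in> signals"
  shows "integrable lborel (\<lambda>t. exp (- \<alpha> * t) * norm (w t))"
proof (rule Bochner_Integration.integrable_bound)
  show "integrable lborel (\<lambda>t. indicator {0..} t * exp (- (2 * \<alpha>) * t) + (norm (w t))\<^sup>2)"
    using w \<alpha> by (intro Bochner_Integration.integrable_add integrable_exp_decay L2_fun_integrable)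
      (auto simp: signals_def)
  note [measurable] = signals_measurable[OF w]
  show "(\<lambda>t. exp (- \<alpha> * t) * norm (w t)) \<in> borel_measurable lborel" by measurable
  have "exp (- \<alpha> * t) * norm (w t) \<le> indicator {0..} t * exp (- (2 * \<alpha>) * t) + (norm (w t))\<^sup>2" for t
  proof (cases "0 \<le> t")
    case True
    have "0 \<le> (exp (- \<alpha> * t) - norm (w t))\<^sup>2" by simp
    then have "2 * (exp (- \<alpha> * t) * norm (w t)) \<le> (exp (- \<alpha> * t))\<^sup>2 + (norm (w t))\<^sup>2"
      by (simp add: power2_diff)
    moreover have "0 \<le> exp (- \<alpha> * t) * norm (w t)" by simp
    moreover have "(exp (- \<alpha> * t))\<^sup>2 = exp (- (2 * \<alpha>) * t)" by (simp add: exp_double[symmetric])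
    moreover have "indicator {0..} t = (1::real)" using True by simp
    ultimately show ?thesis by (simp only: mult_1_left)
  qed (use w in \<open>simp add: signals_def\<close>)
  then show "AE t in lborel. norm (exp (- \<alpha> * t) * norm (w t))
      \<le> norm (indicator {0..} t * exp (- (2 * \<alpha>) * t) + (norm (w t))\<^sup>2)"
    by (intro AE_I2) (simp add: abs_of_nonneg)
qed

lemma hankel_integrable:
  assumes w: "w \<in> signals" shows "integrable lborel (\<lambda>\<tau>. G' (t + \<tau>) (w \<tau>))"
proof (rule Bochner_Integration.integrable_bound)
  note [measurable] = signals_measurable[OF w]
  show "integrable lborel (\<lambda>\<tau>. M * exp (- \<alpha> * t) * (exp (- \<alpha> * \<tau>) * norm (w \<tau>)))"
    by (intro integrable_mult_right signal_exp_integrable w)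
  show "AE \<tau> in lborel. norm (G' (t + \<tau>) (w \<tau>)) \<le> norm (M * exp (- \<alpha> * t) * (exp (- \<alpha> * \<tau>) * norm (w \<tau>)))"
  proof (rule AE_I2)
    fix \<tau> show "norm (G' (t + \<tau>) (w \<tau>)) \<le> norm (M * exp (- \<alpha> * t) * (exp (- \<alpha> * \<tau>) * norm (w \<tau>)))"
      using norm_G'_add_le[of t \<tau> "w \<tau>"] M by (simp add: abs_mult)
  qed
  show "(\<lambda>\<tau>. G' (t + \<tau>) (w \<tau>)) \<in> borel_measurable lborel" by measurable
qed

definition hankel_fun :: "(real \<Rightarrow> 'u) \<Rightarrow> real \<Rightarrow> 'u"
  where "hankel_fun w t = (\<integral>\<tau>. G' (t + \<tau>) (w \<tau>) \<partial>lborel)"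

lemma hankel_fun_measurable [measurable]:
  assumes w: "w \<in> signals" shows "hankel_fun w \<in> borel_measurable borel"
proof -
  note [measurable] = signals_measurable[OF w, unfolded measurable_lborel2]
  show ?thesis unfolding hankel_fun_def by measurable
qed

lemma norm_hankel_fun_le:
  assumes w: "w \<in> signals"
  shows "norm (hankel_fun w t) \<le> M * exp (- \<alpha> * t) * (\<integral>\<tau>. exp (- \<alpha> * \<tau>) * norm (w \<tau>) \<partial>lborel)"
proof -
  have "norm (hankel_fun w t) \<le> (\<integral>\<tau>. norm (G' (t + \<tau>) (w \<tau>)) \<partial>lborel)"
    unfolding hankel_fun_def by (rule integral_norm_bound)
  also have "\<dots> \<le> (\<integral>\<tau>. M * exp (- \<alpha> * t) * (exp (- \<alpha> * \<tau>) * norm (w \<tau>)) \<partial>lborel)"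
    by (intro integral_mono integrable_mult_right signal_exp_integrable w integrable_norm
        hankel_integrable norm_G'_add_le)
  finally show ?thesis by simp
qed

definition extend :: "'u L2_half \<Rightarrow> real \<Rightarrow> 'u"
  where "extend v t = indicator {0..} t *\<^sub>R rep_L2_half v t"

lemma indicator_scaleR_signal:
  assumes "v \<in> L2_fun lborel_nonneg" shows "(\<lambda>t. indicator {0..} t *\<^sub>R v t) \<in> signals"
proof -
  have "(\<lambda>t. (norm (indicator {0..} t *\<^sub>R v t))\<^sup>2) = (\<lambda>t. indicator {0..} t *\<^sub>R (norm (v t))\<^sup>2)"
    by (auto simp: indicator_def)
  then show ?thesis
    using assms by (auto simp: signals_def L2_fun_def borel_measurable_restrict_space_iff integrable_restrict_space)
qed

lemma extend_signal: "extend v \<in> signals"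
  unfolding extend_def[abs_def] by (intro indicator_scaleR_signal rep_L2_half_in)

lemma hankel_operator_eq: "hankel_operator G v = abs_L2_half (hankel_fun (extend v))"
  and hankel_fun_L2: "hankel_fun (extend v) \<in> L2_fun lborel_nonneg"
proof -
  have eq: "(\<integral>\<tau>. G (t + \<tau>) (rep_L2_half v \<tau>) \<partial>lborel_nonneg) = hankel_fun (extend v) t" if "0 \<le> t" for t
    unfolding hankel_fun_def extend_def using that
    by (subst integral_restrict_space)
      (auto intro!: Bochner_Integration.integral_cong simp: indicator_def G'_linear G'_eq)
  have sig: "extend v \<in> signals" by (rule extend_signal)
  note [measurable] = hankel_fun_measurable[OF sig]
  define c where "c = (M * (\<integral>\<tau>. exp (- \<alpha> * \<tau>) * norm (extend v \<tau>) \<partial>lborel))\<^sup>2"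
  show L2: "hankel_fun (extend v) \<in> L2_fun lborel_nonneg"
    unfolding L2_fun_def
  proof (intro CollectI conjI)
    show "hankel_fun (extend v) \<in> borel_measurable lborel_nonneg" by (intro measurable_restrict_space1) simp
    have "integrable lborel (\<lambda>t. c * (indicator {0..} t * exp (- (2 * \<alpha>) * t)))"
      using \<alpha> by (intro integrable_mult_right integrable_exp_decay) simp
    then have "integrable lborel (\<lambda>t. indicator {0..} t *\<^sub>R (norm (hankel_fun (extend v) t))\<^sup>2)"
    proof (rule Bochner_Integration.integrable_bound)
      have "(norm (hankel_fun (extend v) t))\<^sup>2 \<le> c * exp (- (2 * \<alpha>) * t)" for t
      proof -
        have "(norm (hankel_fun (extend v) t))\<^sup>2
            \<le> (M * exp (- \<alpha> * t) * (\<integral>\<tau>. exp (- \<alpha> * \<tau>) * norm (extend v \<tau>) \<partial>lborel))\<^sup>2"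
          by (intro power_mono norm_hankel_fun_le sig) simp
        also have "\<dots> = c * exp (- (2 * \<alpha>) * t)"
          by (simp add: c_def power_mult_distrib exp_double[symmetric])
        finally show ?thesis .
      qed
      then show "AE t in lborel. norm (indicator {0..} t *\<^sub>R (norm (hankel_fun (extend v) t))\<^sup>2)
          \<le> norm (c * (indicator {0..} t * exp (- (2 * \<alpha>) * t)))"
        by (intro AE_I2) (auto simp: indicator_def c_def abs_mult)
    qed measurable
    then show "integrable lborel_nonneg (\<lambda>t. (norm (hankel_fun (extend v) t))\<^sup>2)"
      by (subst integrable_restrict_space) auto
  qed
  have "L2_eq lborel_nonneg (\<lambda>t. \<integral>\<tau>. G (t + \<tau>) (rep_L2_half v \<tau>) \<partial>lborel_nonneg) (hankel_fun (extend v))"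
    unfolding L2_eq_def
  proof (intro conjI L2)
    have sp: "space lborel_nonneg = {0..}" by (simp add: space_restrict_space)
    show "(\<lambda>t. \<integral>\<tau>. G (t + \<tau>) (rep_L2_half v \<tau>) \<partial>lborel_nonneg) \<in> L2_fun lborel_nonneg"
    proof -
      let ?h = "\<lambda>t. \<integral>\<tau>. G (t + \<tau>) (rep_L2_half v \<tau>) \<partial>lborel_nonneg"
      have "?h \<in> borel_measurable lborel_nonneg \<longleftrightarrow> hankel_fun (extend v) \<in> borel_measurable lborel_nonneg"
        by (intro measurable_cong) (simp add: sp eq)
      moreover have "integrable lborel_nonneg (\<lambda>t. (norm (?h t))\<^sup>2)
          \<longleftrightarrow> integrable lborel_nonneg (\<lambda>t. (norm (hankel_fun (extend v) t))\<^sup>2)"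
        by (intro Bochner_Integration.integrable_cong) (simp_all add: sp eq)
      ultimately show ?thesis using L2 unfolding L2_fun_def by blast
    qed
    show "AE t in lborel_nonneg. (\<integral>\<tau>. G (t + \<tau>) (rep_L2_half v \<tau>) \<partial>lborel_nonneg) = hankel_fun (extend v) t"
      using sp eq by (intro AE_I2) auto
  qed
  then show "hankel_operator G v = abs_L2_half (hankel_fun (extend v))"
    unfolding hankel_operator_def by (rule Quotient_rel_abs[OF Quotient_L2_half])
qed

text \<open>The quadratic form of the Hankel operator, on functions rather than on their equivalence classes.\<close>

definition form :: "(real \<Rightarrow> 'u) \<Rightarrow> complex"
  where "form w = (\<integral>t. \<integral>\<tau>. cinner (G' (t + \<tau>) (w \<tau>)) (w t) \<partial>lborel \<partial>lborel)"

lemma form_eq: "w \<in> signals \<Longrightarrow> form w = (\<integral>t. cinner (hankel_fun w t) (w t) \<partial>lborel)"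
  unfolding form_def hankel_fun_def
  by (intro Bochner_Integration.integral_cong refl integral_bounded_linear[OF bounded_linear_cinner_left]
      hankel_integrable)

lemma cinner_hankel_operator: "cinner (hankel_operator G v) v = form (extend v)"
proof -
  have "cinner (hankel_operator G v) v = cinner (abs_L2_half (hankel_fun (extend v))) (abs_L2_half (rep_L2_half v))"
    by (simp add: hankel_operator_eq abs_rep_L2_half)
  also have "\<dots> = L2_cinner lborel_nonneg (hankel_fun (extend v)) (rep_L2_half v)"
    by (rule cinner_L2_half.abs_eq) (simp_all add: L2_eq_refl hankel_fun_L2 rep_L2_half_in)
  also have "\<dots> = (\<integral>t. cinner (hankel_fun (extend v) t) (extend v t) \<partial>lborel)"
    unfolding L2_cinner_def extend_def
    by (subst integral_restrict_space)
      (auto intro!: Bochner_Integration.integral_cong simp: indicator_def)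
  finally show ?thesis by (simp add: form_eq extend_signal)
qed

lemma hankel_operator_linear:
  "hankel_operator G (x + y) = hankel_operator G x + hankel_operator G y"
  "hankel_operator G (c *\<^sub>C x) = c *\<^sub>C hankel_operator G x"
proof -
  have AE_ext: "AE t in lborel. extend v t = indicator {0..} t *\<^sub>R f t" if "L2_eq lborel_nonneg (rep_L2_half v) f" for v f
  proof -
    have "AE t in lborel_nonneg. rep_L2_half v t = f t" using that by (simp add: L2_eq_def)
    then have "AE t in lborel. t \<in> {0..} \<longrightarrow> rep_L2_half v t = f t" by (subst (asm) AE_restrict_space_iff) auto
    then show ?thesis by eventually_elim (auto simp: extend_def indicator_def)
  qed
  have rep_abs: "L2_eq lborel_nonneg (rep_L2_half (abs_L2_half f)) f" if "f \<in> L2_fun lborel_nonneg" for f :: "real \<Rightarrow> 'u"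
    using Quotient_rep_abs[OF Quotient_L2_half, of f] that by (simp add: L2_eq_refl)
  have m [measurable]: "extend v \<in> borel_measurable borel" for v
    using signals_measurable[OF extend_signal] by simp
  have addrep: "L2_eq lborel_nonneg (rep_L2_half (x + y)) (\<lambda>t. rep_L2_half x t + rep_L2_half y t)"
    using rep_abs[OF L2_fun_add[OF rep_L2_half_in[of x] rep_L2_half_in[of y]]]
      plus_L2_half.abs_eq[of "rep_L2_half x" "rep_L2_half y"]
    by (simp add: L2_eq_refl rep_L2_half_in abs_rep_L2_half)
  have "hankel_fun (extend (x + y)) t = hankel_fun (extend x) t + hankel_fun (extend y) t" for t
  proof -
    have "hankel_fun (extend (x + y)) t = (\<integral>\<tau>. G' (t + \<tau>) (extend x \<tau>) + G' (t + \<tau>) (extend y \<tau>) \<partial>lborel)"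
      unfolding hankel_fun_def
      by (rule integral_cong_AE, measurable, use AE_ext[OF addrep] in eventually_elim)
        (simp add: extend_def scaleR_add_right G'_linear)
    then show ?thesis unfolding hankel_fun_def by (simp add: hankel_integrable extend_signal)
  qed
  then have "hankel_fun (extend (x + y)) = (\<lambda>t. hankel_fun (extend x) t + hankel_fun (extend y) t)" by blast
  then show "hankel_operator G (x + y) = hankel_operator G x + hankel_operator G y"
    unfolding hankel_operator_eq by (simp add: plus_L2_half.abs_eq L2_eq_refl hankel_fun_L2)
  have screp: "L2_eq lborel_nonneg (rep_L2_half (c *\<^sub>C x)) (\<lambda>t. c *\<^sub>C rep_L2_half x t)"
    using rep_abs[OF L2_fun_scaleC[OF rep_L2_half_in[of x], of c]]
      scaleC_L2_half.abs_eq[of "rep_L2_half x" c]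
    by (simp add: L2_eq_refl rep_L2_half_in abs_rep_L2_half)
  have "hankel_fun (extend (c *\<^sub>C x)) t = c *\<^sub>C hankel_fun (extend x) t" for t
  proof -
    have "hankel_fun (extend (c *\<^sub>C x)) t = (\<integral>\<tau>. c *\<^sub>C G' (t + \<tau>) (extend x \<tau>) \<partial>lborel)"
      unfolding hankel_fun_def
      by (rule integral_cong_AE, measurable, use AE_ext[OF screp] in eventually_elim)
        (simp add: extend_def G'_linear scaleR_scaleC scaleC_scaleC mult.commute)
    then show ?thesis
      unfolding hankel_fun_def by (simp add: integral_bounded_linear[OF bounded_linear_scaleC] hankel_integrable extend_signal)
  qed
  then have "hankel_fun (extend (c *\<^sub>C x)) = (\<lambda>t. c *\<^sub>C hankel_fun (extend x) t)" by blast
  then show "hankel_operator G (c *\<^sub>C x) = c *\<^sub>C hankel_operator G x"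
    unfolding hankel_operator_eq by (simp add: scaleC_L2_half.abs_eq L2_eq_refl hankel_fun_L2)
qed

end

section \<open>Positivity of the Hankel operator\<close>

lemma sum_if_int_eq:
  "(\<Sum>i<m. if c = int i then F i else 0) = (if 0 \<le> c \<and> c < int m then F (nat c) else (0::'a::comm_monoid_add))"
proof (cases "0 \<le> c")
  case True
  then obtain k where k: "c = int k" using nonneg_int_cases by blast
  have "(\<Sum>i<m. if c = int i then F i else 0) = (\<Sum>i<m. if i = k then F i else 0)"
    unfolding k by (intro sum.cong) auto
  then show ?thesis unfolding k by (simp add: sum.delta)
qed (auto intro!: sum.neutral)

context decaying_response
begin

text \<open>Rounding both time arguments up to a grid of mesh \<open>1/N\<close> turns the form of the Hankel operator
  into a form of the sampled response, evaluated at the integrals of the signal over the cells of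
  the grid. Rounding up keeps the exponential majorant valid, and it keeps the sampling points positive,
  where the condition on \<open>G\<close> applies.\<close>

lemma form_nonneg:
  assumes G: "alternating_operators G" and w: "w \<in> signals"
  shows "form w \<in> \<real>\<^sub>\<ge>\<^sub>0"
proof -
  note [measurable] = signals_measurable[OF w]
  define c where "c N t = \<lfloor>real N * t\<rfloor>" for N :: nat and t :: real
  define r where "r N t = (real_of_int (c N t) + 1) / real N" for N t
  \<comment> \<open>cutting off at time \<open>N\<close> leaves \<open>N * N\<close> cells\<close>
  define W where "W N t = (if 0 \<le> c N t \<and> c N t < int (N * N) then w t else 0)" for N t
  have [measurable]: "c N \<in> measurable borel (count_space UNIV)" for N unfolding c_def by measurable
  have [measurable]: "r N \<in> borel_measurable borel" "W N \<in> borel_measurable borel" for N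
    unfolding r_def W_def by measurable
  have rle: "t \<le> r N t" if "0 < N" for N t
  proof -
    have "real N * t \<le> real_of_int (c N t) + 1" unfolding c_def by linarith
    then show ?thesis using that by (simp add: r_def field_simps)
  qed
  have rlim: "(\<lambda>N. r N t) \<longlonglongrightarrow> t" for t
  proof (rule tendsto_sandwich[OF _ _ tendsto_const])
    show "\<forall>\<^sub>F N in sequentially. t \<le> r N t" using eventually_gt_at_top[of 0] by eventually_elim (rule rle)
    show "\<forall>\<^sub>F N in sequentially. r N t \<le> t + 1 / real N"
      using eventually_gt_at_top[of 0]
    proof eventually_elim
      case (elim N)
      have "real_of_int (c N t) \<le> real N * t" unfolding c_def by linarith
      then show ?case using elim by (simp add: r_def field_simps)
    qed
    show "(\<lambda>N. t + 1 / real N) \<longlonglongrightarrow> t"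
      using tendsto_add[OF tendsto_const lim_1_over_n, of t] by simp
  qed
  have Wlim: "(\<lambda>N. W N t) \<longlonglongrightarrow> w t" for t
  proof -
    obtain n :: nat where n: "t < real n" using reals_Archimedean2 by blast
    have "\<forall>\<^sub>F N in sequentially. w t = W N t"
      using eventually_ge_at_top[of "max 1 n"]
    proof eventually_elim
      case (elim N)
      have N: "0 < real N" "t < real N" using elim n by auto
      show ?case
      proof (cases "0 \<le> t")
        case True
        have "real N * t < real N * real N" using N by (intro mult_strict_left_mono) auto
        then have "c N t < int (N * N)" unfolding c_def by (simp add: floor_less_iff)
        moreover have "0 \<le> c N t" using True by (simp add: c_def)
        ultimately show ?thesis by (simp add: W_def)
      next
        case False
        then have "w t = 0" using w by (simp add: signals_def)
        then show ?thesis by (simp add: W_def)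
      qed
    qed
    then show ?thesis by (rule Lim_transform_eventually[OF tendsto_const])
  qed
  have Wle: "norm (W N t) \<le> norm (w t)" for N t by (simp add: W_def)
  define L where "L = (\<integral>\<tau>. exp (- \<alpha> * \<tau>) * norm (w \<tau>) \<partial>lborel)"
  have bound: "norm (cinner (G' (r N t + r N \<tau>) (W N \<tau>)) (W N t))
      \<le> M * (exp (- \<alpha> * t) * norm (w t)) * (exp (- \<alpha> * \<tau>) * norm (w \<tau>))" if "0 < N" for N t \<tau>
  proof -
    have "norm (cinner (G' (r N t + r N \<tau>) (W N \<tau>)) (W N t)) \<le> norm (G' (r N t + r N \<tau>) (W N \<tau>)) * norm (W N t)"
      by (rule cinner_Cauchy_Schwarz)
    also have "\<dots> \<le> (M * exp (- \<alpha> * r N t) * (exp (- \<alpha> * r N \<tau>) * norm (W N \<tau>))) * norm (W N t)"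
      by (intro mult_right_mono norm_G'_add_le) simp
    also have "\<dots> \<le> (M * exp (- \<alpha> * t) * (exp (- \<alpha> * \<tau>) * norm (w \<tau>))) * norm (w t)"
      using M \<alpha> rle[OF that] by (intro mult_mono Wle) auto
    finally show ?thesis by (simp add: mult_ac)
  qed
  define I where "I N t = (\<integral>\<tau>. cinner (G' (r N t + r N \<tau>) (W N \<tau>)) (W N t) \<partial>lborel)" for N t
  have Ilim: "(\<lambda>N. I (Suc N) t) \<longlonglongrightarrow> (\<integral>\<tau>. cinner (G' (t + \<tau>) (w \<tau>)) (w t) \<partial>lborel)" for t
    unfolding I_def
  proof (rule integral_dominated_convergence)
    show "integrable lborel (\<lambda>\<tau>. M * (exp (- \<alpha> * t) * norm (w t)) * (exp (- \<alpha> * \<tau>) * norm (w \<tau>)))"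
      by (intro integrable_mult_right signal_exp_integrable w)
    show "AE \<tau> in lborel. (\<lambda>N. cinner (G' (r (Suc N) t + r (Suc N) \<tau>) (W (Suc N) \<tau>)) (W (Suc N) t))
        \<longlonglongrightarrow> cinner (G' (t + \<tau>) (w \<tau>)) (w t)"
      by (intro AE_I2 tendsto_cinner G'_tendsto tendsto_add LIMSEQ_Suc rlim Wlim)
    show "AE \<tau> in lborel. norm (cinner (G' (r (Suc N) t + r (Suc N) \<tau>) (W (Suc N) \<tau>)) (W (Suc N) t))
        \<le> M * (exp (- \<alpha> * t) * norm (w t)) * (exp (- \<alpha> * \<tau>) * norm (w \<tau>))" for N
      by (intro AE_I2 bound) simp
  qed measurable
  have lim: "(\<lambda>N. \<integral>t. I (Suc N) t \<partial>lborel) \<longlonglongrightarrow> form w"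
    unfolding form_def
  proof (rule integral_dominated_convergence)
    show "(\<lambda>t. \<integral>\<tau>. cinner (G' (t + \<tau>) (w \<tau>)) (w t) \<partial>lborel) \<in> borel_measurable lborel" by measurable
    show "I (Suc N) \<in> borel_measurable lborel" for N unfolding I_def by measurable
    show "integrable lborel (\<lambda>t. M * L * (exp (- \<alpha> * t) * norm (w t)))"
      by (intro integrable_mult_right signal_exp_integrable w)
    show "AE t in lborel. (\<lambda>N. I (Suc N) t) \<longlonglongrightarrow> (\<integral>\<tau>. cinner (G' (t + \<tau>) (w \<tau>)) (w t) \<partial>lborel)"
      by (intro AE_I2 Ilim)
    show "AE t in lborel. norm (I (Suc N) t) \<le> M * L * (exp (- \<alpha> * t) * norm (w t))" for N
    proof (rule AE_I2)
      fix t
      have "norm (I (Suc N) t) \<le> (\<integral>\<tau>. M * (exp (- \<alpha> * t) * norm (w t)) * (exp (- \<alpha> * \<tau>) * norm (w \<tau>)) \<partial>lborel)"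
      proof -
        have int: "integrable lborel (\<lambda>\<tau>. M * (exp (- \<alpha> * t) * norm (w t)) * (exp (- \<alpha> * \<tau>) * norm (w \<tau>)))"
          by (intro integrable_mult_right signal_exp_integrable w)
        have le: "norm (cinner (G' (r (Suc N) t + r (Suc N) \<tau>) (W (Suc N) \<tau>)) (W (Suc N) t))
            \<le> M * (exp (- \<alpha> * t) * norm (w t)) * (exp (- \<alpha> * \<tau>) * norm (w \<tau>))" for \<tau>
          by (rule bound) simp
        have "integrable lborel (\<lambda>\<tau>. cinner (G' (r (Suc N) t + r (Suc N) \<tau>) (W (Suc N) \<tau>)) (W (Suc N) t))"
        proof (rule Bochner_Integration.integrable_bound[OF int])
          show "AE \<tau> in lborel. norm (cinner (G' (r (Suc N) t + r (Suc N) \<tau>) (W (Suc N) \<tau>)) (W (Suc N) t))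
            \<le> norm (M * (exp (- \<alpha> * t) * norm (w t)) * (exp (- \<alpha> * \<tau>) * norm (w \<tau>)))"
            by (intro AE_I2 order_trans[OF le]) simp
        qed measurable
        then show ?thesis
          unfolding I_def by (intro order_trans[OF integral_norm_bound] integral_mono int le) simp
      qed
      then show "norm (I (Suc N) t) \<le> M * L * (exp (- \<alpha> * t) * norm (w t))"
        unfolding integral_mult_right_zero L_def[symmetric] by (simp only: mult_ac)
    qed
  qed
  have pos: "(\<integral>t. I N t \<partial>lborel) \<in> \<real>\<^sub>\<ge>\<^sub>0" if N: "0 < N" for N
  proof -
    define p where "p j t = (if c N t = int j then w t else 0)" for j t
    \<comment> \<open>the sum of the two rounded times in the cells \<open>i\<close> and \<open>j\<close>\<close>
    define s where "s i j = 2 / real N + real (i + j) * (1 / real N)" for i j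
    define V where "V j = (\<integral>t. p j t \<partial>lborel)" for j
    have [measurable]: "p j \<in> borel_measurable borel" for j unfolding p_def by measurable
    have pint: "integrable lborel (p j)" for j
    proof (rule Bochner_Integration.integrable_bound)
      show "integrable lborel (\<lambda>t. exp (\<alpha> * ((real j + 1) / real N)) * (exp (- \<alpha> * t) * norm (w t)))"
        by (intro integrable_mult_right signal_exp_integrable w)
      have "norm (p j t) \<le> exp (\<alpha> * ((real j + 1) / real N)) * (exp (- \<alpha> * t) * norm (w t))" for t
      proof (cases "c N t = int j")
        case True
        then have "real N * t \<le> real j + 1" unfolding c_def by linarith
        then have "t \<le> (real j + 1) / real N" using N by (simp add: field_simps)
        then have "0 \<le> \<alpha> * ((real j + 1) / real N) - \<alpha> * t"
          using mult_left_mono[of t "(real j + 1) / real N" \<alpha>] \<alpha> by simp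
        then have "1 * norm (w t) \<le> exp (\<alpha> * ((real j + 1) / real N) - \<alpha> * t) * norm (w t)"
          by (intro mult_right_mono) auto
        then show ?thesis using True by (simp add: p_def exp_diff exp_minus divide_inverse)
      qed (simp add: p_def)
      then show "AE t in lborel. norm (p j t) \<le> norm (exp (\<alpha> * ((real j + 1) / real N)) * (exp (- \<alpha> * t) * norm (w t)))"
        by (intro AE_I2) (simp add: abs_mult)
    qed measurable
    have split: "cinner (G' (r N t + r N \<tau>) (W N \<tau>)) (W N t)
        = (\<Sum>i<N*N. \<Sum>j<N*N. cinner (G' (s i j) (p j \<tau>)) (p i t))" for t \<tau>
    proof -
      have "(\<Sum>i<N*N. \<Sum>j<N*N. cinner (G' (s i j) (p j \<tau>)) (p i t))
          = (\<Sum>i<N*N. if c N t = int i then \<Sum>j<N*N. if c N \<tau> = int j then cinner (G' (s i j) (w \<tau>)) (w t) else 0 else 0)"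
        unfolding p_def by (intro sum.cong refl) (auto simp: G'_linear intro!: sum.cong)
      also have "\<dots> = cinner (G' (r N t + r N \<tau>) (W N \<tau>)) (W N t)"
        unfolding sum_if_int_eq W_def
        by (auto simp: G'_linear r_def s_def add_divide_distrib intro!: arg_cong[where f="\<lambda>x. cinner (G' x (w \<tau>)) (w t)"])
      finally show ?thesis ..
    qed
    have blL: "bounded_linear (\<lambda>x. cinner (G' z x) y)" for z y
      by (rule bounded_linear_compose[OF bounded_linear_cinner_left G'_linear(6)])
    have "I N t = (\<Sum>i<N*N. \<Sum>j<N*N. cinner (G' (s i j) (V j)) (p i t))" for t
      unfolding I_def split V_def
      by (simp add: integrable_bounded_linear[OF blL pint] integral_bounded_linear[OF blL pint])
    then have "(\<integral>t. I N t \<partial>lborel) = (\<Sum>i<N*N. \<Sum>j<N*N. cinner (G' (s i j) (V j)) (V i))"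
      by (simp add: V_def integrable_bounded_linear[OF bounded_linear_cinner_right pint]
          integral_bounded_linear[OF bounded_linear_cinner_right pint])
    also have "\<dots> = (\<Sum>i<N*N. \<Sum>j<N*N. cinner (G (s i j) (V j)) (V i))"
      by (intro sum.cong refl) (simp add: s_def G'_eq)
    also have "\<dots> \<in> \<real>\<^sub>\<ge>\<^sub>0"
      unfolding s_def using N by (intro alternating_operators_grid_positive[OF G]) auto
    finally show ?thesis .
  qed
  show ?thesis
    using Lim_in_closed_set[OF _ _ _ lim, of "\<real>\<^sub>\<ge>\<^sub>0"] pos by simp
qed

theorem hankel_nonneg_if_alternating:
  assumes "alternating_operators G"
  shows "nonneg_operator UNIV (hankel_operator G)"
  by (rule nonneg_operator_UNIV)
    (auto simp: hankel_operator_linear cinner_hankel_operator form_nonneg[OF assms] extend_signal)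

end

section \<open>Recovering the response from its Hankel operator\<close>

lemma
  fixes f :: "'a \<Rightarrow> 'b::{banach, second_countable_topology}"
  assumes w: "integrable N w" and f: "f \<in> borel_measurable N" and le: "\<And>x. norm (f x) \<le> w x"
  shows integrable_majorized: "integrable N f"
    and norm_integral_majorized: "norm (integral\<^sup>L N f) \<le> integral\<^sup>L N w"
proof -
  have "norm (f x) \<le> norm (w x)" for x using le[of x] by simp
  then show int: "integrable N f"
    by (intro Bochner_Integration.integrable_bound[OF w f] AE_I2)
  show "norm (integral\<^sup>L N f) \<le> integral\<^sup>L N w"
    by (intro order_trans[OF integral_norm_bound] integral_mono integrable_norm int w le)
qed

lemma integrable_indicator_interval: "integrable lborel (\<lambda>t. c * indicator {a..b::real} t :: real)"
  by (intro integrable_mult_right integrable_real_indicator) (simp_all add: emeasure_lborel_Icc_eq)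

context decaying_response
begin

lemma form_cong_AE:
  assumes w: "w \<in> signals" and v: "v \<in> signals" and eq: "AE t in lborel. w t = v t"
  shows "form w = form v"
proof -
  note [measurable] = signals_measurable[OF w] signals_measurable[OF v]
  have "hankel_fun w t = hankel_fun v t" for t
    unfolding hankel_fun_def by (rule integral_cong_AE) (use eq in \<open>auto elim: eventually_mono\<close>)
  moreover have "AE t in lborel. cinner (hankel_fun v t) (w t) = cinner (hankel_fun v t) (v t)"
    using eq by eventually_elim simp
  ultimately show ?thesis
    unfolding form_eq[OF w] form_eq[OF v] using hankel_fun_measurable[OF v] by (auto intro!: integral_cong_AE)
qed

lemma form_nonneg_if_hankel:
  assumes H: "nonneg_operator UNIV (hankel_operator G)" and w: "w \<in> signals"
  shows "form w \<in> \<real>\<^sub>\<ge>\<^sub>0"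
proof -
  have wL: "w \<in> L2_fun lborel_nonneg"
    using w unfolding signals_def L2_fun_def
    by (auto simp: integrable_restrict_space intro!: measurable_restrict_space1)
      (auto intro!: Bochner_Integration.integrable_bound[of lborel "\<lambda>t. (norm (w t))\<^sup>2"] simp: indicator_def)
  define v where "v = abs_L2_half w"
  have "L2_eq lborel_nonneg (rep_L2_half v) w"
    unfolding v_def using Quotient_rep_abs[OF Quotient_L2_half, of w] wL by (simp add: L2_eq_refl)
  then have "AE t in lborel_nonneg. rep_L2_half v t = w t" by (simp add: L2_eq_def)
  then have "AE t in lborel. t \<in> {0..} \<longrightarrow> rep_L2_half v t = w t" by (subst (asm) AE_restrict_space_iff) auto
  then have "AE t in lborel. extend v t = w t"
    by eventually_elim (use w in \<open>auto simp: extend_def indicator_def signals_def\<close>)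
  then have "form (extend v) = form w" by (rule form_cong_AE[OF extend_signal w])
  moreover have "cinner (hankel_operator G v) v \<in> \<real>\<^sub>\<ge>\<^sub>0" using H by (auto simp: nonneg_operator_def)
  ultimately show ?thesis by (simp add: cinner_hankel_operator)
qed

text \<open>The mean of the response at the sum of two times in intervals of length \<open>\<epsilon>\<close> whose left ends add up to \<open>x\<close>.
  Step signals of width \<open>\<epsilon>\<close> see the response through these means.\<close>

definition averaged :: "real \<Rightarrow> 'u \<Rightarrow> real \<Rightarrow> complex"
  where "averaged \<epsilon> u x = (\<integral>a. \<integral>b. indicator {0..1::real} a *\<^sub>R indicator {0..1::real} b *\<^sub>R cinner (G' (x + \<epsilon> * (a + b)) u) u \<partial>lborel \<partial>lborel)"

lemma norm_cinner_G'_le: "norm (cinner (G' t u) u) \<le> M * (norm u)\<^sup>2"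
  using order_trans[OF cinner_Cauchy_Schwarz mult_right_mono[OF norm_G'_le norm_ge_zero]]
  by (simp add: power2_eq_square mult.assoc)

lemma norm_averaged_inner_le:
  "norm (\<integral>b. indicator {0..1::real} a *\<^sub>R indicator {0..1::real} b *\<^sub>R cinner (G' (x + \<epsilon> * (a + b)) u) u \<partial>lborel)
    \<le> M * (norm u)\<^sup>2 * indicator {0..1::real} a"
proof -
  have "norm (\<integral>b. indicator {0..1::real} a *\<^sub>R indicator {0..1::real} b *\<^sub>R cinner (G' (x + \<epsilon> * (a + b)) u) u \<partial>lborel)
      \<le> (\<integral>b. (M * (norm u)\<^sup>2 * indicator {0..1::real} a) * indicator {0..1::real} b \<partial>lborel)"
    by (intro norm_integral_majorized integrable_indicator_interval)
      (use norm_cinner_G'_le in \<open>auto simp: indicator_def\<close>)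
  then show ?thesis by simp
qed

lemma norm_averaged_le: "norm (averaged \<epsilon> u x) \<le> M * (norm u)\<^sup>2"
proof -
  have "norm (averaged \<epsilon> u x) \<le> (\<integral>a. M * (norm u)\<^sup>2 * indicator {0..1::real} a \<partial>lborel)"
    unfolding averaged_def
    by (intro norm_integral_majorized integrable_indicator_interval norm_averaged_inner_le) simp
  then show ?thesis by simp
qed

lemma averaged_tendsto: "((\<lambda>n. averaged (1 / real (Suc n)) u x) \<longlonglongrightarrow> cinner (G' x u) u)"
proof -
  let ?f = "\<lambda>n a b. indicator {0..1::real} a *\<^sub>R indicator {0..1::real} b *\<^sub>R cinner (G' (x + 1 / real (Suc n) * (a + b)) u) u"
  have pt: "(\<lambda>n. ?f n a b) \<longlonglongrightarrow> indicator {0..1::real} a *\<^sub>R indicator {0..1::real} b *\<^sub>R cinner (G' x u) u" for a b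
  proof -
    have "(\<lambda>n. x + 1 / real (Suc n) * (a + b)) \<longlonglongrightarrow> x + 0 * (a + b)"
      by (intro tendsto_intros LIMSEQ_Suc[OF lim_1_over_n])
    then show ?thesis by (intro tendsto_intros tendsto_cinner G'_tendsto) simp
  qed
  have inner: "(\<lambda>n. \<integral>b. ?f n a b \<partial>lborel) \<longlonglongrightarrow> (\<integral>b. indicator {0..1::real} a *\<^sub>R indicator {0..1::real} b *\<^sub>R cinner (G' x u) u \<partial>lborel)" for a
  proof (rule integral_dominated_convergence[where s="\<lambda>n b. ?f n a b"])
    show "integrable lborel (\<lambda>b. (M * (norm u)\<^sup>2) * indicator {0..1::real} b)" by (rule integrable_indicator_interval)
    show "AE b in lborel. norm (?f n a b) \<le> (M * (norm u)\<^sup>2) * indicator {0..1::real} b" for n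
      using norm_cinner_G'_le M by (intro AE_I2) (auto simp: indicator_def)
    show "AE b in lborel. (\<lambda>n. ?f n a b) \<longlonglongrightarrow> indicator {0..1::real} a *\<^sub>R indicator {0..1::real} b *\<^sub>R cinner (G' x u) u"
      by (intro AE_I2 pt)
  qed measurable
  have "(\<lambda>n. averaged (1 / real (Suc n)) u x) \<longlonglongrightarrow>
      (\<integral>a. \<integral>b. indicator {0..1::real} a *\<^sub>R indicator {0..1::real} b *\<^sub>R cinner (G' x u) u \<partial>lborel \<partial>lborel)"
    unfolding averaged_def
  proof (rule integral_dominated_convergence)
    show "integrable lborel (\<lambda>a. (M * (norm u)\<^sup>2) * indicator {0..1::real} a)" by (rule integrable_indicator_interval)
    show "AE a in lborel. norm (\<integral>b. ?f n a b \<partial>lborel) \<le> (M * (norm u)\<^sup>2) * indicator {0..1::real} a" for n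
      by (intro AE_I2 norm_averaged_inner_le)
    show "AE a in lborel. (\<lambda>n. \<integral>b. ?f n a b \<partial>lborel) \<longlonglongrightarrow>
        (\<integral>b. indicator {0..1::real} a *\<^sub>R indicator {0..1::real} b *\<^sub>R cinner (G' x u) u \<partial>lborel)"
      by (intro AE_I2 inner)
  qed measurable
  also have "(\<integral>a. \<integral>b. indicator {0..1::real} a *\<^sub>R indicator {0..1::real} b *\<^sub>R cinner (G' x u) u \<partial>lborel \<partial>lborel) = cinner (G' x u) u"
    by simp
  finally show ?thesis .
qed

definition step_signal :: "real \<Rightarrow> 'u \<Rightarrow> (real \<times> real) list \<Rightarrow> real \<Rightarrow> 'u"
  where "step_signal \<epsilon> u xs t = (\<Sum>(c, s)\<leftarrow>xs. c * indicator {s..s + \<epsilon>} t) *\<^sub>R u"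

lemma step_signal_in:
  assumes "\<forall>(c, s)\<in>set xs. 0 \<le> s" shows "step_signal \<epsilon> u xs \<in> signals"
  using assms
proof (induction xs)
  case Nil
  then show ?case by (simp add: step_signal_def[abs_def] signals_def L2_fun_zero)
next
  case (Cons p xs)
  obtain c s where p: "p = (c, s)" by (cases p)
  have "(\<lambda>t. indicator {s..s + \<epsilon>} t *\<^sub>R (c *\<^sub>R u)) \<in> L2_fun lborel"
    by (rule L2_fun_indicator) (auto simp: emeasure_lborel_Icc_eq)
  moreover have "step_signal \<epsilon> u xs \<in> signals" using Cons by auto
  ultimately have "(\<lambda>t. indicator {s..s + \<epsilon>} t *\<^sub>R (c *\<^sub>R u) + step_signal \<epsilon> u xs t) \<in> L2_fun lborel"
    by (intro L2_fun_add) (auto simp: signals_def)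
  also have "(\<lambda>t. indicator {s..s + \<epsilon>} t *\<^sub>R (c *\<^sub>R u) + step_signal \<epsilon> u xs t) = step_signal \<epsilon> u (p # xs)"
    by (auto simp: step_signal_def p scaleR_add_left mult.commute)
  finally show ?case using \<open>step_signal \<epsilon> u xs \<in> signals\<close> Cons.prems
    by (auto simp: signals_def step_signal_def p)
qed

lemma integral_interval_scaled:
  fixes f :: "real \<Rightarrow> complex"
  assumes "0 < \<epsilon>"
  shows "(\<integral>t. indicator {s..s + \<epsilon>} t *\<^sub>R f t \<partial>lborel) = \<epsilon> *\<^sub>R (\<integral>a. indicator {0..1::real} a *\<^sub>R f (s + \<epsilon> * a) \<partial>lborel)"
proof -
  have "indicator {s..s + \<epsilon>} (s + \<epsilon> * a) = (indicator {0..1::real} a :: real)" for a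
    using assms by (auto simp: indicator_def mult_le_cancel_left1 zero_le_mult_iff)
  then show ?thesis
    using lborel_integral_real_affine[of \<epsilon> "\<lambda>t. indicator {s..s + \<epsilon>} t *\<^sub>R f t" s] assms by simp
qed

text \<open>Two steps contribute a double integral over a square of side \<open>\<epsilon>\<close>; scaling the square to the unit square
  produces the factor \<open>\<epsilon>\<^sup>2\<close>.\<close>

lemma form_step_signal:
  assumes \<epsilon>: "0 < \<epsilon>" and xs: "\<forall>(c, s)\<in>set xs. 0 \<le> s"
  shows "form (step_signal \<epsilon> u xs) = \<epsilon>\<^sup>2 *\<^sub>R (\<Sum>i<length xs. \<Sum>j<length xs.
    (fst (xs ! i) * fst (xs ! j)) *\<^sub>R averaged \<epsilon> u (snd (xs ! i) + snd (xs ! j)))"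
proof -
  let ?n = "length xs" and ?I = "\<lambda>i t. indicator {snd (xs ! i)..snd (xs ! i) + \<epsilon>} t :: real"
  define g where "g t = cinner (G' t u) u" for t
  have [measurable]: "g \<in> borel_measurable borel" unfolding g_def by measurable
  have gle: "norm (g t) \<le> M * (norm u)\<^sup>2" for t unfolding g_def by (rule norm_cinner_G'_le)
  have st: "step_signal \<epsilon> u xs t = (\<Sum>i<?n. fst (xs ! i) * ?I i t) *\<^sub>R u" for t
    by (simp add: step_signal_def sum_list_sum_nth case_prod_unfold atLeast0LessThan)
  have split: "cinner (G' (t + \<tau>) (step_signal \<epsilon> u xs \<tau>)) (step_signal \<epsilon> u xs t)
      = (\<Sum>i<?n. \<Sum>j<?n. (fst (xs ! i) * fst (xs ! j)) *\<^sub>R ?I i t *\<^sub>R ?I j \<tau> *\<^sub>R g (t + \<tau>))" for t \<tau>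
  proof -
    have expand: "of_real (\<Sum>j<n. a j * f j) * (of_real (\<Sum>i<n. a i * h i) * z)
        = (\<Sum>i<n. \<Sum>j<n. (a i * a j) *\<^sub>R h i *\<^sub>R f j *\<^sub>R z)"
      for n :: nat and a f h :: "nat \<Rightarrow> real" and z :: complex
      by (simp add: scaleR_conv_of_real sum_distrib_left sum_distrib_right mult_ac)
    show ?thesis
      unfolding st G'_linear cinner_scaleR_left cinner_scaleR_right g_def[symmetric]
      by (simp only: expand mult.left_commute)
  qed
  have le0: "norm (?I i t *\<^sub>R ?I j \<tau> *\<^sub>R g (t + \<tau>)) \<le> (M * (norm u)\<^sup>2 * ?I i t) * ?I j \<tau>" for i j t \<tau>
    using gle by (auto simp: indicator_def)
  have int1: "integrable lborel (\<lambda>\<tau>. ?I i t *\<^sub>R ?I j \<tau> *\<^sub>R g (t + \<tau>))" for i j t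
    by (rule integrable_majorized[OF integrable_indicator_interval _ le0]) simp
  have le1: "norm (\<integral>\<tau>. ?I i t *\<^sub>R ?I j \<tau> *\<^sub>R g (t + \<tau>) \<partial>lborel) \<le> (M * (norm u)\<^sup>2 * \<epsilon>) * ?I i t" for i j t
    using norm_integral_majorized[OF integrable_indicator_interval _ le0, of i t j] \<epsilon> by (simp add: mult_ac)
  have int2: "integrable lborel (\<lambda>t. \<integral>\<tau>. ?I i t *\<^sub>R ?I j \<tau> *\<^sub>R g (t + \<tau>) \<partial>lborel)" for i j
    by (rule integrable_majorized[OF integrable_indicator_interval _ le1]) simp
  have expand: "form (step_signal \<epsilon> u xs) = (\<Sum>i<?n. \<Sum>j<?n. (fst (xs ! i) * fst (xs ! j)) *\<^sub>R
      (\<integral>t. \<integral>\<tau>. ?I i t *\<^sub>R ?I j \<tau> *\<^sub>R g (t + \<tau>) \<partial>lborel \<partial>lborel))"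
    unfolding form_def split using int2[unfolded integral_scaleR_right]
    by (simp add: int1 del: scaleR_scaleR)
  have cell: "(\<integral>t. \<integral>\<tau>. ?I i t *\<^sub>R ?I j \<tau> *\<^sub>R g (t + \<tau>) \<partial>lborel \<partial>lborel)
      = \<epsilon>\<^sup>2 *\<^sub>R averaged \<epsilon> u (snd (xs ! i) + snd (xs ! j))" for i j
  proof -
    have "(\<integral>t. \<integral>\<tau>. ?I i t *\<^sub>R ?I j \<tau> *\<^sub>R g (t + \<tau>) \<partial>lborel \<partial>lborel)
        = (\<integral>t. ?I i t *\<^sub>R (\<integral>\<tau>. ?I j \<tau> *\<^sub>R g (t + \<tau>) \<partial>lborel) \<partial>lborel)"
      by (simp only: integral_scaleR_right)
    also have "\<dots> = \<epsilon> *\<^sub>R (\<integral>a. indicator {0..1::real} a *\<^sub>R (\<epsilon> *\<^sub>R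
        (\<integral>b. indicator {0..1::real} b *\<^sub>R g (snd (xs ! i) + \<epsilon> * a + (snd (xs ! j) + \<epsilon> * b)) \<partial>lborel)) \<partial>lborel)"
      unfolding integral_interval_scaled[OF \<epsilon>] ..
    also have "\<dots> = \<epsilon> *\<^sub>R (\<epsilon> *\<^sub>R averaged \<epsilon> u (snd (xs ! i) + snd (xs ! j)))"
    proof -
      have pull: "(\<integral>a. J a *\<^sub>R (\<epsilon> *\<^sub>R X a) \<partial>lborel) = \<epsilon> *\<^sub>R (\<integral>a. J a *\<^sub>R X a \<partial>lborel)"
        for J and X :: "real \<Rightarrow> complex"
        by (subst scaleR_left_commute) (rule integral_scaleR_right)
      have arg: "g (p + \<epsilon> * a + (q + \<epsilon> * b)) = cinner (G' (p + q + \<epsilon> * (a + b)) u) u" for p q a b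
        by (simp add: g_def algebra_simps)
      show ?thesis by (simp only: pull arg averaged_def integral_scaleR_right)
    qed
    finally show ?thesis by (simp add: power2_eq_square)
  qed
  show ?thesis unfolding expand cell by (simp add: scaleR_sum_right mult_ac)
qed

text \<open>The means are bounded and positive definite, hence alternating; by continuity they converge to the form
  of the response when \<open>\<epsilon>\<close> tends to \<open>0\<close>.\<close>

theorem alternating_if_hankel_nonneg:
  assumes H: "nonneg_operator UNIV (hankel_operator G)"
  shows "alternating_operators G"
proof -
  have sums: "(\<Sum>i<length xs. \<Sum>j<length xs. (fst (xs ! i) * fst (xs ! j)) *\<^sub>R averaged \<epsilon> u (snd (xs ! i) + snd (xs ! j))) \<in> \<real>\<^sub>\<ge>\<^sub>0"
    if "0 < \<epsilon>" "\<forall>(c, s)\<in>set xs. 0 \<le> s" for \<epsilon> u xs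
  proof -
    have "\<epsilon>\<^sup>2 *\<^sub>R (\<Sum>i<length xs. \<Sum>j<length xs. (fst (xs ! i) * fst (xs ! j)) *\<^sub>R averaged \<epsilon> u (snd (xs ! i) + snd (xs ! j))) \<in> \<real>\<^sub>\<ge>\<^sub>0"
      unfolding form_step_signal[OF that, symmetric] by (intro form_nonneg_if_hankel H step_signal_in that)
    then show ?thesis using that(1) by (simp add: complex_nonneg_Reals_iff zero_le_mult_iff)
  qed
  have real: "Im (averaged \<epsilon> u x) = 0" if "0 < \<epsilon>" "0 \<le> x" for \<epsilon> u x
    using sums[OF that(1), of "[(1, x / 2)]" u] that(2) by (simp add: complex_nonneg_Reals_iff)
  have alt: "alternating (\<lambda>x. Re (averaged \<epsilon> u x))" if "0 < \<epsilon>" for \<epsilon> u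
  proof (rule alternating_if_positive_definite[where B="M * (norm u)\<^sup>2"])
    show "positive_definite (\<lambda>x. Re (averaged \<epsilon> u x))"
      unfolding positive_definite_def
    proof (intro allI impI)
      fix xs :: "(real \<times> real) list" assume "\<forall>(c, s)\<in>set xs. 0 \<le> s"
      from sums[OF that this, of u] show "0 \<le> hankel_form (\<lambda>x. Re (averaged \<epsilon> u x)) xs xs"
        by (simp add: complex_nonneg_Reals_iff hankel_form_def sum_list_sum_nth case_prod_unfold atLeast0LessThan)
    qed
    show "\<bar>Re (averaged \<epsilon> u x)\<bar> \<le> M * (norm u)\<^sup>2" for x
      using order_trans[OF abs_Re_le_cmod norm_averaged_le] .
  qed
  show ?thesis
    unfolding alternating_operators_def
  proof (intro conjI allI impI)
    show "bounded_clinear (G t)" if "0 < t" for t using bl that by simp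
    show "Im (cinner (G t u) u) = 0" if "0 < t" for u t
    proof -
      have "(\<lambda>n. Im (averaged (1 / real (Suc n)) u t)) \<longlonglongrightarrow> Im (cinner (G' t u) u)"
        by (intro tendsto_Im averaged_tendsto)
      then have "(\<lambda>n::nat. 0) \<longlonglongrightarrow> Im (cinner (G' t u) u)" using real that by simp
      then show ?thesis using that by (simp add: G'_eq LIMSEQ_const_iff)
    qed
    show "alternating (\<lambda>t. Re (cinner (G t u) u))" for u
    proof (rule alternating_limit[where F=sequentially])
      show "\<forall>\<^sub>F n in sequentially. alternating (\<lambda>x. Re (averaged (1 / real (Suc n)) u x))"
        by (intro always_eventually allI alt) simp
      show "(\<lambda>n. Re (averaged (1 / real (Suc n)) u t)) \<longlonglongrightarrow> Re (cinner (G t u) u)" if "0 < t" for t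
        using tendsto_Re[OF averaged_tendsto[of u t]] that by (simp add: G'_eq)
    qed simp
  qed
qed

end

section \<open>Smooth vectors of a stable semigroup\<close>

text \<open>Continuity of an orbit at \<open>0\<close> spreads over the half-line: two points of an orbit are the images under a
  uniformly bounded operator of the initial point and of a point near it.\<close>

lemma C0_semigroup_decaying:
  fixes S :: "real \<Rightarrow> 'z::{complex_hilbert_space, second_countable_topology} \<Rightarrow> 'z"
  assumes S: "C0_semigroup S" and stable: "exponentially_stable S"
  shows "\<exists>M \<alpha>. decaying_response S M \<alpha>"
proof -
  obtain M \<alpha> where M: "0 < M" "0 < \<alpha>" and le: "\<And>t. 0 \<le> t \<Longrightarrow> onorm (S t) \<le> M * exp (- \<alpha> * t)"
    using stable unfolding exponentially_stable_def by blast
  have bl: "bounded_clinear (S t)" if "0 \<le> t" for t using S that by (simp add: C0_semigroup_def)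
  have sg: "S (s + t) = S s \<circ> S t" if "0 \<le> s" "0 \<le> t" for s t
    using S that unfolding C0_semigroup_def by blast
  have decay: "norm (S t x) \<le> M * exp (- \<alpha> * t) * norm x" if "0 \<le> t" for t x
    using order_trans[OF onorm[OF bounded_clinearD(1)[OF bl[OF that]]] mult_right_mono[OF le[OF that] norm_ge_zero]] .
  have bd: "norm (S t x) \<le> M * norm x" if "0 \<le> t" for t x
  proof -
    have "M * exp (- \<alpha> * t) * norm x \<le> M * 1 * norm x"
      using M that by (intro mult_right_mono mult_left_mono) auto
    then show ?thesis using decay[OF that, of x] by simp
  qed
  have diff: "norm (S t x - S s x) \<le> M * norm (S \<bar>t - s\<bar> x - x)" if "0 \<le> s" "0 \<le> t" for s t x
  proof -
    have *: "norm (S t x - S s x) \<le> M * norm (S (t - s) x - x)" if "0 \<le> s" "s \<le> t" for s t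
    proof -
      have "S t = S s \<circ> S (t - s)" using sg[of s "t - s"] that by simp
      then have "S t x - S s x = S s (S (t - s) x - x)"
        using bounded_clinearD(4)[OF bl[OF that(1)]] by simp
      then show ?thesis using bd[OF that(1)] by simp
    qed
    show ?thesis
      using *[of s t] *[of t s] that by (cases "s \<le> t") (auto simp: norm_minus_commute abs_if)
  qed
  have cont: "continuous_on {0..} (\<lambda>t. S t x)" for x
    unfolding continuous_on_def
  proof
    fix s :: real assume s: "s \<in> {0..}"
    have orbit: "((\<lambda>h. S h x) \<longlongrightarrow> x) (at_right 0)" using S by (simp add: C0_semigroup_def)
    have "((\<lambda>t. norm (S t x - S s x)) \<longlongrightarrow> 0) (at s within {0..})"
    proof (rule tendsto_sandwich[OF _ _ tendsto_const])
      show "\<forall>\<^sub>F t in at s within {0..}. norm (S t x - S s x) \<le> M * norm (S \<bar>t - s\<bar> x - x)"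
        using s by (auto simp: eventually_at_filter intro!: always_eventually diff)
      have "filterlim (\<lambda>t. \<bar>t - s\<bar>) (at_right 0) (at s within {0..})"
        unfolding filterlim_at
      proof
        show "\<forall>\<^sub>F t in at s within {0..}. \<bar>t - s\<bar> \<in> {0<..} \<and> \<bar>t - s\<bar> \<noteq> 0"
          by (auto simp: eventually_at_filter intro!: always_eventually)
        have "((\<lambda>t. \<bar>t - s\<bar>) \<longlongrightarrow> \<bar>s - s\<bar>) (at s within {0..})" by (intro tendsto_intros)
        then show "((\<lambda>t. \<bar>t - s\<bar>) \<longlongrightarrow> 0) (at s within {0..})" by simp
      qed
      moreover have "((\<lambda>h. M * norm (S h x - x)) \<longlongrightarrow> M * norm (x - x)) (at_right 0)"
        by (intro tendsto_intros orbit)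
      ultimately show "((\<lambda>t. M * norm (S \<bar>t - s\<bar> x - x)) \<longlongrightarrow> 0) (at s within {0..})"
        by (auto intro: filterlim_compose)
    qed (simp add: always_eventually)
    then show "((\<lambda>t. S t x) \<longlongrightarrow> S s x) (at s within {0..})"
      using tendsto_norm_zero_iff LIM_zero_iff by blast
  qed
  have "decaying_response S M \<alpha>" by unfold_locales (use bl decay M cont in auto)
  then show ?thesis by blast
qed

text \<open>On the left of \<open>t\<close> the difference quotient is \<open>G (t - h)\<close> applied to the quotient at \<open>0\<close>; operator and vector
  vary together, which is harmless since the operators are uniformly bounded.\<close>

lemma (in decaying_response) generator_derivative:
  assumes gen: "generates D A G" and x: "x \<in> D" and t: "0 < t"
  shows "((\<lambda>s. G s x) has_vector_derivative G t (A x)) (at t)"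
  unfolding has_vector_derivative_iff_quotient filterlim_at_split
proof
  have sg: "\<And>s t. 0 \<le> s \<Longrightarrow> 0 \<le> t \<Longrightarrow> G (s + t) = G s \<circ> G t"
    using gen by (simp add: generates_def C0_semigroup_def)
  have quot: "((\<lambda>h. (G h x - x) /\<^sub>R h) \<longlongrightarrow> A x) (at_right 0)"
    using gen x unfolding generates_def by blast
  have lin: "G s ((G h x - x) /\<^sub>R h) = (G (s + h) x - G s x) /\<^sub>R h" if "0 \<le> s" "0 \<le> h" for s h
    using sg[OF that] bounded_clinearD(4,5)[OF bl[OF that(1)]] by simp
  have "((\<lambda>h. G' t ((G h x - x) /\<^sub>R h)) \<longlongrightarrow> G' t (A x)) (at_right 0)"
    by (intro G'_tendsto tendsto_const quot)
  moreover have "\<forall>\<^sub>F h in at_right 0. G' t ((G h x - x) /\<^sub>R h) = (G (t + h) x - G t x) /\<^sub>R h"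
    using eventually_at_right_less[of 0] by eventually_elim (use t lin[of t] in \<open>simp add: G'_eq\<close>)
  ultimately show "((\<lambda>h. (G (t + h) x - G t x) /\<^sub>R h) \<longlongrightarrow> G t (A x)) (at_right 0)"
    using t by (simp add: G'_eq Lim_transform_eventually)
  have "((\<lambda>h. t - h) \<longlongrightarrow> t - 0) (at_right 0)" by (intro tendsto_intros)
  then have "((\<lambda>h. G' (t - h) ((G h x - x) /\<^sub>R h)) \<longlongrightarrow> G' t (A x)) (at_right 0)"
    by (intro G'_tendsto quot) simp
  moreover have "\<forall>\<^sub>F h in at_right 0. G' (t - h) ((G h x - x) /\<^sub>R h) = (G (t + - h) x - G t x) /\<^sub>R - h"
  proof -
    have "\<forall>\<^sub>F h in at_right 0. h < t" by (rule eventually_at_rightI[of 0 t]) (use t in auto)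
    with eventually_at_right_less[of 0] show ?thesis
    proof eventually_elim
      case (elim h)
      have "G' (t - h) ((G h x - x) /\<^sub>R h) = (G (t - h + h) x - G (t - h) x) /\<^sub>R h"
        using lin[of "t - h" h] elim by (simp add: G'_eq)
      also have "\<dots> = (G (t + - h) x - G t x) /\<^sub>R - h" by (simp add: scaleR_diff_right)
      finally show ?case .
    qed
  qed
  ultimately have "((\<lambda>h. (G (t + - h) x - G t x) /\<^sub>R - h) \<longlongrightarrow> G t (A x)) (at_right 0)"
    using t by (simp add: G'_eq Lim_transform_eventually)
  then show "((\<lambda>h. (G (t + h) x - G t x) /\<^sub>R h) \<longlongrightarrow> G t (A x)) (at_left 0)"
    using filterlim_at_left_to_right[of "\<lambda>h. (G (t + h) x - G t x) /\<^sub>R h" _ 0] by simp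
qed

lemma impulse_response_decaying:
  fixes S :: "real \<Rightarrow> 'z::{complex_hilbert_space, second_countable_topology} \<Rightarrow> 'z"
    and B :: "'u::{complex_hilbert_space, second_countable_topology} \<Rightarrow> 'z"
  assumes S: "decaying_response S M \<alpha>" and B: "bounded_clinear B" and C: "bounded_clinear C"
  shows "\<exists>K. decaying_response (impulse_response S B C) K \<alpha>"
proof -
  interpret decaying_response S M \<alpha> by fact
  obtain b where b: "0 < b" "\<And>x. norm (B x) \<le> norm x * b"
    using bounded_linear.pos_bounded[OF bounded_clinearD(1)[OF B]] by blast
  obtain c where c: "0 < c" "\<And>x. norm (C x) \<le> norm x * c"
    using bounded_linear.pos_bounded[OF bounded_clinearD(1)[OF C]] by blast
  have "decaying_response (impulse_response S B C) (c * M * b) \<alpha>"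
  proof
    show "bounded_clinear (impulse_response S B C t)" if "0 \<le> t" for t
      unfolding bounded_clinear_def impulse_response_def o_def
      using bounded_clinearD[OF bl[OF that]] bounded_clinearD[OF B] bounded_clinearD[OF C]
      by (auto intro!: bounded_linear_compose[of C] bounded_linear_compose[of "S t" B])
    show "norm (impulse_response S B C t x) \<le> c * M * b * exp (- \<alpha> * t) * norm x" if "0 \<le> t" for t x
    proof -
      have "norm (C (S t (B x))) \<le> norm (S t (B x)) * c" by (rule c)
      also have "\<dots> \<le> (M * exp (- \<alpha> * t) * (norm x * b)) * c"
        using M by (intro mult_right_mono order_trans[OF decay[OF that]] mult_left_mono b) (use c in auto)
      finally show ?thesis by (simp add: impulse_response_def mult_ac)
    qed
    show "0 < c * M * b" "0 < \<alpha>" using b c M \<alpha> by auto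
    show "continuous_on {0..} (\<lambda>t. impulse_response S B C t x)" for x
      unfolding impulse_response_def o_def
      by (intro bounded_linear.continuous_on[OF bounded_clinearD(1)[OF C]] cont)
  qed
  then show ?thesis by blast
qed

section \<open>From derivatives to differences\<close>

text \<open>Induction over the steps, for the whole sequence of derivatives at once: if every member is replaced by its
  difference, the sequence still consists of derivatives, and monotonicity preserves their signs.\<close>

lemma alternating_if_derivatives:
  fixes f :: "nat \<Rightarrow> real \<Rightarrow> real"
  assumes der: "\<And>k t. 0 < t \<Longrightarrow> (f k has_real_derivative f (Suc k) t) (at t)"
    and sign: "\<And>k t. 0 < t \<Longrightarrow> 0 \<le> (-1)^k * f k t"
  shows "alternating (f 0)"
proof -
  have "0 \<le> foldr bdiff hs (f 0) t" if "\<forall>h\<in>set hs. 0 < h" "0 < t" for hs t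
    using that der sign
  proof (induction hs arbitrary: f rule: rev_induct)
    case Nil
    then show ?case using Nil.prems(4)[of t 0] by simp
  next
    case (snoc h hs)
    have h: "0 < h" using snoc.prems by simp
    have "0 \<le> foldr bdiff hs (bdiff h (f 0)) t"
    proof (rule snoc.IH[where f="\<lambda>k. bdiff h (f k)"])
      show "(bdiff h (f k) has_real_derivative bdiff h (f (Suc k)) s) (at s)" if "0 < s" for k s
        unfolding bdiff_def using snoc.prems(3) h that by (auto intro!: DERIV_diff simp: DERIV_shift[symmetric])
      show "0 \<le> (-1)^k * bdiff h (f k) s" if s: "0 < s" for k s
      proof -
        have "(-1)^k * f k (s + h) \<le> (-1)^k * f k s"
        proof (rule DERIV_nonpos_imp_nonincreasing[where f="\<lambda>x. (-1)^k * f k x"])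
          fix x assume "s \<le> x" "x \<le> s + h"
          then have x: "0 < x" using s by simp
          have "((\<lambda>x. (-1)^k * f k x) has_real_derivative (-1)^k * f (Suc k) x) (at x)"
            by (intro DERIV_cmult snoc.prems(3) x)
          moreover have "(-1)^k * f (Suc k) x \<le> 0" using snoc.prems(4)[OF x, of "Suc k"] by simp
          ultimately show "\<exists>y. ((\<lambda>x. (-1)^k * f k x) has_real_derivative y) (at x) \<and> y \<le> 0" by blast
        qed (use h in simp)
        then show ?thesis by (simp add: bdiff_def right_diff_distrib)
      qed
    qed (use snoc.prems in auto)
    then show ?case by simp
  qed
  then show ?thesis by (simp add: alternating_def)
qed

lemma alternating_cong:
  assumes f: "alternating f" and eq: "\<And>t. 0 < t \<Longrightarrow> f t = g t" shows "alternating g"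
proof (rule alternating_limit[of sequentially "\<lambda>_. f"])
  show "(\<lambda>_. f t) \<longlonglongrightarrow> g t" if "0 < t" for t using eq[OF that] by simp
qed (simp_all add: f)

text \<open>Complete monotonicity gives information on a vector as far as its orbit can be differentiated; a smooth orbit
  yields the signs of all derivatives of the quadratic form.\<close>

lemma completely_monotone_smooth_vector:
  fixes G :: "real \<Rightarrow> 'u::complex_hilbert_space \<Rightarrow> 'u"
  assumes cm: "completely_monotone G"
    and d0: "\<And>t. 0 < t \<Longrightarrow> d 0 t = G t u"
    and der: "\<And>k t. 0 < t \<Longrightarrow> (d k has_vector_derivative d (Suc k) t) (at t)"
  shows "alternating (\<lambda>t. Re (cinner (G t u) u))" "0 < t \<Longrightarrow> Im (cinner (G t u) u) = 0"
proof -
  have nth: "has_nth_derivative k (\<lambda>s. G s u) (d k t) t" if "0 < t" for k t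
    using that
  proof (induction k arbitrary: t)
    case (Suc k)
    have "\<forall>\<^sub>F s in nhds t. s \<in> {0<..}" using Suc.prems by (intro eventually_nhds_in_open) auto
    then have "\<forall>\<^sub>F s in nhds t. has_nth_derivative k (\<lambda>s. G s u) (d k s) s"
      by eventually_elim (simp add: Suc.IH)
    then show ?case using der[OF Suc.prems, of k] by auto
  qed (simp add: d0)
  have nn: "cinner ((-1)^k *\<^sub>R d k t) u \<in> \<real>\<^sub>\<ge>\<^sub>0" if "0 < t" for k t
    using cm that strong_deriv_eqI[of k G, OF nth[OF that]]
    unfolding completely_monotone_def nonneg_operator_def by metis
  have "alternating (\<lambda>t. Re (cinner (d 0 t) u))"
  proof (rule alternating_if_derivatives[where f="\<lambda>k t. Re (cinner (d k t) u)"])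
    show "((\<lambda>t. Re (cinner (d k t) u)) has_real_derivative Re (cinner (d (Suc k) t) u)) (at t)" if "0 < t" for k t
      unfolding has_real_derivative_iff_has_vector_derivative
      by (intro bounded_linear.has_vector_derivative[OF bounded_linear_Re]
          bounded_linear.has_vector_derivative[OF bounded_linear_cinner_left] der that)
    show "0 \<le> (-1)^k * Re (cinner (d k t) u)" if "0 < t" for k t
      using nn[OF that, of k] by (simp add: complex_nonneg_Reals_iff cinner_scaleR_left)
  qed
  then show "alternating (\<lambda>t. Re (cinner (G t u) u))"
    by (rule alternating_cong) (simp add: d0)
  show "Im (cinner (G t u) u) = 0" if "0 < t"
    using nn[OF that, of 0] d0[OF that] by (simp add: complex_nonneg_Reals_iff)
qed

section \<open>Continuity of translation in the mean\<close>

lemma borel_measurable_shift [measurable (raw)]: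
  fixes f :: "'a::euclidean_space \<Rightarrow> 'b::{banach, second_countable_topology}"
  assumes "f \<in> borel_measurable borel" "g \<in> borel_measurable M" "h \<in> borel_measurable M"
  shows "(\<lambda>x. f (g x + h x)) \<in> borel_measurable M"
  using measurable_compose[OF borel_measurable_add[OF assms(2,3)] assms(1)] .

lemma
  fixes f :: "'a::euclidean_space \<Rightarrow> 'b::{banach, second_countable_topology}"
  assumes f: "integrable lborel f"
  shows integrable_shift: "integrable lborel (\<lambda>x. f (x + h))"
    and integral_shift: "(\<integral>x. f (x + h) \<partial>lborel) = integral\<^sup>L lborel f"
proof -
  have [measurable]: "f \<in> borel_measurable borel" using f by simp
  have "integrable (distr lborel borel ((+) h)) f" unfolding lborel_distr_plus by (rule f)
  then show "integrable lborel (\<lambda>x. f (x + h))"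
    by (subst (asm) integrable_distr_eq) (auto simp: add.commute)
  have "integral\<^sup>L (distr lborel borel ((+) h)) f = (\<integral>x. f (h + x) \<partial>lborel)"
    by (subst integral_distr) auto
  then show "(\<integral>x. f (x + h) \<partial>lborel) = integral\<^sup>L lborel f"
    by (simp add: lborel_distr_plus add.commute)
qed

text \<open>The modulus of continuity in the mean.\<close>

definition shift_modulus :: "('a::euclidean_space \<Rightarrow> 'b::{banach, second_countable_topology}) \<Rightarrow> 'a \<Rightarrow> real"
  where "shift_modulus f h = (\<integral>x. norm (f (x + h) - f x) \<partial>lborel)"

lemma shift_modulus_le:
  assumes f: "integrable lborel f" and g: "integrable lborel g"
  shows "shift_modulus f h \<le> 2 * (\<integral>x. norm (f x - g x) \<partial>lborel) + shift_modulus g h"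
proof -
  have int: "integrable lborel (\<lambda>x. norm (f x - g x))" "integrable lborel (\<lambda>x. norm (g (x + h) - g x))"
    "integrable lborel (\<lambda>x. norm (f (x + h) - f x))"
    using f g integrable_shift[OF f] integrable_shift[OF g] by auto
  note int' = integrable_shift[OF int(1)]
  have "shift_modulus f h \<le> (\<integral>x. norm (f (x + h) - g (x + h)) + norm (f x - g x) + norm (g (x + h) - g x) \<partial>lborel)"
    unfolding shift_modulus_def
  proof (rule integral_mono)
    show "norm (f (x + h) - f x) \<le> norm (f (x + h) - g (x + h)) + norm (f x - g x) + norm (g (x + h) - g x)" for x
    proof -
      have "f (x + h) - f x = (f (x + h) - g (x + h)) - (f x - g x) + (g (x + h) - g x)" by simp
      then show ?thesis
        using norm_triangle_ineq[of "(f (x + h) - g (x + h)) - (f x - g x)" "g (x + h) - g x"]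
          norm_triangle_ineq4[of "f (x + h) - g (x + h)" "f x - g x"] by simp
    qed
  qed (use int int' in auto)
  also have "\<dots> = 2 * (\<integral>x. norm (f x - g x) \<partial>lborel) + shift_modulus g h"
    using int int' integral_shift[OF int(1), of h] by (simp add: shift_modulus_def)
  finally show ?thesis .
qed

lemma shift_modulus_nonneg: "0 \<le> shift_modulus f h"
  by (simp add: shift_modulus_def)

lemma shift_modulus_approx:
  assumes f: "integrable lborel f"
    and approx: "\<And>e. 0 < e \<Longrightarrow> \<exists>g. integrable lborel g \<and> (\<integral>x. norm (f x - g x) \<partial>lborel) \<le> e \<and> (\<lambda>n. shift_modulus g (h n)) \<longlonglongrightarrow> 0"
  shows "(\<lambda>n. shift_modulus f (h n)) \<longlonglongrightarrow> 0"
proof (rule LIMSEQ_I)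
  fix e :: real assume e: "0 < e"
  obtain g where g: "integrable lborel g" "(\<integral>x. norm (f x - g x) \<partial>lborel) \<le> e / 4" "(\<lambda>n. shift_modulus g (h n)) \<longlonglongrightarrow> 0"
    using approx[of "e / 4"] e by auto
  obtain N where N: "\<And>n. n \<ge> N \<Longrightarrow> norm (shift_modulus g (h n) - 0) < e / 2"
    using LIMSEQ_D[OF g(3), of "e / 2"] e by auto
  have "norm (shift_modulus f (h n) - 0) < e" if "n \<ge> N" for n
    using shift_modulus_le[OF f g(1), of "h n"] g(2) N[OF that] shift_modulus_nonneg[of f "h n"] by simp
  then show "\<exists>N. \<forall>n\<ge>N. norm (shift_modulus f (h n) - 0) < e" by blast
qed

text \<open>For an open set \<open>T\<close> the points of \<open>T\<close> that a small translation moves out of \<open>T\<close> disappear in the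
  limit, and translation preserves the measure, so the two halves of the symmetric difference are equal.\<close>

lemma shift_modulus_open:
  fixes T :: "'a::euclidean_space set" and c :: "'b::{banach, second_countable_topology}"
  assumes T: "open T" "emeasure lborel T < \<infinity>" and h: "h \<longlonglongrightarrow> 0"
  shows "(\<lambda>n. shift_modulus (\<lambda>x. indicator T x *\<^sub>R c) (h n)) \<longlonglongrightarrow> 0"
proof -
  have [measurable]: "T \<in> sets borel" using T by simp
  have int: "integrable lborel (\<lambda>x. indicator T x :: real)" using T by simp
  have intp: "integrable lborel (\<lambda>x. indicator T x * (1 - indicator T (x + d)) :: real)" for d
    by (rule Bochner_Integration.integrable_bound[OF int]) (auto simp: indicator_def)
  have eq: "shift_modulus (\<lambda>x. indicator T x *\<^sub>R c) d = 2 * norm c * (\<integral>x. indicator T x * (1 - indicator T (x + d)) \<partial>lborel)" for d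
  proof -
    have "shift_modulus (\<lambda>x. indicator T x *\<^sub>R c) d
        = (\<integral>x. norm c * (indicator T (x + d) - indicator T x + 2 * (indicator T x * (1 - indicator T (x + d)))) \<partial>lborel)"
      unfolding shift_modulus_def by (intro Bochner_Integration.integral_cong) (auto simp: indicator_def)
    also have "\<dots> = norm c * (2 * (\<integral>x. indicator T x * (1 - indicator T (x + d)) \<partial>lborel))"
      using integrable_shift[OF int, of d] integral_shift[OF int, of d] int intp by simp
    finally show ?thesis by simp
  qed
  have "(\<lambda>n. \<integral>x. indicator T x * (1 - indicator T (x + h n)) \<partial>lborel) \<longlonglongrightarrow> (\<integral>x. (0::real) \<partial>(lborel :: 'a measure))"
  proof (rule integral_dominated_convergence[OF _ _ int])
    show "AE x in lborel. (\<lambda>n. indicator T x * (1 - indicator T (x + h n)) :: real) \<longlonglongrightarrow> 0"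
    proof (rule AE_I2)
      fix x :: 'a
      show "(\<lambda>n. indicator T x * (1 - indicator T (x + h n)) :: real) \<longlonglongrightarrow> 0"
      proof (cases "x \<in> T")
        case True
        have "(\<lambda>n. x + h n) \<longlonglongrightarrow> x + 0" by (intro tendsto_intros h)
        then have "\<forall>\<^sub>F n in sequentially. x + h n \<in> T" using T(1) True by (auto dest: topological_tendstoD)
        then have "\<forall>\<^sub>F n in sequentially. 0 = (indicator T x * (1 - indicator T (x + h n)) :: real)"
          by eventually_elim simp
        then show ?thesis by (rule Lim_transform_eventually[OF tendsto_const])
      qed simp
    qed
  qed (auto simp: indicator_def)
  then have "(\<lambda>n. 2 * norm c * (\<integral>x. indicator T x * (1 - indicator T (x + h n)) \<partial>lborel)) \<longlonglongrightarrow> 2 * norm c * 0"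
    by (intro tendsto_intros) simp
  then show ?thesis by (simp add: eq)
qed

text \<open>Open sets are enough: sets of finite measure are approximated in measure by open sets from outside, and
  integrable functions in the mean by simple ones.\<close>

lemma shift_modulus_tendsto:
  fixes f :: "'a::euclidean_space \<Rightarrow> 'b::{banach, second_countable_topology}"
  assumes f: "integrable lborel f" and h: "h \<longlonglongrightarrow> 0"
  shows "(\<lambda>n. shift_modulus f (h n)) \<longlonglongrightarrow> 0"
  using f
proof (induction rule: integrable_induct)
  case (base A c)
  then have A [measurable]: "A \<in> sets borel" by simp
  have intA: "integrable lborel (\<lambda>x. indicator A x *\<^sub>R c)" using base by simp
  show ?case
  proof (rule shift_modulus_approx[OF intA])
    fix e :: real assume e: "0 < e"
    define d where "d = e / (norm c + 1)"
    have nc: "0 < norm c + 1" using norm_ge_zero[of c] by linarith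
    have d: "0 < d" using e nc by (simp add: d_def)
    obtain T where T: "open T" "A \<subseteq> T" "emeasure lborel (T - A) < ennreal d"
      using outer_regular_lborel[OF A, of d] d by auto
    have [measurable]: "T \<in> sets borel" using T by simp
    have "emeasure lborel T = emeasure lborel A + emeasure lborel (T - A)"
      using T(2) by (subst plus_emeasure) (auto intro!: arg_cong[where f="emeasure lborel"])
    also have "\<dots> < \<infinity>" using base T(3) by (auto simp: less_top[symmetric] top_unique)
    finally have Tfin: "emeasure lborel T < \<infinity>" .
    have "(\<integral>x. norm (indicator A x *\<^sub>R c - indicator T x *\<^sub>R c) \<partial>lborel) = (\<integral>x. indicator (T - A) x * norm c \<partial>lborel)"
      using T(2) by (intro Bochner_Integration.integral_cong) (auto simp: indicator_def)
    also have "\<dots> = measure lborel (T - A) * norm c" by simp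
    also have "\<dots> \<le> d * (norm c + 1)"
    proof (rule mult_mono)
      show "measure lborel (T - A) \<le> d"
        using T(3) d by (simp add: measure_def enn2real_leI less_imp_le)
    qed (use d in auto)
    also have "\<dots> = e" using nc by (simp add: d_def)
    finally show "\<exists>g. integrable lborel g \<and> (\<integral>x. norm (indicator A x *\<^sub>R c - g x) \<partial>lborel) \<le> e \<and> (\<lambda>n. shift_modulus g (h n)) \<longlonglongrightarrow> 0"
      using shift_modulus_open[OF T(1) Tfin h, of c] Tfin by (intro exI[of _ "\<lambda>x. indicator T x *\<^sub>R c"]) simp
  qed
next
  case (add f g)
  have "shift_modulus (\<lambda>x. f x + g x) d \<le> shift_modulus f d + shift_modulus g d" for d
  proof -
    note int = integrable_shift[OF add.hyps(1), of d] integrable_shift[OF add.hyps(2), of d] add.hyps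
    have "shift_modulus (\<lambda>x. f x + g x) d \<le> (\<integral>x. norm (f (x + d) - f x) + norm (g (x + d) - g x) \<partial>lborel)"
      unfolding shift_modulus_def
    proof (rule integral_mono)
      show "norm (f (x + d) + g (x + d) - (f x + g x)) \<le> norm (f (x + d) - f x) + norm (g (x + d) - g x)" for x
        using norm_triangle_ineq[of "f (x + d) - f x" "g (x + d) - g x"] by (simp add: algebra_simps)
    qed (use int in auto)
    then show ?thesis using int by (simp add: shift_modulus_def)
  qed
  then have le: "\<forall>\<^sub>F n in sequentially. shift_modulus (\<lambda>x. f x + g x) (h n) \<le> shift_modulus f (h n) + shift_modulus g (h n)"
    by (intro always_eventually allI)
  have nonneg: "\<forall>\<^sub>F n in sequentially. 0 \<le> shift_modulus (\<lambda>x. f x + g x) (h n)"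
    by (intro always_eventually allI shift_modulus_nonneg)
  from tendsto_add[OF add.IH] show ?case
    by (intro tendsto_sandwich[OF nonneg le tendsto_const]) simp
next
  case (lim f s)
  show ?case
  proof (rule shift_modulus_approx[OF lim.hyps(4)])
    fix e :: real assume e: "0 < e"
    have "(\<lambda>i. \<integral>x. norm (f x - s i x) \<partial>lborel) \<longlonglongrightarrow> (\<integral>x. 0 \<partial>(lborel :: 'a measure))"
    proof (rule integral_dominated_convergence)
      show "integrable lborel (\<lambda>x. 3 * norm (f x))" using lim.hyps(4) by simp
      show "AE x in lborel. (\<lambda>i. norm (f x - s i x)) \<longlonglongrightarrow> 0"
      proof (rule AE_I2)
        fix x
        have "(\<lambda>i. norm (f x - s i x)) \<longlonglongrightarrow> norm (f x - f x)" by (intro tendsto_intros lim.hyps(2)) simp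
        then show "(\<lambda>i. norm (f x - s i x)) \<longlonglongrightarrow> 0" by simp
      qed
      show "AE x in lborel. norm (norm (f x - s i x)) \<le> 3 * norm (f x)" for i
      proof (rule AE_I2)
        fix x show "norm (norm (f x - s i x)) \<le> 3 * norm (f x)"
          using norm_triangle_ineq4[of "f x" "s i x"] lim.hyps(3)[of x i] by simp
      qed
    qed (use lim.hyps(1,4) in auto)
    then have "\<forall>\<^sub>F i in sequentially. (\<integral>x. norm (f x - s i x) \<partial>lborel) < e"
      using e by (intro order_tendstoD(2)[of _ 0]) auto
    then obtain i where "(\<integral>x. norm (f x - s i x) \<partial>lborel) < e" by (auto simp: eventually_sequentially)
    then show "\<exists>g. integrable lborel g \<and> (\<integral>x. norm (f x - g x) \<partial>lborel) \<le> e \<and> (\<lambda>n. shift_modulus g (h n)) \<longlonglongrightarrow> 0"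
      using lim.hyps(1)[of i] lim.IH[of i] by (intro exI[of _ "s i"]) auto
  qed
qed

section \<open>The Gaussian and its Fourier integral\<close>

definition wave :: "'a::euclidean_space \<Rightarrow> 'a \<Rightarrow> complex"
  where "wave \<omega> x = exp (- \<i> * complex_of_real (\<omega> \<bullet> x))"

lemma norm_wave [simp]: "cmod (wave \<omega> x) = 1"
  by (simp add: wave_def)

lemma wave_add: "wave \<omega> (x + y) = wave \<omega> x * wave \<omega> y"
  by (simp add: wave_def inner_add_right ring_distribs exp_add[symmetric])

lemma wave_commute: "wave \<omega> x = wave x \<omega>"
  by (simp add: wave_def inner_commute)

lemma cnj_wave: "cnj (wave \<omega> x) = wave \<omega> (- x)"
  by (simp add: wave_def exp_cnj)

lemma borel_measurable_wave [measurable (raw)]: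
  assumes "f \<in> borel_measurable M" "g \<in> borel_measurable M"
  shows "(\<lambda>x. wave (f x) (g x)) \<in> borel_measurable M"
  unfolding wave_def using assms by measurable

lemma scaleC_eq_scaleR: "a *\<^sub>C x = Re a *\<^sub>R x + Im a *\<^sub>R (\<i> *\<^sub>C x)"
proof -
  have eq: "complex_of_real (Re a) + complex_of_real (Im a) * \<i> = a" by (simp add: complex_eq_iff)
  show ?thesis unfolding scaleR_scaleC scaleC_scaleC scaleC_add_left[symmetric] eq ..
qed

lemma borel_measurable_scaleC_fun [measurable (raw)]:
  fixes f :: "'a \<Rightarrow> 'b::{complex_hilbert_space, second_countable_topology}"
  assumes "a \<in> borel_measurable M" "f \<in> borel_measurable M"
  shows "(\<lambda>x. a x *\<^sub>C f x) \<in> borel_measurable M"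
  unfolding scaleC_eq_scaleR[of "a _"] using assms by measurable

lemma lborel_integral_prod_Basis:
  fixes f :: "'a::euclidean_space \<Rightarrow> real \<Rightarrow> complex"
  assumes f: "\<And>b. b \<in> Basis \<Longrightarrow> integrable lborel (f b)"
  shows "(\<integral>x. (\<Prod>b\<in>Basis. f b (x \<bullet> b)) \<partial>lborel) = (\<Prod>b\<in>Basis. integral\<^sup>L lborel (f b))"
proof -
  interpret product_sigma_finite "\<lambda>b::'a. lborel :: real measure" ..
  have [measurable]: "f b \<in> borel_measurable borel" if "b \<in> Basis" for b using f[OF that] by simp
  have "(\<integral>x. (\<Prod>b\<in>Basis. f b (x \<bullet> b)) \<partial>lborel)
      = (\<integral>p. (\<Prod>b\<in>Basis. f b ((\<Sum>b\<in>Basis. p b *\<^sub>R b) \<bullet> b)) \<partial>(\<Pi>\<^sub>M b\<in>Basis. lborel))"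
    by (subst lborel_eq) (intro integral_distr; measurable)
  also have "\<dots> = (\<integral>p. (\<Prod>b\<in>Basis. f b (p b)) \<partial>(\<Pi>\<^sub>M b\<in>Basis. lborel))"
    by (intro Bochner_Integration.integral_cong refl prod.cong) simp
  also have "\<dots> = (\<Prod>b\<in>Basis. integral\<^sup>L lborel (f b))"
    by (intro product_integral_prod finite_Basis f)
  finally show ?thesis .
qed

text \<open>The integral is, up to a factor, the characteristic function of the standard normal distribution. Integrability comes
  for free: a Bochner integral with a nonzero value cannot be the default value \<open>0\<close> of a divergent one.\<close>

lemma gaussian_fourier_real:
  "integrable lborel (\<lambda>x. complex_of_real (exp (- x\<^sup>2 / 2)) * exp (- \<i> * complex_of_real (t * x)))"
  "(\<integral>x. complex_of_real (exp (- x\<^sup>2 / 2)) * exp (- \<i> * complex_of_real (t * x)) \<partial>lborel)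
    = complex_of_real (sqrt (2 * pi) * exp (- t\<^sup>2 / 2))"
proof -
  let ?g = "\<lambda>x. complex_of_real (exp (- x\<^sup>2 / 2)) * exp (- \<i> * complex_of_real (t * x))"
  have "char std_normal_distribution (- t) = (\<integral>x. std_normal_density x *\<^sub>R exp (- \<i> * complex_of_real (t * x)) \<partial>lborel)"
    unfolding char_def by (subst integral_density) (auto simp: normal_density_nonneg)
  also have "(\<lambda>x. std_normal_density x *\<^sub>R exp (- \<i> * complex_of_real (t * x))) = (\<lambda>x. ?g x / complex_of_real (sqrt (2 * pi)))"
    by (simp add: std_normal_density_def scaleR_conv_of_real fun_eq_iff)
  finally have eq: "(\<integral>x. ?g x \<partial>lborel) / complex_of_real (sqrt (2 * pi)) = complex_of_real (exp (- t\<^sup>2 / 2))"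
    by (simp add: char_std_normal_distribution)
  then show val: "integral\<^sup>L lborel ?g = complex_of_real (sqrt (2 * pi) * exp (- t\<^sup>2 / 2))"
    by (simp add: field_simps)
  have "integral\<^sup>L lborel ?g \<noteq> 0" unfolding val by simp
  then show "integrable lborel ?g" using not_integrable_integral_eq by blast
qed

definition gaussian :: "'a::euclidean_space \<Rightarrow> real"
  where "gaussian x = exp (- (norm x)\<^sup>2 / 2)"

lemma borel_measurable_gaussian [measurable]: "gaussian \<in> borel_measurable borel"
  unfolding gaussian_def by measurable

lemma gaussian_pos: "0 < gaussian x" and gaussian_le_1: "gaussian x \<le> 1"
  by (simp_all add: gaussian_def)

lemma
  shows integrable_gaussian: "integrable lborel (gaussian :: 'a::euclidean_space \<Rightarrow> real)"
    and gaussian_fourier: "(\<integral>x. gaussian x *\<^sub>R wave \<omega> x \<partial>lborel) = of_real ((2 * pi) powr (DIM('a) / 2) * gaussian (\<omega> :: 'a))"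
proof -
  have split: "gaussian x *\<^sub>R wave \<omega> x
      = (\<Prod>b\<in>Basis. complex_of_real (exp (- (x \<bullet> b)\<^sup>2 / 2)) * exp (- \<i> * complex_of_real ((\<omega> \<bullet> b) * (x \<bullet> b))))" for x \<omega> :: 'a
  proof -
    have "(\<Prod>b\<in>Basis. complex_of_real (exp (- (x \<bullet> b)\<^sup>2 / 2)) * exp (- \<i> * complex_of_real ((\<omega> \<bullet> b) * (x \<bullet> b))))
        = complex_of_real (exp (\<Sum>b\<in>Basis. - (x \<bullet> b)\<^sup>2 / 2)) * exp (\<Sum>b\<in>Basis. - \<i> * complex_of_real ((\<omega> \<bullet> b) * (x \<bullet> b)))"
      by (simp add: prod.distrib exp_sum)
    also have "(\<Sum>b\<in>Basis. - (x \<bullet> b)\<^sup>2 / 2) = - (norm x)\<^sup>2 / 2"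
      unfolding power2_norm_eq_inner euclidean_inner[of x x]
      by (simp add: sum_negf sum_divide_distrib power2_eq_square)
    also have "(\<Sum>b\<in>Basis. - \<i> * complex_of_real ((\<omega> \<bullet> b) * (x \<bullet> b))) = - \<i> * complex_of_real (\<omega> \<bullet> x)"
      by (simp add: euclidean_inner[of \<omega> x] sum_distrib_left sum_negf)
    finally show ?thesis by (simp add: gaussian_def wave_def scaleR_conv_of_real)
  qed
  have val: "(\<integral>x. gaussian x *\<^sub>R wave \<omega> x \<partial>lborel) = of_real ((2 * pi) powr (DIM('a) / 2) * gaussian \<omega>)" for \<omega> :: 'a
  proof -
    have "(\<integral>x. gaussian x *\<^sub>R wave \<omega> x \<partial>lborel) = (\<Prod>b\<in>Basis. complex_of_real (sqrt (2 * pi) * exp (- (\<omega> \<bullet> b)\<^sup>2 / 2)))"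
      unfolding split gaussian_fourier_real(2)[symmetric]
      by (intro lborel_integral_prod_Basis gaussian_fourier_real(1))
    also have "\<dots> = of_real (sqrt (2 * pi) ^ DIM('a) * exp (\<Sum>b\<in>Basis. - (\<omega> \<bullet> b)\<^sup>2 / 2))"
      by (simp add: prod.distrib exp_sum)
    also have "(\<Sum>b\<in>Basis. - (\<omega> \<bullet> b)\<^sup>2 / 2) = - (norm \<omega>)\<^sup>2 / 2"
      unfolding power2_norm_eq_inner euclidean_inner[of \<omega> \<omega>]
      by (simp add: sum_negf sum_divide_distrib power2_eq_square)
    also have "sqrt (2 * pi) ^ DIM('a) = (2 * pi) powr (DIM('a) / 2)"
      by (simp add: powr_half_sqrt[symmetric] powr_realpow[symmetric] powr_powr)
    finally show ?thesis by (simp add: gaussian_def)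
  qed
  then show "(\<integral>x. gaussian x *\<^sub>R wave \<omega> x \<partial>lborel) = of_real ((2 * pi) powr (DIM('a) / 2) * gaussian \<omega>)" .
  have "(\<integral>x. gaussian x *\<^sub>R wave (0::'a) x \<partial>lborel) \<noteq> (0::complex)"
    unfolding val by (simp add: gaussian_def)
  then have "integrable lborel (\<lambda>x::'a. gaussian x *\<^sub>R wave 0 x)" using not_integrable_integral_eq by blast
  then have "integrable lborel (\<lambda>x::'a. Re (gaussian x *\<^sub>R wave 0 x))" by (rule integrable_Re)
  then show "integrable lborel (gaussian :: 'a \<Rightarrow> real)" by (simp add: wave_def)
qed

lemma integral_scaled:
  fixes f :: "'a::euclidean_space \<Rightarrow> 'b::{banach, second_countable_topology}"
  assumes [measurable]: "f \<in> borel_measurable borel" and c: "0 < c"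
  shows "(\<integral>x. f x \<partial>lborel) = c ^ DIM('a) *\<^sub>R (\<integral>x. f (c *\<^sub>R x) \<partial>lborel)"
proof -
  have "(\<integral>x. f x \<partial>lborel) = integral\<^sup>L (density (distr lborel borel (\<lambda>x::'a. 0 + c *\<^sub>R x)) (\<lambda>_. \<bar>c\<bar> ^ DIM('a))) f"
    using lborel_affine[of c "0::'a"] c by simp
  also have "\<dots> = c ^ DIM('a) *\<^sub>R (\<integral>x. f (c *\<^sub>R x) \<partial>lborel)"
    using c by (subst integral_density) (auto simp: integral_distr)
  finally show ?thesis .
qed

lemma integral_gaussian: "integral\<^sup>L lborel (gaussian :: 'a \<Rightarrow> real) = (2 * pi) powr (DIM('a::euclidean_space) / 2)"
proof -
  have "complex_of_real (integral\<^sup>L lborel (gaussian :: 'a \<Rightarrow> real)) = (\<integral>x. gaussian x *\<^sub>R wave (0::'a) x \<partial>lborel)"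
    by (simp add: wave_def scaleR_conv_of_real)
  also have "\<dots> = of_real ((2 * pi) powr (DIM('a) / 2))"
    unfolding gaussian_fourier by (simp add: gaussian_def)
  finally show ?thesis by (simp only: of_real_eq_iff)
qed

lemma integrable_gaussian_scaled:
  assumes \<epsilon>: "0 < \<epsilon>" shows "integrable lborel (\<lambda>\<omega>::'a::euclidean_space. gaussian (\<epsilon> *\<^sub>R \<omega>))"
proof -
  have "integral\<^sup>L lborel (gaussian :: 'a \<Rightarrow> real) = \<epsilon> ^ DIM('a) *\<^sub>R integral\<^sup>L lborel (\<lambda>\<omega>::'a. gaussian (\<epsilon> *\<^sub>R \<omega>))"
    by (rule integral_scaled[OF borel_measurable_gaussian \<epsilon>])
  moreover have "integral\<^sup>L lborel (gaussian :: 'a \<Rightarrow> real) \<noteq> 0" by (simp add: integral_gaussian)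
  ultimately have "integral\<^sup>L lborel (\<lambda>\<omega>::'a. gaussian (\<epsilon> *\<^sub>R \<omega>)) \<noteq> 0" by auto
  then show ?thesis using not_integrable_integral_eq by blast
qed

section \<open>The Plancherel identity\<close>

text \<open>Fubini's theorem with absolute integrability replaced by an iterated majorant.\<close>

lemma
  fixes F :: "'a::euclidean_space \<Rightarrow> 'c::euclidean_space \<Rightarrow> 'b::{banach, second_countable_topology}"
  assumes F: "(\<lambda>p. F (fst p) (snd p)) \<in> borel_measurable (lborel \<Otimes>\<^sub>M lborel)"
    and le: "\<And>x y. norm (F x y) \<le> G x y" and G: "\<And>x. integrable lborel (G x)"
    and w: "\<And>x. integral\<^sup>L lborel (G x) \<le> w x" "integrable lborel w"
  shows Fubini_majorized: "(\<integral>x. \<integral>y. F x y \<partial>lborel \<partial>lborel) = (\<integral>y. \<integral>x. F x y \<partial>lborel \<partial>lborel)"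
    and Fubini_majorized_integrable: "integrable lborel (\<lambda>y. \<integral>x. F x y \<partial>lborel)"
proof -
  have pair: "pair_sigma_finite (lborel :: 'a measure) (lborel :: 'c measure)" ..
  note [measurable] = F
  have meas: "F x \<in> borel_measurable lborel" for x
    using measurable_compose[OF measurable_Pair1' F, of x] by simp
  have int: "integrable lborel (F x)" for x
    by (rule integrable_majorized[OF G meas le])
  have "integrable (lborel \<Otimes>\<^sub>M lborel) (\<lambda>p. F (fst p) (snd p))"
  proof (rule pair_sigma_finite.Fubini_integrable[OF pair])
    show "integrable lborel (\<lambda>x. \<integral>y. norm (F (fst (x, y)) (snd (x, y))) \<partial>lborel)"
    proof (rule integrable_majorized[OF w(2)])
      show "norm (\<integral>y. norm (F (fst (x, y)) (snd (x, y))) \<partial>lborel) \<le> w x" for x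
      proof -
        have "norm (\<integral>y. norm (F x y) \<partial>lborel) \<le> integral\<^sup>L lborel (G x)"
          by (rule norm_integral_majorized[OF G]) (use meas le in auto)
        then show ?thesis using w(1)[of x] by simp
      qed
    qed measurable
  qed (use int F in auto)
  then have P: "integrable (lborel \<Otimes>\<^sub>M lborel) (case_prod F)" by (simp add: case_prod_unfold)
  show "(\<integral>x. \<integral>y. F x y \<partial>lborel \<partial>lborel) = (\<integral>y. \<integral>x. F x y \<partial>lborel \<partial>lborel)"
    using pair_sigma_finite.Fubini_integral[OF pair P] by simp
  show "integrable lborel (\<lambda>y. \<integral>x. F x y \<partial>lborel)" by (rule pair_sigma_finite.integrable_snd[OF pair P])
qed

definition autocorrelation :: "('a::euclidean_space \<Rightarrow> 'b::{complex_hilbert_space, second_countable_topology}) \<Rightarrow> 'a \<Rightarrow> complex"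
  where "autocorrelation f h = (\<integral>y. cinner (f (y + h)) (f y) \<partial>lborel)"

text \<open>The Fourier integral without the normalizing power of \<open>2 * pi\<close>.\<close>

definition plain_fourier :: "('a::euclidean_space \<Rightarrow> 'b::{complex_hilbert_space, second_countable_topology}) \<Rightarrow> 'a \<Rightarrow> 'b"
  where "plain_fourier f \<omega> = (\<integral>x. wave \<omega> x *\<^sub>C f x \<partial>lborel)"

lemma wave_integrable:
  fixes f :: "'a::euclidean_space \<Rightarrow> 'b::{complex_hilbert_space, second_countable_topology}"
  assumes f: "integrable lborel f" shows "integrable lborel (\<lambda>x. wave \<omega> x *\<^sub>C f x)"
proof (rule integrable_majorized[OF integrable_norm[OF f]])
  have [measurable]: "f \<in> borel_measurable borel" using f by simp
  show "(\<lambda>x. wave \<omega> x *\<^sub>C f x) \<in> borel_measurable lborel" by measurable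
qed (simp add: norm_scaleC)

lemma plain_fourier_measurable:
  fixes f :: "'a::euclidean_space \<Rightarrow> 'b::{complex_hilbert_space, second_countable_topology}"
  assumes f: "integrable lborel f" shows "plain_fourier f \<in> borel_measurable borel"
proof -
  have [measurable]: "f \<in> borel_measurable borel" using f by simp
  show ?thesis unfolding plain_fourier_def by measurable
qed

lemma norm_plain_fourier_le: "norm (plain_fourier f \<omega>) \<le> (\<integral>x. norm (f x) \<partial>lborel)"
  unfolding plain_fourier_def
  by (rule order_trans[OF integral_norm_bound]) (simp add: norm_scaleC)

lemma
  fixes f :: "'a::euclidean_space \<Rightarrow> 'b::{complex_hilbert_space, second_countable_topology}"
  assumes f: "f \<in> L2_fun lborel"
  shows autocorrelation_integrable: "integrable lborel (\<lambda>y. cinner (f (y + h)) (f y))"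
    and norm_autocorrelation_le: "cmod (autocorrelation f h) \<le> (L2_norm lborel f)\<^sup>2"
proof -
  note fh = L2_fun_translate[OF f, of h]
  show int: "integrable lborel (\<lambda>y. cinner (f (y + h)) (f y))"
    by (rule L2_cinner_integrable[OF fh f])
  have sq: "integrable lborel (\<lambda>y. (norm (f y))\<^sup>2)" by (rule L2_fun_integrable[OF f])
  have "cmod (autocorrelation f h) \<le> (\<integral>y. ((norm (f (y + h)))\<^sup>2 + (norm (f y))\<^sup>2) / 2 \<partial>lborel)"
    unfolding autocorrelation_def
  proof (rule norm_integral_majorized)
    show "cmod (cinner (f (y + h)) (f y)) \<le> ((norm (f (y + h)))\<^sup>2 + (norm (f y))\<^sup>2) / 2" for y
    proof -
      have "0 \<le> (norm (f (y + h)) - norm (f y))\<^sup>2" by simp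
      then show ?thesis using cinner_Cauchy_Schwarz[of "f (y + h)" "f y"] by (simp add: power2_diff)
    qed
    show "integrable lborel (\<lambda>y. ((norm (f (y + h)))\<^sup>2 + (norm (f y))\<^sup>2) / 2)"
      using sq integrable_shift[OF sq, of h] by simp
  qed (use int in simp)
  also have "\<dots> = (L2_norm lborel f)\<^sup>2"
    using sq integrable_shift[OF sq, of h] integral_shift[OF sq, of h] by (simp add: L2_norm_sq)
  finally show "cmod (autocorrelation f h) \<le> (L2_norm lborel f)\<^sup>2" .
qed

lemma autocorrelation_zero: "autocorrelation f 0 = of_real ((L2_norm lborel f)\<^sup>2)"
  by (simp add: autocorrelation_def cinner_self L2_norm_sq del: of_real_power)

text \<open>Where \<open>f\<close> is bounded by \<open>K\<close>, the increment of the autocorrelation is controlled by the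
  modulus of continuity in the mean; the rest of \<open>f\<close> is small in \<open>L\<^sup>2\<close>.\<close>

lemma autocorrelation_tendsto:
  fixes f :: "'a::euclidean_space \<Rightarrow> 'b::{complex_hilbert_space, second_countable_topology}"
  assumes f1: "integrable lborel f" and f2: "f \<in> L2_fun lborel" and h: "h \<longlonglongrightarrow> 0"
  shows "(\<lambda>n. autocorrelation f (h n)) \<longlonglongrightarrow> of_real ((L2_norm lborel f)\<^sup>2)"
proof (rule LIMSEQ_I)
  fix e :: real assume e: "0 < e"
  have [measurable]: "f \<in> borel_measurable borel" using f1 by simp
  define N where "N = (L2_norm lborel f)\<^sup>2"
  define \<delta> where "\<delta> = e / (3 * (2 * N + 1))"
  have N: "0 \<le> N" by (simp add: N_def)
  have \<delta>: "0 < \<delta>" using e N by (simp add: \<delta>_def)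
  have \<delta>N: "\<delta> * (2 * N) \<le> e / 3"
  proof -
    have "\<delta> * (2 * N) \<le> \<delta> * (2 * N + 1)" using \<delta> by (intro mult_left_mono) auto
    also have "\<dots> = e / 3" using N by (simp add: \<delta>_def field_simps)
    finally show ?thesis .
  qed
  define r where "r k y = (if real k < norm (f y) then norm (f y) else 0)" for k y
  have [measurable]: "r k \<in> borel_measurable borel" for k unfolding r_def by measurable
  have sq: "integrable lborel (\<lambda>y. (norm (f y))\<^sup>2)" by (rule L2_fun_integrable[OF f2])
  have rint: "integrable lborel (\<lambda>y. (r k y)\<^sup>2)" for k
    by (rule integrable_majorized[OF sq]) (auto simp: r_def)
  have "(\<lambda>k. \<integral>y. (r k y)\<^sup>2 \<partial>lborel) \<longlonglongrightarrow> (\<integral>y. 0 \<partial>(lborel :: 'a measure))"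
  proof (rule integral_dominated_convergence[OF _ _ sq])
    show "AE y in lborel. (\<lambda>k. (r k y)\<^sup>2) \<longlonglongrightarrow> 0"
    proof (rule AE_I2)
      fix y
      obtain K :: nat where K: "norm (f y) \<le> real K" using real_arch_simple by blast
      have "\<forall>\<^sub>F k in sequentially. 0 = (r k y)\<^sup>2"
        using eventually_ge_at_top[of K] by eventually_elim (use K in \<open>simp add: r_def\<close>)
      then show "(\<lambda>k. (r k y)\<^sup>2) \<longlonglongrightarrow> 0" by (rule Lim_transform_eventually[OF tendsto_const])
    qed
  qed (auto simp: r_def)
  then have "\<forall>\<^sub>F k in sequentially. (\<integral>y. (r k y)\<^sup>2 \<partial>lborel) < 2 * \<delta> * (e / 3)"
    using \<delta> e by (intro order_tendstoD(2)[of _ 0]) auto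
  then obtain K where K: "(\<integral>y. (r K y)\<^sup>2 \<partial>lborel) < 2 * \<delta> * (e / 3)" by (auto simp: eventually_sequentially)
  have est: "cmod (autocorrelation f d - of_real N) \<le> real K * shift_modulus f d + 2 * e / 3" for d
  proof -
    have mi: "integrable lborel (\<lambda>y. norm (f (y + d) - f y))"
      using f1 integrable_shift[OF f1, of d] by simp
    let ?w = "\<lambda>y. real K * norm (f (y + d) - f y) + \<delta> * ((norm (f (y + d)))\<^sup>2 + (norm (f y))\<^sup>2) + (r K y)\<^sup>2 / (2 * \<delta>)"
    have wint: "integrable lborel ?w"
      using mi sq integrable_shift[OF sq, of d] rint[of K] by simp
    have "autocorrelation f d - of_real N = (\<integral>y. cinner (f (y + d) - f y) (f y) \<partial>lborel)"
      unfolding N_def autocorrelation_zero[symmetric] cinner_diff_left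
      using autocorrelation_integrable[OF f2, of d] autocorrelation_integrable[OF f2, of 0]
      by (simp add: autocorrelation_def)
    also have "cmod \<dots> \<le> integral\<^sup>L lborel ?w"
    proof (rule norm_integral_majorized[OF wint])
      show "cmod (cinner (f (y + d) - f y) (f y)) \<le> ?w y" for y
      proof -
        define a where "a = norm (f (y + d) - f y)"
        have a: "0 \<le> a" by (simp add: a_def)
        have 1: "a * norm (f y) \<le> real K * a + a * r K y"
          using a mult_left_mono[of "norm (f y)" "real K" a] by (auto simp: r_def mult.commute)
        have "0 \<le> (\<delta> * a - r K y)\<^sup>2 / (2 * \<delta>)" using \<delta> by simp
        also have "\<dots> = \<delta> * a\<^sup>2 / 2 - a * r K y + (r K y)\<^sup>2 / (2 * \<delta>)"
          using \<delta> by (simp add: power2_eq_square field_simps)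
        finally have 2: "a * r K y \<le> \<delta> * (a\<^sup>2 / 2) + (r K y)\<^sup>2 / (2 * \<delta>)" by simp
        have "a\<^sup>2 / 2 \<le> (norm (f (y + d)))\<^sup>2 + (norm (f y))\<^sup>2"
          using norm_add_sq_le[of "f (y + d)" "- f y"] by (simp add: a_def)
        then have "\<delta> * (a\<^sup>2 / 2) \<le> \<delta> * ((norm (f (y + d)))\<^sup>2 + (norm (f y))\<^sup>2)"
          using \<delta> by (intro mult_left_mono) auto
        then show ?thesis
          using cinner_Cauchy_Schwarz[of "f (y + d) - f y" "f y"] 1 2 unfolding a_def by linarith
      qed
    qed measurable
    also have "integral\<^sup>L lborel ?w = real K * shift_modulus f d + \<delta> * (2 * N) + (\<integral>y. (r K y)\<^sup>2 \<partial>lborel) / (2 * \<delta>)"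
      using mi sq integrable_shift[OF sq, of d] integral_shift[OF sq, of d] rint[of K]
      by (simp add: shift_modulus_def N_def L2_norm_sq)
    also have "\<dots> \<le> real K * shift_modulus f d + e / 3 + e / 3"
    proof -
      have "(\<integral>y. (r K y)\<^sup>2 \<partial>lborel) / (2 * \<delta>) \<le> e / 3" using K \<delta> by (simp add: field_simps)
      then show ?thesis using \<delta>N by linarith
    qed
    finally show ?thesis by simp
  qed
  have "(\<lambda>n. real K * shift_modulus f (h n)) \<longlonglongrightarrow> real K * 0"
    by (intro tendsto_intros shift_modulus_tendsto f1 h)
  then obtain n0 where n0: "\<And>n. n \<ge> n0 \<Longrightarrow> norm (real K * shift_modulus f (h n) - 0) < e / 3"
    using LIMSEQ_D[of _ 0 "e / 3"] e by (metis divide_pos_pos mult_zero_right zero_less_numeral)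
  have "cmod (autocorrelation f (h n) - of_real N) < e" if "n \<ge> n0" for n
    using est[of "h n"] n0[OF that] by simp
  then show "\<exists>n0. \<forall>n\<ge>n0. cmod (autocorrelation f (h n) - of_real ((L2_norm lborel f)\<^sup>2)) < e"
    unfolding N_def by blast
qed

text \<open>Wiener-Khinchin: write the squared norm as a double integral over \<open>x\<close> and \<open>y\<close>, substitute \<open>x = y + h\<close> and
  integrate over \<open>y\<close> first.\<close>

lemma
  fixes f :: "'a::euclidean_space \<Rightarrow> 'b::{complex_hilbert_space, second_countable_topology}"
  assumes f: "integrable lborel f"
  shows plain_fourier_autocorrelation:
      "of_real ((norm (plain_fourier f \<omega>))\<^sup>2) = (\<integral>h. wave \<omega> h * autocorrelation f h \<partial>lborel)"
    and integrable_autocorrelation: "integrable lborel (autocorrelation f)"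
proof -
  have [measurable]: "f \<in> borel_measurable borel" using f by simp
  note nf = integrable_norm[OF f]
  have main: "(\<integral>y. \<integral>h. wave \<omega> h * cinner (f (y + h)) (f y) \<partial>lborel \<partial>lborel)
        = (\<integral>h. \<integral>y. wave \<omega> h * cinner (f (y + h)) (f y) \<partial>lborel \<partial>lborel)"
    "integrable lborel (\<lambda>h. \<integral>y. wave \<omega> h * cinner (f (y + h)) (f y) \<partial>lborel)" for \<omega>
  proof -
    have meas: "(\<lambda>p. wave \<omega> (snd p) * cinner (f (fst p + snd p)) (f (fst p))) \<in> borel_measurable (lborel \<Otimes>\<^sub>M lborel)"
      by measurable
    have le: "cmod (wave \<omega> h * cinner (f (y + h)) (f y)) \<le> norm (f (h + y)) * norm (f y)" for y h
      using cinner_Cauchy_Schwarz[of "f (y + h)" "f y"] by (simp add: norm_mult add.commute)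
    have G: "integrable lborel (\<lambda>h. norm (f (h + y)) * norm (f y))" for y
      using integrable_shift[OF nf, of y] by simp
    have w: "(\<integral>h. norm (f (h + y)) * norm (f y) \<partial>lborel) \<le> (\<integral>x. norm (f x) \<partial>lborel) * norm (f y)" for y
      using integrable_shift[OF nf, of y] integral_shift[OF nf, of y] by simp
    have wi: "integrable lborel (\<lambda>y. (\<integral>x. norm (f x) \<partial>lborel) * norm (f y))" using nf by simp
    show "(\<integral>y. \<integral>h. wave \<omega> h * cinner (f (y + h)) (f y) \<partial>lborel \<partial>lborel)
        = (\<integral>h. \<integral>y. wave \<omega> h * cinner (f (y + h)) (f y) \<partial>lborel \<partial>lborel)"
      by (rule Fubini_majorized[OF meas le G w wi])
    show "integrable lborel (\<lambda>h. \<integral>y. wave \<omega> h * cinner (f (y + h)) (f y) \<partial>lborel)"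
      by (rule Fubini_majorized_integrable[OF meas le G w wi])
  qed
  have "of_real ((norm (plain_fourier f \<omega>))\<^sup>2) = cinner (plain_fourier f \<omega>) (plain_fourier f \<omega>)"
    by (simp add: cinner_self)
  also have "\<dots> = (\<integral>y. cinner (plain_fourier f \<omega>) (wave \<omega> y *\<^sub>C f y) \<partial>lborel)"
    by (subst (2) plain_fourier_def)
      (rule integral_bounded_linear[OF bounded_linear_cinner_right wave_integrable[OF f], symmetric])
  also have "\<dots> = (\<integral>y. \<integral>h. wave \<omega> h * cinner (f (y + h)) (f y) \<partial>lborel \<partial>lborel)"
  proof (intro Bochner_Integration.integral_cong refl)
    fix y
    have "cinner (plain_fourier f \<omega>) (wave \<omega> y *\<^sub>C f y) = (\<integral>x. cinner (wave \<omega> x *\<^sub>C f x) (wave \<omega> y *\<^sub>C f y) \<partial>lborel)"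
      unfolding plain_fourier_def
      by (rule integral_bounded_linear[OF bounded_linear_cinner_left wave_integrable[OF f], symmetric])
    also have "\<dots> = (\<integral>h. cinner (wave \<omega> (h + y) *\<^sub>C f (h + y)) (wave \<omega> y *\<^sub>C f y) \<partial>lborel)"
      by (rule integral_shift[symmetric])
        (rule integrable_bounded_linear[OF bounded_linear_cinner_left wave_integrable[OF f]])
    also have "\<dots> = (\<integral>h. wave \<omega> h * cinner (f (y + h)) (f y) \<partial>lborel)"
    proof (intro Bochner_Integration.integral_cong refl)
      fix h
      have "cnj (wave \<omega> y) * wave \<omega> y = 1"
        using complex_norm_square[of "wave \<omega> y"] by (simp add: mult.commute)
      then show "cinner (wave \<omega> (h + y) *\<^sub>C f (h + y)) (wave \<omega> y *\<^sub>C f y) = wave \<omega> h * cinner (f (y + h)) (f y)"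
        by (simp add: cinner_scaleC_left cinner_scaleC_right wave_add add.commute[of h y])
    qed
    finally show "cinner (plain_fourier f \<omega>) (wave \<omega> y *\<^sub>C f y) = (\<integral>h. wave \<omega> h * cinner (f (y + h)) (f y) \<partial>lborel)" .
  qed
  also have "\<dots> = (\<integral>h. wave \<omega> h * autocorrelation f h \<partial>lborel)"
    unfolding main(1) autocorrelation_def by simp
  finally show "of_real ((norm (plain_fourier f \<omega>))\<^sup>2) = (\<integral>h. wave \<omega> h * autocorrelation f h \<partial>lborel)" .
  have "integrable lborel (\<lambda>h. \<integral>y. wave 0 h * cinner (f (y + h)) (f y) \<partial>lborel)" by (rule main(2))
  then show "integrable lborel (autocorrelation f)" by (simp add: wave_def autocorrelation_def[abs_def])
qed

text \<open>Fubini's theorem moves the Gaussian weight from the frequency side to the autocorrelation. A wide Gaussian becomes a narrow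
  one, and the substitution \<open>h = \<epsilon> *\<^sub>R z\<close> turns the dependence on \<open>\<epsilon>\<close> into a small translation.\<close>

lemma gaussian_mean_fourier:
  fixes f :: "'a::euclidean_space \<Rightarrow> 'b::{complex_hilbert_space, second_countable_topology}"
  assumes f: "integrable lborel f" and \<epsilon>: "0 < \<epsilon>"
  shows "(\<integral>\<omega>. complex_of_real (gaussian (\<epsilon> *\<^sub>R \<omega>) * (norm (plain_fourier f \<omega>))\<^sup>2) \<partial>lborel)
    = (\<integral>z. autocorrelation f (\<epsilon> *\<^sub>R z) * of_real ((2 * pi) powr (DIM('a) / 2) * gaussian z) \<partial>lborel)"
proof -
  define a where "a = autocorrelation f"
  have a: "integrable lborel a" unfolding a_def by (rule integrable_autocorrelation[OF f])
  have [measurable]: "a \<in> borel_measurable borel" using a by simp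
  have inner: "(\<integral>\<omega>. gaussian (\<epsilon> *\<^sub>R \<omega>) *\<^sub>R wave \<omega> (\<epsilon> *\<^sub>R z) \<partial>lborel)
      = of_real ((2 * pi) powr (DIM('a) / 2) * gaussian z / \<epsilon> ^ DIM('a))" for z :: 'a
  proof -
    have "(\<integral>x. gaussian x *\<^sub>R wave z x \<partial>lborel) = \<epsilon> ^ DIM('a) *\<^sub>R (\<integral>\<omega>. gaussian (\<epsilon> *\<^sub>R \<omega>) *\<^sub>R wave z (\<epsilon> *\<^sub>R \<omega>) \<partial>lborel)"
      by (rule integral_scaled[OF _ \<epsilon>]) measurable
    also have "(\<lambda>\<omega>. gaussian (\<epsilon> *\<^sub>R \<omega>) *\<^sub>R wave z (\<epsilon> *\<^sub>R \<omega>)) = (\<lambda>\<omega>. gaussian (\<epsilon> *\<^sub>R \<omega>) *\<^sub>R wave \<omega> (\<epsilon> *\<^sub>R z))"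
      by (simp add: wave_def inner_commute[of z])
    finally show ?thesis using gaussian_fourier[of z] \<epsilon> by (simp add: scaleR_conv_of_real field_simps)
  qed
  have "(\<integral>\<omega>. complex_of_real (gaussian (\<epsilon> *\<^sub>R \<omega>) * (norm (plain_fourier f \<omega>))\<^sup>2) \<partial>lborel)
      = (\<integral>\<omega>. \<integral>h. gaussian (\<epsilon> *\<^sub>R \<omega>) *\<^sub>R (wave \<omega> h * a h) \<partial>lborel \<partial>lborel)"
  proof -
    have "complex_of_real (gaussian (\<epsilon> *\<^sub>R \<omega>) * (norm (plain_fourier f \<omega>))\<^sup>2)
        = gaussian (\<epsilon> *\<^sub>R \<omega>) *\<^sub>R (\<integral>h. wave \<omega> h * a h \<partial>lborel)" for \<omega>
      unfolding a_def plain_fourier_autocorrelation[OF f, symmetric] by (simp add: scaleR_conv_of_real)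
    then show ?thesis by simp
  qed
  also have "\<dots> = (\<integral>h. \<integral>\<omega>. gaussian (\<epsilon> *\<^sub>R \<omega>) *\<^sub>R (wave \<omega> h * a h) \<partial>lborel \<partial>lborel)"
  proof (rule Fubini_majorized)
    show "norm (gaussian (\<epsilon> *\<^sub>R \<omega>) *\<^sub>R (wave \<omega> h * a h)) \<le> gaussian (\<epsilon> *\<^sub>R \<omega>) * cmod (a h)" for \<omega> h :: 'a
      using gaussian_pos[of "\<epsilon> *\<^sub>R \<omega>"] by (simp add: norm_mult)
    show "integrable lborel (\<lambda>h. gaussian (\<epsilon> *\<^sub>R \<omega>) * cmod (a h))" for \<omega> :: 'a using a by simp
    show "(\<integral>h. gaussian (\<epsilon> *\<^sub>R \<omega>) * cmod (a h) \<partial>lborel) \<le> gaussian (\<epsilon> *\<^sub>R \<omega>) * (\<integral>h. cmod (a h) \<partial>lborel)" for \<omega> :: 'a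
      by simp
    show "integrable lborel (\<lambda>\<omega>::'a. gaussian (\<epsilon> *\<^sub>R \<omega>) * (\<integral>h. cmod (a h) \<partial>lborel))"
      using integrable_gaussian_scaled[OF \<epsilon>, where 'a='a] by simp
  qed measurable
  also have "\<dots> = (\<integral>h. (\<integral>\<omega>. gaussian (\<epsilon> *\<^sub>R \<omega>) *\<^sub>R wave \<omega> h \<partial>lborel) * a h \<partial>lborel)"
    by (simp add: mult_scaleR_left[symmetric] del: mult_scaleR_left)
  also have "\<dots> = \<epsilon> ^ DIM('a) *\<^sub>R (\<integral>z. (\<integral>\<omega>. gaussian (\<epsilon> *\<^sub>R \<omega>) *\<^sub>R wave \<omega> (\<epsilon> *\<^sub>R z) \<partial>lborel) * a (\<epsilon> *\<^sub>R z) \<partial>lborel)"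
    by (rule integral_scaled[OF _ \<epsilon>]) measurable
  also have "\<dots> = (\<integral>z. \<epsilon> ^ DIM('a) *\<^sub>R ((\<integral>\<omega>. gaussian (\<epsilon> *\<^sub>R \<omega>) *\<^sub>R wave \<omega> (\<epsilon> *\<^sub>R z) \<partial>lborel) * a (\<epsilon> *\<^sub>R z)) \<partial>lborel)"
    by simp
  also have "\<dots> = (\<integral>z. a (\<epsilon> *\<^sub>R z) * of_real ((2 * pi) powr (DIM('a) / 2) * gaussian z) \<partial>lborel)"
    unfolding inner using \<epsilon> by (simp add: scaleR_conv_of_real mult_ac)
  finally show ?thesis by (simp add: a_def)
qed

lemma gaussian_scaled_tendsto: "(\<lambda>n. gaussian ((1 / real (Suc n)) *\<^sub>R \<omega>)) \<longlonglongrightarrow> 1"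
proof -
  have lim: "(\<lambda>n. (1 / real (Suc n)) *\<^sub>R \<omega>) \<longlonglongrightarrow> 0 *\<^sub>R \<omega>"
    by (intro tendsto_intros LIMSEQ_Suc[OF lim_1_over_n])
  have "(\<lambda>n. exp (- (norm ((1 / real (Suc n)) *\<^sub>R \<omega>))\<^sup>2 / 2)) \<longlonglongrightarrow> exp (- (norm (0 *\<^sub>R \<omega>))\<^sup>2 / 2)"
    by (intro tendsto_exp tendsto_divide tendsto_minus tendsto_power tendsto_norm tendsto_const lim) simp
  then show ?thesis by (simp add: gaussian_def)
qed

text \<open>As \<open>\<epsilon>\<close> tends to \<open>0\<close>, the autocorrelation side tends to a multiple of the squared norm of \<open>f\<close>. The frequency side
  stays bounded, so Fatou's lemma gives square integrability of the transform, and then dominated convergence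
  identifies the limit.\<close>

lemma
  fixes f :: "'a::euclidean_space \<Rightarrow> 'b::{complex_hilbert_space, second_countable_topology}"
  assumes f1: "integrable lborel f" and f2: "f \<in> L2_fun lborel"
  shows plain_fourier_L2: "plain_fourier f \<in> L2_fun lborel"
    and L2_norm_plain_fourier: "(L2_norm lborel (plain_fourier f))\<^sup>2 = (2 * pi) powr DIM('a) * (L2_norm lborel f)\<^sup>2"
proof -
  define N where "N = (L2_norm lborel f)\<^sup>2"
  define c where "c = (2 * pi) powr (DIM('a) / 2)"
  define \<epsilon> where "\<epsilon> n = 1 / real (Suc n)" for n
  have \<epsilon>: "0 < \<epsilon> n" for n by (simp add: \<epsilon>_def)
  have c: "0 < c" by (simp add: c_def)
  have N: "0 \<le> N" by (simp add: N_def)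
  have c2: "c * c = (2 * pi) powr DIM('a)" by (simp add: c_def powr_add[symmetric])
  note [measurable] = plain_fourier_measurable[OF f1]
  have [measurable]: "autocorrelation f \<in> borel_measurable borel" using integrable_autocorrelation[OF f1] by simp
  define X where "X n = (\<integral>\<omega>. gaussian (\<epsilon> n *\<^sub>R \<omega>) * (norm (plain_fourier f \<omega>))\<^sup>2 \<partial>lborel)" for n
  have X: "complex_of_real (X n) = (\<integral>z. autocorrelation f (\<epsilon> n *\<^sub>R z) * of_real (c * gaussian z) \<partial>lborel)" for n
    using gaussian_mean_fourier[OF f1 \<epsilon>[of n]] unfolding X_def c_def by (simp del: of_real_mult of_real_power)
  have maj: "cmod (autocorrelation f z * of_real (c * gaussian y)) \<le> N * c * gaussian y" for y z :: 'a
    using mult_right_mono[OF norm_autocorrelation_le[OF f2, of z], of "c * gaussian y"] c gaussian_pos[of y]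
    by (simp add: norm_mult N_def mult.assoc)
  have int: "integrable lborel (\<lambda>y::'a. N * c * gaussian y)"
    using integrable_gaussian[where 'a='a] by simp
  have ig: "(\<integral>y. N * c * gaussian y \<partial>(lborel :: 'a measure)) = N * (c * c)"
    using integral_gaussian[where 'a='a] by (simp add: c_def)
  have Xle: "X n \<le> N * (c * c)" for n
  proof -
    have "cmod (complex_of_real (X n)) \<le> N * (c * c)"
      unfolding X ig[symmetric] by (rule norm_integral_majorized[OF int _ maj]) measurable
    then show ?thesis by simp
  qed
  have "(\<lambda>n. complex_of_real (X n)) \<longlonglongrightarrow> (\<integral>y. of_real N * of_real (c * gaussian y) \<partial>(lborel :: 'a measure))"
    unfolding X
  proof (rule integral_dominated_convergence[OF _ _ int])
    show "AE z in lborel. (\<lambda>n. autocorrelation f (\<epsilon> n *\<^sub>R z) * of_real (c * gaussian z)) \<longlonglongrightarrow> of_real N * of_real (c * gaussian z)"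
    proof (intro AE_I2 tendsto_mult tendsto_const)
      fix z :: 'a
      have "(\<lambda>n. \<epsilon> n *\<^sub>R z) \<longlonglongrightarrow> 0 *\<^sub>R z" unfolding \<epsilon>_def by (intro tendsto_intros LIMSEQ_Suc[OF lim_1_over_n])
      then show "(\<lambda>n. autocorrelation f (\<epsilon> n *\<^sub>R z)) \<longlonglongrightarrow> of_real N"
        unfolding N_def by (intro autocorrelation_tendsto f1 f2) simp
    qed
    show "AE z in lborel. cmod (autocorrelation f (\<epsilon> n *\<^sub>R z) * of_real (c * gaussian z)) \<le> N * c * gaussian z" for n
      by (intro AE_I2 maj)
  qed measurable
  also have "(\<integral>y. of_real N * of_real (c * gaussian y) \<partial>(lborel :: 'a measure)) = complex_of_real (N * (c * c))"
    unfolding ig[symmetric] of_real_mult[symmetric] integral_complex_of_real by (simp add: mult.assoc)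
  finally have Xlim: "X \<longlonglongrightarrow> N * (c * c)" by (simp only: tendsto_of_real_iff)
  have Xint: "integrable lborel (\<lambda>\<omega>. gaussian (\<epsilon> n *\<^sub>R \<omega>) * (norm (plain_fourier f \<omega>))\<^sup>2)" for n
  proof (rule integrable_majorized)
    show "integrable lborel (\<lambda>\<omega>::'a. gaussian (\<epsilon> n *\<^sub>R \<omega>) * (\<integral>x. norm (f x) \<partial>lborel)\<^sup>2)"
      using integrable_gaussian_scaled[OF \<epsilon>, where 'a='a] by simp
    show "norm (gaussian (\<epsilon> n *\<^sub>R \<omega>) * (norm (plain_fourier f \<omega>))\<^sup>2) \<le> gaussian (\<epsilon> n *\<^sub>R \<omega>) * (\<integral>x. norm (f x) \<partial>lborel)\<^sup>2" for \<omega>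
      using mult_left_mono[OF power_mono[OF norm_plain_fourier_le[of f \<omega>] norm_ge_zero, of 2], of "gaussian (\<epsilon> n *\<^sub>R \<omega>)"]
        gaussian_pos[of "\<epsilon> n *\<^sub>R \<omega>"] by (simp add: abs_mult)
  qed measurable
  define F where "F n \<omega> = sqrt (gaussian (\<epsilon> n *\<^sub>R \<omega>)) *\<^sub>R plain_fourier f \<omega>" for n \<omega>
  have Fsq: "(norm (F n \<omega>))\<^sup>2 = gaussian (\<epsilon> n *\<^sub>R \<omega>) * (norm (plain_fourier f \<omega>))\<^sup>2" for n \<omega>
    using gaussian_pos[of "\<epsilon> n *\<^sub>R \<omega>"] by (simp add: F_def power_mult_distrib)
  have F: "F n \<in> L2_fun lborel" for n
  proof -
    have "F n \<in> borel_measurable borel" unfolding F_def by measurable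
    then show ?thesis using Xint[of n] by (simp add: L2_fun_def Fsq)
  qed
  have Fnorm: "L2_norm lborel (F n) \<le> sqrt (N * (c * c))" for n
    unfolding L2_norm_def Fsq using Xle[of n] by (simp add: X_def)
  show L2: "plain_fourier f \<in> L2_fun lborel"
  proof (rule L2_Fatou(1)[OF F])
    show "AE \<omega> in lborel. (\<lambda>n. F n \<omega>) \<longlonglongrightarrow> plain_fourier f \<omega>"
    proof (rule AE_I2)
      fix \<omega>
      have "(\<lambda>n. F n \<omega>) \<longlonglongrightarrow> sqrt 1 *\<^sub>R plain_fourier f \<omega>"
        unfolding F_def \<epsilon>_def by (intro tendsto_intros gaussian_scaled_tendsto)
      then show "(\<lambda>n. F n \<omega>) \<longlonglongrightarrow> plain_fourier f \<omega>" by simp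
    qed
    show "\<forall>\<^sub>F n in sequentially. L2_norm lborel (F n) \<le> sqrt (N * (c * c))"
      by (intro always_eventually allI Fnorm)
  qed (use N c in auto)
  have "X \<longlonglongrightarrow> (\<integral>\<omega>. 1 * (norm (plain_fourier f \<omega>))\<^sup>2 \<partial>lborel)"
    unfolding X_def
  proof (rule integral_dominated_convergence[OF _ _ L2_fun_integrable[OF L2]])
    show "AE \<omega> in lborel. (\<lambda>n. gaussian (\<epsilon> n *\<^sub>R \<omega>) * (norm (plain_fourier f \<omega>))\<^sup>2) \<longlonglongrightarrow> 1 * (norm (plain_fourier f \<omega>))\<^sup>2"
      unfolding \<epsilon>_def by (intro AE_I2 tendsto_intros gaussian_scaled_tendsto)
    show "AE \<omega> in lborel. norm (gaussian (\<epsilon> n *\<^sub>R \<omega>) * (norm (plain_fourier f \<omega>))\<^sup>2) \<le> (norm (plain_fourier f \<omega>))\<^sup>2" for n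
    proof (rule AE_I2)
      fix \<omega> :: 'a
      show "norm (gaussian (\<epsilon> n *\<^sub>R \<omega>) * (norm (plain_fourier f \<omega>))\<^sup>2) \<le> (norm (plain_fourier f \<omega>))\<^sup>2"
        using mult_right_mono[OF gaussian_le_1[of "\<epsilon> n *\<^sub>R \<omega>"], of "(norm (plain_fourier f \<omega>))\<^sup>2"]
          gaussian_pos[of "\<epsilon> n *\<^sub>R \<omega>"] by (simp add: abs_mult)
    qed
  qed measurable
  then have "(\<integral>\<omega>. (norm (plain_fourier f \<omega>))\<^sup>2 \<partial>lborel) = N * (c * c)"
    using LIMSEQ_unique[OF Xlim] by simp
  then show "(L2_norm lborel (plain_fourier f))\<^sup>2 = (2 * pi) powr DIM('a) * (L2_norm lborel f)\<^sup>2"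
    unfolding L2_norm_sq c2 by (simp add: N_def L2_norm_sq)
qed

section \<open>The Fourier transform as a unitary operator\<close>

lemma fourier_integral_eq: "fourier_integral f \<omega> = (2 * pi) powr (- real DIM('a) / 2) *\<^sub>R plain_fourier f \<omega>"
  for \<omega> :: "'a::euclidean_space"
  by (simp add: fourier_integral_def plain_fourier_def wave_def)

text \<open>The dense subspace \<open>L\<^sup>1 \<inter> L\<^sup>2\<close>, on which the transform is given by an integral.\<close>

definition fourier_domain :: "('a::euclidean_space \<Rightarrow> 'b::{complex_hilbert_space, second_countable_topology}) set"
  where "fourier_domain = {f \<in> L2_fun lborel. integrable lborel f}"

lemma
  fixes f :: "'a::euclidean_space \<Rightarrow> 'b::{complex_hilbert_space, second_countable_topology}"
  assumes f: "f \<in> fourier_domain"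
  shows fourier_integral_L2: "fourier_integral f \<in> L2_fun lborel"
    and L2_norm_fourier_integral: "L2_norm lborel (fourier_integral f) = L2_norm lborel f"
proof -
  define k where "k = (2 * pi) powr (- real DIM('a) / 2)"
  have f': "integrable lborel f" "f \<in> L2_fun lborel" using f by (auto simp: fourier_domain_def)
  have eq: "fourier_integral f = (\<lambda>\<omega>. k *\<^sub>R plain_fourier f \<omega>)"
    by (simp add: fourier_integral_eq[abs_def] k_def)
  show "fourier_integral f \<in> L2_fun lborel"
    unfolding eq scaleR_scaleC by (intro L2_fun_scaleC plain_fourier_L2 f')
  have k: "0 < k" "k * k * (2 * pi) powr DIM('a) = 1"
    by (simp_all add: k_def powr_add[symmetric])
  have "(L2_norm lborel (fourier_integral f))\<^sup>2 = k * k * (L2_norm lborel (plain_fourier f))\<^sup>2"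
    unfolding eq L2_norm_scaleR using k by (simp add: power_mult_distrib power2_eq_square)
  also have "\<dots> = (L2_norm lborel f)\<^sup>2"
    unfolding L2_norm_plain_fourier[OF f'] using k(2) by (simp add: mult.assoc[symmetric])
  finally show "L2_norm lborel (fourier_integral f) = L2_norm lborel f"
    by (simp add: power2_eq_iff_nonneg L2_norm_nonneg)
qed

lemma fourier_integral_cong_AE:
  fixes f g :: "'a::euclidean_space \<Rightarrow> 'b::{complex_hilbert_space, second_countable_topology}"
  assumes [measurable]: "f \<in> borel_measurable borel" "g \<in> borel_measurable borel"
    and eq: "AE x in lborel. f x = g x"
  shows "fourier_integral f = fourier_integral g"
proof
  fix \<omega>
  have "plain_fourier f \<omega> = plain_fourier g \<omega>"
    unfolding plain_fourier_def by (rule integral_cong_AE) (use eq in \<open>auto elim: eventually_mono\<close>)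
  then show "fourier_integral f \<omega> = fourier_integral g \<omega>" by (simp add: fourier_integral_eq)
qed

lemma fourier_integral_linear:
  fixes f g :: "'a::euclidean_space \<Rightarrow> 'b::{complex_hilbert_space, second_countable_topology}"
  assumes f: "integrable lborel f" and g: "integrable lborel g"
  shows "fourier_integral (\<lambda>x. f x + g x) = (\<lambda>\<omega>. fourier_integral f \<omega> + fourier_integral g \<omega>)"
    and "fourier_integral (\<lambda>x. f x - g x) = (\<lambda>\<omega>. fourier_integral f \<omega> - fourier_integral g \<omega>)"
proof -
  note int = wave_integrable[OF f] wave_integrable[OF g]
  show "fourier_integral (\<lambda>x. f x + g x) = (\<lambda>\<omega>. fourier_integral f \<omega> + fourier_integral g \<omega>)"
    "fourier_integral (\<lambda>x. f x - g x) = (\<lambda>\<omega>. fourier_integral f \<omega> - fourier_integral g \<omega>)"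
    using int by (auto simp: fourier_integral_eq plain_fourier_def scaleC_add_right scaleC_diff_right scaleR_add_right scaleR_diff_right)
qed

lemma fourier_integral_scaleC:
  fixes f :: "'a::euclidean_space \<Rightarrow> 'b::{complex_hilbert_space, second_countable_topology}"
  assumes f: "integrable lborel f"
  shows "fourier_integral (\<lambda>x. c *\<^sub>C f x) = (\<lambda>\<omega>. c *\<^sub>C fourier_integral f \<omega>)"
proof -
  have "plain_fourier (\<lambda>x. c *\<^sub>C f x) \<omega> = c *\<^sub>C plain_fourier f \<omega>" for \<omega>
  proof -
    have "plain_fourier (\<lambda>x. c *\<^sub>C f x) \<omega> = (\<integral>x. c *\<^sub>C (wave \<omega> x *\<^sub>C f x) \<partial>lborel)"
      unfolding plain_fourier_def scaleC_scaleC by (simp only: mult.commute)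
    then show ?thesis unfolding plain_fourier_def integral_bounded_linear[OF bounded_linear_scaleC wave_integrable[OF f]] .
  qed
  then show "fourier_integral (\<lambda>x. c *\<^sub>C f x) = (\<lambda>\<omega>. c *\<^sub>C fourier_integral f \<omega>)"
    by (simp add: fourier_integral_eq fun_eq_iff scaleR_scaleC scaleC_scaleC mult.commute)
qed

text \<open>Fubini's theorem; conjugation of the wave turns into a reflection of its argument.\<close>

lemma fourier_integral_adjoint:
  fixes f g :: "'a::euclidean_space \<Rightarrow> 'b::{complex_hilbert_space, second_countable_topology}"
  assumes f: "integrable lborel f" and g: "integrable lborel g"
  shows "(\<integral>\<omega>. cinner (fourier_integral f \<omega>) (g \<omega>) \<partial>lborel) = (\<integral>x. cinner (f x) (fourier_integral g (- x)) \<partial>lborel)"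
proof -
  have [measurable]: "f \<in> borel_measurable borel" "g \<in> borel_measurable borel" using f g by auto
  have "(\<integral>\<omega>. cinner (plain_fourier f \<omega>) (g \<omega>) \<partial>lborel) = (\<integral>\<omega>. \<integral>x. wave \<omega> x * cinner (f x) (g \<omega>) \<partial>lborel \<partial>lborel)"
    unfolding plain_fourier_def cinner_scaleC_left[symmetric]
    by (simp only: integral_bounded_linear[OF bounded_linear_cinner_left wave_integrable[OF f]])
  also have "\<dots> = (\<integral>x. \<integral>\<omega>. wave \<omega> x * cinner (f x) (g \<omega>) \<partial>lborel \<partial>lborel)"
  proof (rule Fubini_majorized)
    show "norm (wave \<omega> x * cinner (f x) (g \<omega>)) \<le> norm (f x) * norm (g \<omega>)" for \<omega> x :: 'a
      using cinner_Cauchy_Schwarz[of "f x" "g \<omega>"] by (simp add: norm_mult)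
    show "integrable lborel (\<lambda>x. norm (f x) * norm (g \<omega>))" for \<omega> using f by simp
    show "(\<integral>x. norm (f x) * norm (g \<omega>) \<partial>lborel) \<le> (\<integral>x. norm (f x) \<partial>lborel) * norm (g \<omega>)" for \<omega> using f by simp
    show "integrable lborel (\<lambda>\<omega>. (\<integral>x. norm (f x) \<partial>lborel) * norm (g \<omega>))" using g by simp
  qed measurable
  also have "\<dots> = (\<integral>x. cinner (f x) (plain_fourier g (- x)) \<partial>lborel)"
  proof (intro Bochner_Integration.integral_cong refl)
    fix x
    have "cinner (f x) (plain_fourier g (- x)) = (\<integral>\<omega>. cinner (f x) (wave (- x) \<omega> *\<^sub>C g \<omega>) \<partial>lborel)"
      unfolding plain_fourier_def
      by (rule integral_bounded_linear[OF bounded_linear_cinner_right wave_integrable[OF g], symmetric])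
    also have "\<dots> = (\<integral>\<omega>. wave \<omega> x * cinner (f x) (g \<omega>) \<partial>lborel)"
      unfolding cinner_scaleC_right wave_commute[of "- x"] cnj_wave by simp
    finally show "(\<integral>\<omega>. wave \<omega> x * cinner (f x) (g \<omega>) \<partial>lborel) = cinner (f x) (plain_fourier g (- x))" ..
  qed
  finally show ?thesis
    by (simp add: fourier_integral_eq cinner_scaleR_left cinner_scaleR_right)
qed

lemma abs_L2_norm: "f \<in> L2_fun lborel \<Longrightarrow> norm (abs_L2 f) = L2_norm lborel f"
  by (simp add: norm_L2.abs_eq L2_eq_refl)

lemma abs_L2_linear:
  assumes "f \<in> L2_fun lborel" "g \<in> L2_fun lborel"
  shows "abs_L2 (\<lambda>x. f x + g x) = abs_L2 f + abs_L2 g" "abs_L2 (\<lambda>x. f x - g x) = abs_L2 f - abs_L2 g"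
  using assms by (simp_all add: plus_L2.abs_eq minus_L2.abs_eq L2_eq_refl)

lemma abs_L2_scaleC: "f \<in> L2_fun lborel \<Longrightarrow> abs_L2 (\<lambda>x. c *\<^sub>C f x) = c *\<^sub>C abs_L2 f"
  by (simp add: scaleC_L2.abs_eq L2_eq_refl)

lemma abs_L2_cong: "L2_eq lborel f g \<Longrightarrow> abs_L2 f = abs_L2 g"
  by (rule Quotient_rel_abs[OF Quotient_L2])

lemma rep_abs_L2:
  assumes "f \<in> L2_fun lborel" shows "L2_eq lborel (rep_L2 (abs_L2 f)) f"
  using Quotient_rep_abs[OF Quotient_L2, of f] assms by (simp add: L2_eq_refl)

lemma rep_L2_linear:
  "L2_eq lborel (rep_L2 (f + g)) (\<lambda>x. rep_L2 f x + rep_L2 g x)"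
  "L2_eq lborel (rep_L2 (c *\<^sub>C f)) (\<lambda>x. c *\<^sub>C rep_L2 f x)"
  using rep_abs_L2[OF L2_fun_add[OF rep_L2_in[of f] rep_L2_in[of g]]]
    rep_abs_L2[OF L2_fun_scaleC[OF rep_L2_in[of f], of c]]
  by (simp_all add: abs_L2_linear abs_L2_scaleC rep_L2_in abs_rep_L2)

definition ball_cut :: "nat \<Rightarrow> ('a::euclidean_space \<Rightarrow> 'b::{complex_hilbert_space, second_countable_topology}) \<Rightarrow> 'a \<Rightarrow> 'b"
  where "ball_cut n f x = indicator (cball 0 (real n)) x *\<^sub>R f x"

lemma ball_cut_domain:
  fixes f :: "'a::euclidean_space \<Rightarrow> 'b::{complex_hilbert_space, second_countable_topology}"
  assumes f: "f \<in> L2_fun lborel" shows "ball_cut n f \<in> fourier_domain"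
proof -
  have [measurable]: "f \<in> borel_measurable borel" using L2_funD[OF f] by simp
  have m: "ball_cut n f \<in> borel_measurable borel"
    unfolding ball_cut_def by (intro borel_measurable_scaleR borel_measurable_indicator) auto
  have "integrable lborel (\<lambda>x. (norm (ball_cut n f x))\<^sup>2)"
    by (rule integrable_majorized[OF L2_fun_integrable[OF f]]) (use m in \<open>auto simp: ball_cut_def indicator_def\<close>)
  then have "ball_cut n f \<in> L2_fun lborel" using m by (simp add: L2_fun_def)
  moreover have "integrable lborel (ball_cut n f)"
  proof (rule integrable_majorized)
    have "emeasure lborel (cball (0::'a) (real n)) < \<infinity>"
      using emeasure_lborel_cball_finite by blast
    then show "integrable lborel (\<lambda>x. indicator (cball 0 (real n)) x + (norm (f x))\<^sup>2 :: real)"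
      using L2_fun_integrable[OF f] by simp
    show "norm (ball_cut n f x) \<le> indicator (cball 0 (real n)) x + (norm (f x))\<^sup>2" for x
    proof -
      have "0 \<le> (norm (f x) - 1)\<^sup>2 + 1 + (norm (f x))\<^sup>2" by simp
      then have "norm (f x) \<le> 1 + (norm (f x))\<^sup>2" by (simp add: power2_eq_square algebra_simps)
      then show ?thesis by (auto simp: ball_cut_def indicator_def)
    qed
  qed (use m in simp)
  ultimately show ?thesis by (simp add: fourier_domain_def)
qed

lemma domain_L2: "f \<in> fourier_domain \<Longrightarrow> f \<in> L2_fun lborel"
  and domain_integrable: "f \<in> fourier_domain \<Longrightarrow> integrable lborel f"
  by (auto simp: fourier_domain_def)

lemma ball_cut_tendsto:
  fixes f :: "('a::euclidean_space, 'b::{complex_hilbert_space, second_countable_topology}) L2"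
  shows "(\<lambda>n. abs_L2 (ball_cut n (rep_L2 f))) \<longlonglongrightarrow> f"
proof -
  note g = rep_L2_in[of f]
  have "(\<lambda>n. abs_L2 (ball_cut n (rep_L2 f))) \<longlonglongrightarrow> abs_L2 (rep_L2 f)"
  proof (rule abs_L2_tendsto[OF domain_L2[OF ball_cut_domain[OF g]] g L2_fun_integrable[OF g]])
    fix x :: 'a
    obtain N :: nat where N: "norm x \<le> real N" using real_arch_simple by blast
    have "\<forall>\<^sub>F n in sequentially. rep_L2 f x = ball_cut n (rep_L2 f) x"
      using eventually_ge_at_top[of N] by eventually_elim (use N in \<open>simp add: ball_cut_def\<close>)
    then show "(\<lambda>n. ball_cut n (rep_L2 f) x) \<longlonglongrightarrow> rep_L2 f x" by (rule Lim_transform_eventually[OF tendsto_const])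
  qed (auto simp: ball_cut_def indicator_def)
  then show ?thesis by (simp add: abs_rep_L2)
qed

definition fourier_pre :: "('a::euclidean_space \<Rightarrow> 'b::{complex_hilbert_space, second_countable_topology}) \<Rightarrow> ('a, 'b) L2"
  where "fourier_pre f = abs_L2 (fourier_integral f)"

lemma fourier_pre_linear:
  assumes "f \<in> fourier_domain" "g \<in> fourier_domain"
  shows "fourier_pre (\<lambda>x. f x + g x) = fourier_pre f + fourier_pre g"
    "fourier_pre (\<lambda>x. f x - g x) = fourier_pre f - fourier_pre g"
  using assms by (simp_all add: fourier_pre_def fourier_integral_linear domain_integrable
      abs_L2_linear fourier_integral_L2)

lemma fourier_pre_scaleC: "f \<in> fourier_domain \<Longrightarrow> fourier_pre (\<lambda>x. c *\<^sub>C f x) = c *\<^sub>C fourier_pre f"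
  by (simp add: fourier_pre_def fourier_integral_scaleC domain_integrable abs_L2_scaleC fourier_integral_L2)

lemma norm_fourier_pre: "f \<in> fourier_domain \<Longrightarrow> norm (fourier_pre f) = norm (abs_L2 f)"
  by (simp add: fourier_pre_def abs_L2_norm fourier_integral_L2 L2_norm_fourier_integral domain_L2)

lemma norm_fourier_pre_diff:
  fixes f g :: "'a::euclidean_space \<Rightarrow> 'b::{complex_hilbert_space, second_countable_topology}"
  assumes f: "f \<in> fourier_domain" and g: "g \<in> fourier_domain"
  shows "norm (fourier_pre f - fourier_pre g) = norm (abs_L2 f - abs_L2 g)"
proof -
  have "(\<lambda>x. f x - g x) \<in> fourier_domain"
    using f g by (simp add: fourier_domain_def L2_fun_diff)
  from norm_fourier_pre[OF this] show ?thesis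
    using f g by (simp add: fourier_pre_linear abs_L2_linear domain_L2)
qed

lemma fourier_pre_cong:
  fixes f g :: "'a::euclidean_space \<Rightarrow> 'b::{complex_hilbert_space, second_countable_topology}"
  assumes "L2_eq lborel f g" shows "fourier_pre f = fourier_pre g"
proof -
  have "f \<in> borel_measurable borel" "g \<in> borel_measurable borel" "AE x in lborel. f x = g x"
    using assms L2_funD[of f lborel] L2_funD[of g lborel] by (auto simp: L2_eq_def)
  then show ?thesis unfolding fourier_pre_def by (simp only: fourier_integral_cong_AE[of f g])
qed

lemma L2_eq_ball_cut:
  assumes "L2_eq lborel f g" shows "L2_eq lborel (ball_cut n f) (ball_cut n g)"
proof -
  have "AE x in lborel. f x = g x" using assms by (simp add: L2_eq_def)
  then have "AE x in lborel. ball_cut n f x = ball_cut n g x" by eventually_elim (simp add: ball_cut_def)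
  then show ?thesis using assms by (simp add: L2_eq_def domain_L2 ball_cut_domain)
qed

text \<open>The extension by continuity, along truncations to balls.\<close>

definition fourier_operator :: "('a::euclidean_space, 'b::{complex_hilbert_space, second_countable_topology}) L2 \<Rightarrow> ('a, 'b) L2"
  where "fourier_operator f = lim (\<lambda>n. fourier_pre (ball_cut n (rep_L2 f)))"

lemma fourier_operator_tendsto:
  fixes f :: "('a::euclidean_space, 'b::{complex_hilbert_space, second_countable_topology}) L2"
  shows "(\<lambda>n. fourier_pre (ball_cut n (rep_L2 f))) \<longlonglongrightarrow> fourier_operator f"
proof -
  have d: "ball_cut n (rep_L2 f) \<in> fourier_domain" for n by (rule ball_cut_domain[OF rep_L2_in])
  have "Cauchy (\<lambda>n. abs_L2 (ball_cut n (rep_L2 f)))" using ball_cut_tendsto by (rule LIMSEQ_imp_Cauchy)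
  then have "Cauchy (\<lambda>n. fourier_pre (ball_cut n (rep_L2 f)))"
    unfolding Cauchy_def dist_norm by (simp add: norm_fourier_pre_diff d)
  then show ?thesis unfolding fourier_operator_def by (simp add: Cauchy_convergent_iff convergent_LIMSEQ_iff)
qed

lemma fourier_operator_on_domain:
  fixes f :: "'a::euclidean_space \<Rightarrow> 'b::{complex_hilbert_space, second_countable_topology}"
  assumes f: "f \<in> fourier_domain" shows "fourier_operator (abs_L2 f) = fourier_pre f"
proof -
  let ?f = "abs_L2 f"
  have d: "ball_cut n (rep_L2 ?f) \<in> fourier_domain" for n by (rule ball_cut_domain[OF rep_L2_in])
  have "(\<lambda>n. norm (fourier_pre (ball_cut n (rep_L2 ?f)) - fourier_pre f)) \<longlonglongrightarrow> 0"
    unfolding norm_fourier_pre_diff[OF d f] by (rule tendsto_norm_zero[OF LIM_zero[OF ball_cut_tendsto]])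
  then have "(\<lambda>n. fourier_pre (ball_cut n (rep_L2 ?f))) \<longlonglongrightarrow> fourier_pre f"
    by (rule LIM_zero_cancel[OF tendsto_norm_zero_cancel])
  then show ?thesis using LIMSEQ_unique[OF fourier_operator_tendsto] by blast
qed

lemma norm_fourier_operator:
  fixes f :: "('a::euclidean_space, 'b::{complex_hilbert_space, second_countable_topology}) L2"
  shows "norm (fourier_operator f) = norm f"
proof -
  have "(\<lambda>n. norm (fourier_pre (ball_cut n (rep_L2 f)))) \<longlonglongrightarrow> norm (fourier_operator f)"
    by (intro tendsto_norm fourier_operator_tendsto)
  moreover have "(\<lambda>n. norm (fourier_pre (ball_cut n (rep_L2 f)))) \<longlonglongrightarrow> norm f"
    unfolding norm_fourier_pre[OF ball_cut_domain[OF rep_L2_in]] by (intro tendsto_norm ball_cut_tendsto)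
  ultimately show ?thesis by (rule LIMSEQ_unique)
qed

lemma fourier_operator_add:
  fixes f g :: "('a::euclidean_space, 'b::{complex_hilbert_space, second_countable_topology}) L2"
  shows "fourier_operator (f + g) = fourier_operator f + fourier_operator g"
proof -
  have "fourier_pre (ball_cut n (rep_L2 (f + g))) = fourier_pre (ball_cut n (rep_L2 f)) + fourier_pre (ball_cut n (rep_L2 g))" for n
  proof -
    have "fourier_pre (ball_cut n (rep_L2 (f + g))) = fourier_pre (ball_cut n (\<lambda>x. rep_L2 f x + rep_L2 g x))"
      by (intro fourier_pre_cong L2_eq_ball_cut rep_L2_linear)
    also have "ball_cut n (\<lambda>x. rep_L2 f x + rep_L2 g x) = (\<lambda>x. ball_cut n (rep_L2 f) x + ball_cut n (rep_L2 g) x)"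
      by (simp add: ball_cut_def fun_eq_iff scaleR_add_right)
    finally show ?thesis by (simp add: fourier_pre_linear ball_cut_domain rep_L2_in)
  qed
  then show ?thesis
    using LIMSEQ_unique[OF fourier_operator_tendsto[of "f + g"]]
      tendsto_add[OF fourier_operator_tendsto[of f] fourier_operator_tendsto[of g]] by simp
qed

lemma fourier_operator_scaleC:
  fixes f :: "('a::euclidean_space, 'b::{complex_hilbert_space, second_countable_topology}) L2"
  shows "fourier_operator (c *\<^sub>C f) = c *\<^sub>C fourier_operator f"
proof -
  have "fourier_pre (ball_cut n (rep_L2 (c *\<^sub>C f))) = c *\<^sub>C fourier_pre (ball_cut n (rep_L2 f))" for n
  proof -
    have "fourier_pre (ball_cut n (rep_L2 (c *\<^sub>C f))) = fourier_pre (ball_cut n (\<lambda>x. c *\<^sub>C rep_L2 f x))"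
      by (intro fourier_pre_cong L2_eq_ball_cut rep_L2_linear)
    also have "ball_cut n (\<lambda>x. c *\<^sub>C rep_L2 f x) = (\<lambda>x. c *\<^sub>C ball_cut n (rep_L2 f) x)"
      by (simp add: ball_cut_def fun_eq_iff scaleR_scaleC scaleC_scaleC mult.commute)
    finally show ?thesis by (simp add: fourier_pre_scaleC ball_cut_domain rep_L2_in)
  qed
  then show ?thesis
    using LIMSEQ_unique[OF fourier_operator_tendsto[of "c *\<^sub>C f"]]
      bounded_linear.tendsto[OF bounded_linear_scaleC fourier_operator_tendsto[of f], of c] by simp
qed

lemma lborel_distr_uminus: "distr lborel borel (uminus :: 'a \<Rightarrow> 'a) = (lborel :: 'a::euclidean_space measure)"
  using lborel_affine[of "-1" "0::'a"] by (simp add: density_1)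

lemma L2_fun_reflect:
  fixes f :: "'a::euclidean_space \<Rightarrow> 'b::{complex_hilbert_space, second_countable_topology}"
  assumes f: "f \<in> L2_fun lborel" shows "(\<lambda>x. f (- x)) \<in> L2_fun lborel"
proof -
  have [measurable]: "f \<in> borel_measurable borel" using L2_funD[OF f] by simp
  have "integrable (distr lborel borel (uminus :: 'a \<Rightarrow> 'a)) (\<lambda>x. (norm (f x))\<^sup>2)"
    unfolding lborel_distr_uminus by (rule L2_fun_integrable[OF f])
  then show ?thesis by (subst (asm) integrable_distr_eq) (auto simp: L2_fun_def)
qed

lift_definition reflect :: "('a::euclidean_space, 'b::{complex_hilbert_space, second_countable_topology}) L2 \<Rightarrow> ('a, 'b) L2"
  is "\<lambda>f x. f (- x)"
proof -
  fix f g :: "'a \<Rightarrow> 'b" assume fg: "L2_eq lborel f g"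
  have [measurable]: "f \<in> borel_measurable borel" "g \<in> borel_measurable borel"
    using fg L2_funD[of f lborel] L2_funD[of g lborel] by (auto simp: L2_eq_def)
  have "AE x in distr lborel borel (uminus :: 'a \<Rightarrow> 'a). f x = g x"
    unfolding lborel_distr_uminus using fg by (simp add: L2_eq_def)
  then have "AE x in lborel. f (- x) = g (- x)" by (subst (asm) AE_distr_iff) auto
  then show "L2_eq lborel (\<lambda>x. f (- x)) (\<lambda>x. g (- x))" using fg by (simp add: L2_eq_def L2_fun_reflect)
qed

lemma norm_reflect: "norm (reflect f) = norm f"
proof (transfer)
  fix f :: "'a \<Rightarrow> 'b" assume "L2_eq lborel f f"
  then have f: "f \<in> L2_fun lborel" by (simp add: L2_eq_refl)
  have [measurable]: "f \<in> borel_measurable borel" using L2_funD[OF f] by simp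
  have "(\<integral>x. (norm (f x))\<^sup>2 \<partial>distr lborel borel (uminus :: 'a \<Rightarrow> 'a)) = (\<integral>x. (norm (f (- x)))\<^sup>2 \<partial>lborel)"
    by (subst integral_distr) auto
  then show "L2_norm lborel (\<lambda>x. f (- x)) = L2_norm lborel f" by (simp add: lborel_distr_uminus L2_norm_def)
qed

lemma reflect_diff: "reflect f - reflect g = reflect (f - g)"
  by transfer (auto intro!: L2_eqI L2_fun_diff L2_fun_reflect simp: L2_eq_refl)

lemma reflect_tendsto:
  assumes "f \<longlonglongrightarrow> g" shows "(\<lambda>n. reflect (f n)) \<longlonglongrightarrow> reflect g"
proof -
  have "(\<lambda>n. norm (reflect (f n) - reflect g)) \<longlonglongrightarrow> 0"
    unfolding reflect_diff norm_reflect by (rule tendsto_norm_zero[OF LIM_zero[OF assms]])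
  then show ?thesis by (rule LIM_zero_cancel[OF tendsto_norm_zero_cancel])
qed

lemma fourier_pre_adjoint:
  fixes f g :: "'a::euclidean_space \<Rightarrow> 'b::{complex_hilbert_space, second_countable_topology}"
  assumes f: "f \<in> fourier_domain" and g: "g \<in> fourier_domain"
  shows "cinner (fourier_pre f) (abs_L2 g) = cinner (abs_L2 f) (reflect (fourier_pre g))"
proof -
  have r: "reflect (fourier_pre g) = abs_L2 (\<lambda>x. fourier_integral g (- x))"
    unfolding fourier_pre_def by (rule reflect.abs_eq) (simp add: L2_eq_refl fourier_integral_L2 g)
  have "(\<lambda>x. fourier_integral g (- x)) \<in> L2_fun lborel" by (intro L2_fun_reflect fourier_integral_L2 g)
  then have "cinner (abs_L2 f) (reflect (fourier_pre g)) = L2_cinner lborel f (\<lambda>x. fourier_integral g (- x))"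
    unfolding r by (intro cinner_L2.abs_eq) (simp_all add: L2_eq_refl domain_L2 f)
  moreover have "cinner (fourier_pre f) (abs_L2 g) = L2_cinner lborel (fourier_integral f) g"
    unfolding fourier_pre_def
    by (intro cinner_L2.abs_eq) (simp_all add: L2_eq_refl domain_L2 fourier_integral_L2 f g)
  ultimately show ?thesis
    unfolding L2_cinner_def by (simp add: fourier_integral_adjoint domain_integrable f g)
qed

lemma fourier_operator_adjoint:
  fixes f g :: "('a::euclidean_space, 'b::{complex_hilbert_space, second_countable_topology}) L2"
  shows "cinner (fourier_operator f) g = cinner f (reflect (fourier_operator g))"
proof (rule LIMSEQ_unique)
  have d: "ball_cut n (rep_L2 h) \<in> fourier_domain" for n and h :: "('a, 'b) L2" by (rule ball_cut_domain[OF rep_L2_in])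
  show "(\<lambda>n. cinner (fourier_pre (ball_cut n (rep_L2 f))) (abs_L2 (ball_cut n (rep_L2 g)))) \<longlonglongrightarrow> cinner (fourier_operator f) g"
    by (intro tendsto_cinner fourier_operator_tendsto ball_cut_tendsto)
  show "(\<lambda>n. cinner (fourier_pre (ball_cut n (rep_L2 f))) (abs_L2 (ball_cut n (rep_L2 g)))) \<longlonglongrightarrow> cinner f (reflect (fourier_operator g))"
    unfolding fourier_pre_adjoint[OF d d]
    by (intro tendsto_cinner reflect_tendsto fourier_operator_tendsto ball_cut_tendsto)
qed

text \<open>The transform \<open>F\<close> and its adjoint are both isometric. With \<open>f\<close> the image of \<open>g\<close> under the adjoint,
  \<open>F f\<close> and \<open>g\<close> have the same norm and \<open>cinner (F f) g = (norm g)\<^sup>2\<close>, which forces \<open>F f = g\<close>.\<close>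

lemma unitary_fourier_operator:
  "unitary (fourier_operator :: ('a::euclidean_space, 'b::{complex_hilbert_space, second_countable_topology}) L2 \<Rightarrow> ('a, 'b) L2)"
proof -
  have "bounded_linear (fourier_operator :: ('a, 'b) L2 \<Rightarrow> ('a, 'b) L2)"
  proof (rule bounded_linear_intro[where K=1])
    show "fourier_operator (r *\<^sub>R x) = r *\<^sub>R fourier_operator x" for r and x :: "('a, 'b) L2"
      by (simp only: scaleR_scaleC fourier_operator_scaleC)
  qed (simp_all add: fourier_operator_add norm_fourier_operator)
  then have lin: "bounded_clinear (fourier_operator :: ('a, 'b) L2 \<Rightarrow> ('a, 'b) L2)"
    by (simp add: bounded_clinear_def fourier_operator_scaleC)
  have "\<exists>f. g = fourier_operator f" for g :: "('a, 'b) L2"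
  proof -
    define f where "f = reflect (fourier_operator g)"
    have nf: "norm f = norm g" by (simp add: f_def norm_reflect norm_fourier_operator)
    have "cinner (fourier_operator f) g = of_real ((norm g)\<^sup>2)"
      unfolding fourier_operator_adjoint f_def[symmetric] cinner_self nf ..
    then have "(norm (fourier_operator f - g))\<^sup>2 = 0"
      unfolding norm_diff_sq norm_fourier_operator nf by simp
    then show ?thesis by (intro exI[of _ f]) simp
  qed
  then have "surj (fourier_operator :: ('a, 'b) L2 \<Rightarrow> ('a, 'b) L2)" unfolding surj_def by blast
  moreover have "cinner (fourier_operator x) (fourier_operator y) = cinner x y" for x y :: "('a, 'b) L2"
    unfolding cinner_polarization
    by (simp only: fourier_operator_add[symmetric] fourier_operator_scaleC[symmetric] norm_fourier_operator)
  ultimately show ?thesis using lin by (simp add: unitary_def)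
qed

text \<open>The operator constructed above agrees with the Fourier integral on integrable functions, and truncation shows that
  no other bounded linear operator does; so the definite description in \<open>fourier\<close> denotes it.\<close>

theorem unitary_fourier:
  "unitary (fourier :: ('a::euclidean_space, 'b::{complex_hilbert_space, second_countable_topology}) L2 \<Rightarrow> ('a, 'b) L2)"
proof -
  define P where "P F \<longleftrightarrow> unitary F \<and> (\<forall>f. integrable lborel (rep_L2 f) \<longrightarrow>
    (AE \<omega> in lborel. rep_L2 (F f) \<omega> = fourier_integral (rep_L2 f) \<omega>))" for F :: "('a, 'b) L2 \<Rightarrow> ('a, 'b) L2"
  have ext: "fourier_operator f = fourier_pre (rep_L2 f)" if "integrable lborel (rep_L2 f)" for f :: "('a, 'b) L2"
    using fourier_operator_on_domain[of "rep_L2 f"] that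
    by (simp add: fourier_domain_def rep_L2_in abs_rep_L2)
  have "P fourier_operator"
    unfolding P_def
  proof (intro conjI allI impI unitary_fourier_operator)
    fix f :: "('a, 'b) L2" assume f: "integrable lborel (rep_L2 f)"
    have "fourier_integral (rep_L2 f) \<in> L2_fun lborel"
      using f by (intro fourier_integral_L2) (simp add: fourier_domain_def rep_L2_in)
    from rep_abs_L2[OF this] show "AE \<omega> in lborel. rep_L2 (fourier_operator f) \<omega> = fourier_integral (rep_L2 f) \<omega>"
      by (simp add: ext[OF f] fourier_pre_def L2_eq_def)
  qed
  moreover have "F = fourier_operator" if F: "P F" for F
  proof
    fix f
    have bl: "bounded_clinear F" using F by (simp add: P_def unitary_def)
    have "F (abs_L2 (ball_cut n (rep_L2 f))) = fourier_operator (abs_L2 (ball_cut n (rep_L2 f)))" for n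
    proof -
      let ?g = "abs_L2 (ball_cut n (rep_L2 f))"
      have d: "ball_cut n (rep_L2 f) \<in> fourier_domain" by (rule ball_cut_domain[OF rep_L2_in])
      have eq: "L2_eq lborel (rep_L2 ?g) (ball_cut n (rep_L2 f))" by (rule rep_abs_L2[OF domain_L2[OF d]])
      have "rep_L2 ?g \<in> borel_measurable lborel" using L2_funD[OF rep_L2_in[of ?g]] .
      then have int: "integrable lborel (rep_L2 ?g)"
        using domain_integrable[OF d] eq by (subst integrable_cong_AE[where g="ball_cut n (rep_L2 f)"])
          (auto simp: L2_eq_def L2_fun_def)
      have "L2_eq lborel (rep_L2 (F ?g)) (fourier_integral (rep_L2 ?g))"
        using F int fourier_integral_L2[of "rep_L2 ?g"] unfolding P_def L2_eq_def
        by (simp add: rep_L2_in fourier_domain_def)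
      from abs_L2_cong[OF this] show ?thesis by (simp add: abs_rep_L2 ext[OF int] fourier_pre_def)
    qed
    moreover have "(\<lambda>n. F (abs_L2 (ball_cut n (rep_L2 f)))) \<longlonglongrightarrow> F f"
      by (rule bounded_linear.tendsto[OF bounded_clinearD(1)[OF bl] ball_cut_tendsto])
    moreover have "(\<lambda>n. fourier_operator (abs_L2 (ball_cut n (rep_L2 f)))) \<longlonglongrightarrow> fourier_operator f"
      using unitary_fourier_operator unfolding unitary_def
      by (intro bounded_linear.tendsto[OF bounded_clinearD(1) ball_cut_tendsto]) blast
    ultimately show "F f = fourier_operator f" using LIMSEQ_unique by simp
  qed
  ultimately have "(THE F. P F) = fourier_operator" by (rule the_equality)
  then show ?thesis using unitary_fourier_operator unfolding fourier_def P_def by simp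
qed

section \<open>Band-limited functions\<close>

definition bandlimited :: "real \<Rightarrow> ('a::euclidean_space, complex ^ 'n) L2 \<Rightarrow> bool"
  where "bandlimited R f \<longleftrightarrow> (AE \<omega> in lborel. R < norm \<omega> \<longrightarrow> rep_L2 (fourier f) \<omega> = 0)"

lemma norm_matrix_vector_le:
  fixes A :: "complex ^ 'n ^ 'p"
  shows "norm (A *v x) \<le> (\<Sum>i\<in>UNIV. \<Sum>j\<in>UNIV. norm (A $ i $ j)) * norm x"
proof -
  have "norm (A *v x) \<le> (\<Sum>i\<in>UNIV. norm ((A *v x) $ i))" by (simp add: norm_vec_def L2_set_le_sum)
  also have "\<dots> \<le> (\<Sum>i\<in>UNIV. \<Sum>j\<in>UNIV. norm (A $ i $ j) * norm x)"
    by (intro sum_mono) (auto simp: matrix_vector_mult_def norm_mult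
        intro!: order_trans[OF norm_sum] sum_mono mult_left_mono Finite_Cartesian_Product.norm_nth_le)
  finally show ?thesis by (simp add: sum_distrib_right)
qed

text \<open>A continuous symbol is bounded on every ball, so it acts boundedly on band-limited functions
  whatever its growth at infinity.\<close>

lemma symbol_bandlimited:
  fixes T :: "('a::euclidean_space, complex ^ 'n) L2 \<Rightarrow> ('a, complex ^ 'p) L2"
  assumes sym: "has_symbol D T Q" and Q: "continuous_on UNIV Q" and f: "bandlimited R f"
  shows "f \<in> D" "bandlimited R (T f)"
proof -
  define g where "g = rep_L2 (fourier f)"
  have g: "g \<in> L2_fun lborel" by (simp add: g_def rep_L2_in)
  have g0: "AE \<omega> in lborel. R < norm \<omega> \<longrightarrow> g \<omega> = 0" using f by (simp add: bandlimited_def g_def)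
  have [measurable]: "g \<in> borel_measurable borel" using L2_funD[OF g] by simp
  have [measurable]: "Q \<in> borel_measurable borel" by (rule borel_measurable_continuous_onI[OF Q])
  have mv: "continuous_on UNIV (\<lambda>p :: (complex ^ 'n ^ 'p) \<times> (complex ^ 'n). fst p *v snd p)"
    unfolding matrix_vector_mult_def by (intro continuous_intros)
  have meas: "(\<lambda>\<omega>. Q \<omega> *v g \<omega>) \<in> borel_measurable borel"
    by (rule borel_measurable_continuous_Pair[OF _ _ mv]) measurable
  define q where "q \<omega> = (\<Sum>i\<in>UNIV. \<Sum>j\<in>UNIV. norm (Q \<omega> $ i $ j))" for \<omega>
  have "continuous_on (cball 0 R) q"
    unfolding q_def by (intro continuous_intros continuous_on_subset[OF Q]) auto
  then have "bounded (q ` cball 0 R)" by (intro compact_imp_bounded compact_continuous_image) auto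
  then obtain K where "\<forall>y\<in>q ` cball 0 R. norm y \<le> K" unfolding bounded_iff by blast
  then have K: "\<bar>q \<omega>\<bar> \<le> K" if "norm \<omega> \<le> R" for \<omega> using that by (simp add: mem_cball_0)
  have "AE \<omega> in lborel. norm (Q \<omega> *v g \<omega>) \<le> \<bar>K\<bar> * norm (g \<omega>)"
    using g0
  proof eventually_elim
    case (elim \<omega>)
    show ?case
    proof (cases "R < norm \<omega>")
      case True
      then show ?thesis using elim by simp
    next
      case False
      have "norm (Q \<omega> *v g \<omega>) \<le> q \<omega> * norm (g \<omega>)" unfolding q_def by (rule norm_matrix_vector_le)
      also have "\<dots> \<le> \<bar>K\<bar> * norm (g \<omega>)" using K[of \<omega>] False by (intro mult_right_mono) auto
      finally show ?thesis .
    qed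
  qed
  then have bd: "AE \<omega> in lborel. norm ((norm (Q \<omega> *v g \<omega>))\<^sup>2) \<le> norm (K\<^sup>2 * (norm (g \<omega>))\<^sup>2)"
  proof eventually_elim
    case (elim \<omega>)
    from power_mono[OF elim norm_ge_zero, of 2] show ?case by (simp add: power_mult_distrib)
  qed
  have "integrable lborel (\<lambda>\<omega>. (norm (Q \<omega> *v g \<omega>))\<^sup>2)"
    by (rule Bochner_Integration.integrable_bound[OF integrable_mult_right[OF L2_fun_integrable[OF g]] _ bd])
      (use meas in measurable)
  then have L2: "(\<lambda>\<omega>. Q \<omega> *v g \<omega>) \<in> L2_fun lborel" using meas by (simp add: L2_fun_def)
  then show fD: "f \<in> D" using sym unfolding has_symbol_def g_def by blast
  have "AE \<omega> in lborel. rep_L2 (fourier (T f)) \<omega> = Q \<omega> *v g \<omega>"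
    using sym fD unfolding has_symbol_def g_def by blast
  then show "bandlimited R (T f)"
    unfolding bandlimited_def using g0 by eventually_elim simp
qed

text \<open>Truncations of the Fourier transform of \<open>u\<close> are again Fourier transforms because the transform is onto, and
  they converge because it is isometric.\<close>

lemma bandlimited_dense:
  fixes u :: "('a::euclidean_space, complex ^ 'n) L2"
  shows "\<exists>v. (\<forall>n. bandlimited (real n) (v n)) \<and> v \<longlonglongrightarrow> u"
proof -
  note F = unitary_fourier[where 'a='a and 'b="complex ^ 'n"]
  define h where "h n = ball_cut n (rep_L2 (fourier u))" for n
  have "\<exists>f. fourier f = abs_L2 (h n)" for n
    using F unfolding unitary_def by (metis surjD)
  then obtain v where v: "\<And>n. fourier (v n) = abs_L2 (h n)" by metis
  have rep: "AE \<omega> in lborel. rep_L2 (abs_L2 (h n)) \<omega> = h n \<omega>" for n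
    using rep_abs_L2[OF domain_L2[OF ball_cut_domain[OF rep_L2_in]], of n "fourier u"]
    by (simp add: L2_eq_def h_def)
  have "bandlimited (real n) (v n)" for n
    unfolding bandlimited_def v using rep[of n]
    by eventually_elim (auto simp: h_def ball_cut_def indicator_def)
  moreover have "v \<longlonglongrightarrow> u"
  proof -
    have lim: "(\<lambda>n. fourier (v n)) \<longlonglongrightarrow> fourier u" unfolding v h_def by (rule ball_cut_tendsto)
    have iso: "norm (fourier x) = norm x" for x :: "('a, complex ^ 'n) L2"
      using F by (simp add: unitary_def norm_eq_sqrt_cinner)
    have "bounded_clinear (fourier :: ('a, complex ^ 'n) L2 \<Rightarrow> ('a, complex ^ 'n) L2)"
      using F by (simp add: unitary_def)
    then have "norm (v n - u) = norm (fourier (v n) - fourier u)" for n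
      using iso[of "v n - u"] by (simp add: bounded_clinearD(4))
    moreover have "(\<lambda>n. norm (fourier (v n) - fourier u)) \<longlonglongrightarrow> 0"
      by (rule tendsto_norm_zero[OF LIM_zero[OF lim]])
    ultimately have "(\<lambda>n. norm (v n - u)) \<longlonglongrightarrow> 0" by simp
    then show ?thesis by (rule LIM_zero_cancel[OF tendsto_norm_zero_cancel])
  qed
  ultimately show ?thesis by blast
qed

text \<open>For band-limited \<open>u\<close> the vector \<open>B u\<close> and all its images under powers of \<open>A\<close> are band-limited, hence in
  the domain of \<open>A\<close>, so the orbit of \<open>u\<close> is smooth. General \<open>u\<close> are reached by density, which is possible since
  the conclusion concerns differences of bounded operators.\<close>

theorem alternating_if_relaxation:
  fixes D :: "(real ^ 's, complex ^ 'n) L2 set"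
    and A :: "(real ^ 's, complex ^ 'n) L2 \<Rightarrow> (real ^ 's, complex ^ 'n) L2"
    and B :: "(real ^ 's, complex ^ 'm) L2 \<Rightarrow> (real ^ 's, complex ^ 'n) L2"
    and C :: "(real ^ 's, complex ^ 'n) L2 \<Rightarrow> (real ^ 's, complex ^ 'm) L2"
  assumes sys: "LTSI_system D A S B C" and stable: "exponentially_stable S"
    and relax: "relaxation_type S B C"
  shows "alternating_operators (impulse_response S B C)"
proof -
  have gen: "generates D A S" and B: "bounded_clinear B" and C: "bounded_clinear C"
    using sys by (auto simp: LTSI_system_def)
  obtain QA QB where QA: "has_symbol D A QA" "continuous_on UNIV QA"
    and QB: "has_symbol UNIV B QB" "continuous_on UNIV QB"
    using sys by (auto simp: LTSI_system_def)
  obtain M \<alpha> where S: "decaying_response S M \<alpha>"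
    using C0_semigroup_decaying gen stable unfolding generates_def by blast
  obtain K where G: "decaying_response (impulse_response S B C) K \<alpha>"
    using impulse_response_decaying[OF S B C] by blast
  interpret S: decaying_response S M \<alpha> by fact
  interpret G: decaying_response "impulse_response S B C" K \<alpha> by fact
  let ?G = "impulse_response S B C"
  have cm: "completely_monotone ?G" using relax by (simp add: relaxation_type_def)
  have band: "alternating (\<lambda>t. Re (cinner (?G t u) u)) \<and> (\<forall>t>0. Im (cinner (?G t u) u) = 0)"
    if u: "bandlimited R u" for R u
  proof -
    define z where "z k = (A ^^ k) (B u)" for k
    have z: "bandlimited R (z k) \<and> z k \<in> D" for k
    proof (induction k)
      case 0
      show ?case using symbol_bandlimited[OF QB u] symbol_bandlimited(1)[OF QA] by (simp add: z_def)
    next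
      case (Suc k)
      have "bandlimited R (z (Suc k))"
        using symbol_bandlimited(2)[OF QA conjunct1[OF Suc.IH]] by (simp add: z_def)
      then show ?case using symbol_bandlimited(1)[OF QA] by blast
    qed
    have der: "((\<lambda>t. C (S t (z k))) has_vector_derivative C (S t (z (Suc k)))) (at t)" if "0 < t" for k t
      using S.generator_derivative[OF gen conjunct2[OF z[of k]] that]
      by (intro bounded_linear.has_vector_derivative[OF bounded_clinearD(1)[OF C]]) (simp add: z_def)
    show ?thesis
      using completely_monotone_smooth_vector[OF cm, of "\<lambda>k t. C (S t (z k))" u] der
      by (simp add: z_def impulse_response_def)
  qed
  show ?thesis
    unfolding alternating_operators_def
  proof (intro conjI allI impI)
    show "bounded_clinear (?G t)" if "0 < t" for t using G.bl that by simp
    fix u :: "(real ^ 's, complex ^ 'm) L2"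
    obtain v where v: "\<And>n. bandlimited (real n) (v n)" "v \<longlonglongrightarrow> u"
      using bandlimited_dense[of u] by blast
    have lim: "(\<lambda>n. cinner (?G t (v n)) (v n)) \<longlonglongrightarrow> cinner (?G t u) u" if "0 < t" for t
      using that by (intro tendsto_cinner bounded_linear.tendsto[OF bounded_clinearD(1)[OF G.bl]] v) simp
    show "Im (cinner (?G t u) u) = 0" if "0 < t" for t
      using tendsto_Im[OF lim[OF that]] band[OF v(1)] that by (simp add: LIMSEQ_const_iff)
    show "alternating (\<lambda>t. Re (cinner (?G t u) u))"
      by (rule alternating_limit[where F=sequentially and f="\<lambda>n t. Re (cinner (?G t (v n)) (v n))"])
        (use band[OF v(1)] lim in \<open>auto intro!: tendsto_Re always_eventually\<close>)
  qed
qed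

section \<open>Relaxation and the Hankel operator\<close>

theorem theorem6:
  fixes D :: "(real ^ 's, complex ^ 'n) L2 set"
    and A :: "(real ^ 's, complex ^ 'n) L2 \<Rightarrow> (real ^ 's, complex ^ 'n) L2"
    and S :: "real \<Rightarrow> (real ^ 's, complex ^ 'n) L2 \<Rightarrow> (real ^ 's, complex ^ 'n) L2"
    and B :: "(real ^ 's, complex ^ 'm) L2 \<Rightarrow> (real ^ 's, complex ^ 'n) L2"
    and C :: "(real ^ 's, complex ^ 'n) L2 \<Rightarrow> (real ^ 's, complex ^ 'm) L2"
  assumes "LTSI_system D A S B C"
    and "exponentially_stable S"
  shows "relaxation_type S B C \<longleftrightarrow> nonneg_operator UNIV (hankel_operator (impulse_response S B C))"
proof -
  have "C0_semigroup S" "bounded_clinear B" "bounded_clinear C"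
    using assms(1) by (auto simp: LTSI_system_def generates_def)
  then obtain M \<alpha> where "decaying_response (impulse_response S B C) M \<alpha>"
    using C0_semigroup_decaying[OF _ assms(2)] impulse_response_decaying by blast
  then interpret decaying_response "impulse_response S B C" M \<alpha> .
  show ?thesis
  proof
    assume "relaxation_type S B C"
    then have "alternating_operators (impulse_response S B C)"
      by (rule alternating_if_relaxation[OF assms])
    then show "nonneg_operator UNIV (hankel_operator (impulse_response S B C))"
      by (rule hankel_nonneg_if_alternating)
  next
    assume "nonneg_operator UNIV (hankel_operator (impulse_response S B C))"
    then have "alternating_operators (impulse_response S B C)" by (rule alternating_if_hankel_nonneg)
    then show "relaxation_type S B C"
      unfolding relaxation_type_def by (rule completely_monotone_if_alternating)
  qed
qed

end
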